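(* For any $a\in\mathbb{Z}_{>0}$ and all $m,n\in\mathbb{Z}_{\ge0}$, \[ \begin{aligned} u_{(a,2)}(m,n)=&\sum_{\frac a2<k\le a}\left\lceil\tfrac{2k-a}{2}\right\rceil\binom{2k-a}{\lceil\frac{2k-a}{2}\rceil}\binom{k}{2k-a}\binom{m}{k}\binom{n}{2}\\ &+\sum_{\frac a2+1<k\le a}\left\{\frac{2k-a}{2}\binom{2k-a-1}{\lceil\frac{2k-a-1}{2}\rceil}-2^{2k-a-2}\right\}\binom{k}{2k-a}\binom{m}{k}\binom{n}{1}, \end{aligned} \] where the sums run over integers $k$ and $\lceil x\rceil$ is the least integer $\ge x$.
   Context: Let $N^+=\mathbb{Z}_{\ge0}^2\setminus\{(0,0)\}$ and for $(a,b),(c,d)\in\mathbb{Z}^2$ put $\{(a,b),(c,d)\}=bc-ad$. Let $\mathfrak{g}=\bigoplus_{n\in N^+}\mathbb{Q}X_n$ be the Lie algebra with $[X_n,X_{n'}]=\{n,n'\}X_{n+n'}$, $\deg(a,b)=a+b$, $\mathfrak{g}^{\le l}=\mathfrak{g}/\bigoplus_{\deg n>l}\mathbb{Q}X_n$, $G^{\le l}=\exp(\mathfrak{g}^{\le l})$ (BCH product) and $G=\varprojlim G^{\le l}$; $\exp(X)^c=\exp(cX)$ for $c\in\mathbb{Q}$. Dilogarithm element: $[a,b]:=\exp\big(\sum_{j\ge1}\frac{(-1)^{j+1}}{j^2}X_{j(a,b)}\big)$. Total order on $N^+$: $(a,b)\le(c,d)$ iff $\{(a,b),(c,d)\}<0$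 or $(c,d)=k(a,b)$ with rational $k\ge1$; a product $\prod_{j}[a_j,b_j]^{u_j}$ is ordered if its indices strictly increase in this order (infinite products interpreted in the inverse limit). It is known that for $m,n\in\mathbb{Z}_{\ge0}$, $[0,1]^n[1,0]^m$ equals a unique ordered product $\prod_{(a,b)\in N^+}[a,b]^{u_{(a,b)}(m,n)}$, $u_{(a,b)}(m,n)\in\mathbb{Q}$; this defines $u_{(a,b)}(m,n)$. *)

theory Defs
  imports Complex_Main "HOL-Algebra.Group" "HOL-Library.Poly_Mapping" "HOL-Library.Product_Plus"
begin

definition Nplus :: "(nat \<times> nat) set" where
  "Nplus = UNIV - {(0, 0)}"

definition skew :: "nat \<times> nat \<Rightarrow> nat \<times> nat \<Rightarrow> int" where
  "skew p q = int (snd p) * int (fst q) - int (fst p) * int (snd q)"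

definition deg :: "nat \<times> nat \<Rightarrow> nat" where
  "deg p = fst p + snd p"

text \<open>
  Elements of the Lie algebra are the finitely supported families of rationals whose
  support lies in \<^const>\<open>Nplus\<close>; the basis vector \<open>X\<^sub>n\<close> is
  \<open>Poly_Mapping.single n 1\<close>.
\<close>

type_synonym lie = "(nat \<times> nat) \<Rightarrow>\<^sub>0 rat"

definition scale :: "rat \<Rightarrow> lie \<Rightarrow> lie" where
  "scale c x = Poly_Mapping.map ((*) c) x"

definition lie_bracket :: "lie \<Rightarrow> lie \<Rightarrow> lie" where
  "lie_bracket x y =
     (\<Sum>p\<in>Poly_Mapping.keys x. \<Sum>q\<in>Poly_Mapping.keys y.
        Poly_Mapping.single (p + q) (Poly_Mapping.lookup x p * Poly_Mapping.lookup y q * of_int (skew p q)))"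

text \<open>
  The quotient by the span of the \<open>X\<^sub>n\<close> with \<open>deg n > l\<close> is represented by the elements
  supported in degrees at most \<open>l\<close>; \<open>trunc l\<close> is the projection onto it.
\<close>

definition trunc :: "nat \<Rightarrow> lie \<Rightarrow> lie" where
  "trunc l x = (\<Sum>p\<in>{p \<in> Poly_Mapping.keys x. deg p \<le> l}. Poly_Mapping.single p (Poly_Mapping.lookup x p))"

definition lie_trunc :: "nat \<Rightarrow> lie set" where
  "lie_trunc l = {x. Poly_Mapping.keys x \<subseteq> {p \<in> Nplus. deg p \<le> l}}"

definition bracket_trunc :: "nat \<Rightarrow> lie \<Rightarrow> lie \<Rightarrow> lie" where
  "bracket_trunc l x y = trunc l (lie_bracket x y)"

fun nested_bracket :: "nat \<Rightarrow> lie list \<Rightarrow> lie" where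
  "nested_bracket l [] = 0"
| "nested_bracket l [x] = x"
| "nested_bracket l (x # y # zs) = bracket_trunc l x (nested_bracket l (y # zs))"

text \<open>
  The Baker--Campbell--Hausdorff series in Dynkin's form: the sum, over all nonempty lists
  \<open>(r\<^sub>1,s\<^sub>1),\<dots>,(r\<^sub>k,s\<^sub>k)\<close> of pairs with \<open>r\<^sub>i + s\<^sub>i > 0\<close>, of
  \<open>(-1)\<^bsup>k-1\<^esup> / (k \<cdot> (\<Sum>\<^sub>i (r\<^sub>i + s\<^sub>i)) \<cdot> \<Prod>\<^sub>i r\<^sub>i! s\<^sub>i!)\<close> times the right-nested bracket of
  the word \<open>x\<^bsup>r\<^sub>1\<^esup> y\<^bsup>s\<^sub>1\<^esup> \<dots> x\<^bsup>r\<^sub>k\<^esup> y\<^bsup>s\<^sub>k\<^esup>\<close>. Brackets of more than \<open>l\<close> elements vanish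
  in degrees at most \<open>l\<close>, so that only words of length at most \<open>l\<close> contribute.
\<close>

definition dynkin_size :: "(nat \<times> nat) list \<Rightarrow> nat" where
  "dynkin_size rs = sum_list (map (\<lambda>(r, s). r + s) rs)"

definition dynkin_indices :: "nat \<Rightarrow> (nat \<times> nat) list set" where
  "dynkin_indices l =
     {rs. rs \<noteq> [] \<and> (\<forall>(r, s)\<in>set rs. 0 < r + s) \<and> dynkin_size rs \<le> l}"

definition dynkin_coeff :: "(nat \<times> nat) list \<Rightarrow> rat" where
  "dynkin_coeff rs =
     (-1) ^ (length rs - 1) /
       (of_nat (length rs) * of_nat (dynkin_size rs) *
        prod_list (map (\<lambda>(r, s). fact r * fact s) rs))"

definition dynkin_word :: "lie \<Rightarrow> lie \<Rightarrow> (nat \<times> nat) list \<Rightarrow> lie list" where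
  "dynkin_word x y rs = concat (map (\<lambda>(r, s). replicate r x @ replicate s y) rs)"

definition bch :: "nat \<Rightarrow> lie \<Rightarrow> lie \<Rightarrow> lie" where
  "bch l x y =
     (\<Sum>rs\<in>dynkin_indices l.
        scale (dynkin_coeff rs) (nested_bracket l (dynkin_word x y rs)))"

lemma finite_dynkin_indices: "finite (dynkin_indices l)"
proof (rule finite_subset)
  have bound: "length rs \<le> dynkin_size rs \<and> set rs \<subseteq> {..dynkin_size rs} \<times> {..dynkin_size rs}"
    if "\<forall>(r, s)\<in>set rs. 0 < r + s" for rs
    using that by (induction rs) (force simp: dynkin_size_def)+
  show "dynkin_indices l \<subseteq> {rs. set rs \<subseteq> {..l} \<times> {..l} \<and> length rs \<le> l}"
    using bound unfolding dynkin_indices_def by fastforce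
  show "finite {rs. set rs \<subseteq> {..l} \<times> {..l} \<and> length rs \<le> l}"
    by (rule finite_lists_length_le) simp
qed

text \<open>
  The group \<open>exp (lie_trunc l)\<close>, with \<open>exp x\<close> represented by \<open>x\<close> itself, and the inverse limit
  of these groups, consisting of the compatible families.
\<close>

definition G_trunc :: "nat \<Rightarrow> lie monoid" where
  "G_trunc l = \<lparr>carrier = lie_trunc l, mult = bch l, one = 0\<rparr>"

definition G_lim :: "(nat \<Rightarrow> lie) monoid" where
  "G_lim =
     \<lparr>carrier = {g. \<forall>l. g l \<in> carrier (G_trunc l) \<and> trunc l (g (Suc l)) = g l},
      mult = (\<lambda>g h l. g l \<otimes>\<^bsub>G_trunc l\<^esub> h l),
      one = (\<lambda>l. \<one>\<^bsub>G_trunc l\<^esub>)\<rparr>"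

definition G_pow :: "(nat \<Rightarrow> lie) \<Rightarrow> rat \<Rightarrow> (nat \<Rightarrow> lie)" where
  "G_pow g c = (\<lambda>l. scale c (g l))"

text \<open>Terms with \<open>j > l\<close> have degree greater than \<open>l\<close>.\<close>

definition dilog :: "nat \<times> nat \<Rightarrow> (nat \<Rightarrow> lie)" where
  "dilog p = (\<lambda>l. trunc l
     (\<Sum>j\<in>{1..l}. Poly_Mapping.single (j * fst p, j * snd p) ((-1) ^ (j + 1) / of_nat j ^ 2)))"

definition Nplus_le :: "nat \<times> nat \<Rightarrow> nat \<times> nat \<Rightarrow> bool" where
  "Nplus_le p q \<longleftrightarrow> skew p q < 0 \<or>
     (\<exists>k::rat. 1 \<le> k \<and> of_nat (fst q) = k * of_nat (fst p) \<and> of_nat (snd q) = k * of_nat (snd p))"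

definition Nplus_less :: "nat \<times> nat \<Rightarrow> nat \<times> nat \<Rightarrow> bool" where
  "Nplus_less p q \<longleftrightarrow> Nplus_le p q \<and> p \<noteq> q"

text \<open>
  \<open>g\<close> is the infinite ordered product of the \<open>f p\<close>, \<open>p \<in> Nplus\<close>. It is used for \<open>f p\<close> a power
  of \<open>dilog p\<close>, whose component in \<open>G_trunc l\<close> is trivial when \<open>deg p > l\<close>, so that the component
  of the product in \<open>G_trunc l\<close> is the ordered product over the finitely many \<open>p\<close> of degree at
  most \<open>l\<close>.
\<close>

definition is_ordered_product ::
    "(nat \<times> nat \<Rightarrow> (nat \<Rightarrow> lie)) \<Rightarrow> (nat \<Rightarrow> lie) \<Rightarrow> bool" where
  "is_ordered_product f g \<longleftrightarrow>
     (\<forall>l. \<exists>ps. sorted_wrt Nplus_less ps \<and> set ps = {p \<in> Nplus. deg p \<le> l} \<and>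
        g l = foldr (mult (G_trunc l)) (map (\<lambda>p. f p l) ps) \<one>\<^bsub>G_trunc l\<^esub>)"

definition exponents :: "nat \<Rightarrow> nat \<Rightarrow> (nat \<times> nat \<Rightarrow> rat)" where
  "exponents m n =
     (THE u. u \<in> extensional Nplus \<and>
        is_ordered_product (\<lambda>p. G_pow (dilog p) (u p))
          (G_pow (dilog (0, 1)) (of_nat n) \<otimes>\<^bsub>G_lim\<^esub> G_pow (dilog (1, 0)) (of_nat m)))"

end

theory Submission
  imports Defs "HOL-Computational_Algebra.Formal_Power_Series"
begin

unbundle fps_syntax

text \<open>
  Let \<open>\<theta> = x d/dx\<close>. Modulo the ideal spanned by the \<open>X\<^sub>(\<^sub>a\<^sub>,\<^sub>b\<^sub>)\<close> with \<open>b \<ge> 3\<close>, the elements \<open>f = \<Sum> f\<^sub>a X\<^sub>(\<^sub>a\<^sub>,\<^sub>0\<^sub>)\<close> act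
  on the span of the \<open>X\<^sub>(\<^sub>a\<^sub>,\<^sub>b\<^sub>)\<close> with \<open>b\<close> fixed as multiplication by the power series \<open>-b \<theta>f\<close>. For
  \<open>f = log [1,0]\<close> this is \<open>-b log (1 + x)\<close>, so that moving \<open>[1,0]\<^sup>m\<close> to the left of \<open>[0,1]\<^sup>n\<close> produces
  the powers \<open>(1 + x)\<^sup>b\<^sup>m\<close>. Comparing the images of \<open>X\<^sub>(\<^sub>1\<^sub>,\<^sub>0\<^sub>)\<close> under the adjoint actions of both sides
  of the factorization gives \<open>u\<^sub>(\<^sub>a\<^sub>,\<^sub>1\<^sub>) = n (m choose a)\<close> and \<open>u\<^sub>(\<^sub>a\<^sub>,\<^sub>2\<^sub>)\<close> as a convolution of binomial
  coefficients, in which products \<open>(m choose i) (m choose j)\<close> are then expanded in the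
  \<open>(m choose k)\<close>.

  That the adjoint action turns the group law into composition is the Baker--Campbell--Hausdorff
  theorem in Dynkin's form. With \<open>P = exp (sx) exp (sy)\<close>, the Euler derivative \<open>\<delta> = s d/ds\<close> of \<open>log P\<close> is
  \<open>\<Sum>\<^sub>r (-1)\<^sup>r / (r + 1) (Ad\<^sub>P - 1)\<^sup>r (\<delta>P P\<^sup>-\<^sup>1)\<close>, and the coefficient of \<open>s\<^sup>n\<close> in this series is \<open>n\<close> times the part
  of length \<open>n\<close> of Dynkin's series.
\<close>

section \<open>Logarithms in nilpotent algebras\<close>

text \<open>\<open>bch\<close> is only a sum of nested brackets, and its associativity is never
  established directly: products are compared after \<open>Ad\<close>, in the associative ring
  \<open>lie_end\<close>. A kernel of \<open>Ad\<close> does no harm, since only the image of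
  X_(1,0) is read off. As [X_(a,b), X_(1,0)] = b X_(a+1,b), the coefficient of X_(a,b) with b > 0
  reappears there, multiplied by b and one column to the right; reading u at (a,2) therefore takes
  degree a + 3. The exponents at (a,0), invisible to X_(1,0), come from the abelian quotient by the
  rows b > 0. The formal variable s counts the letters of a bracket word. The degree in the Lie
  algebra cannot do this, because log [a,b] has components in many degrees. The order puts (i,1)
  before (j,1) when i > j. Two distinct factors with i + j = a therefore interact once, the larger
  index acting last, which leaves a one-sided sum over a < 2i with a weight linear in i. Its
  telescoping is the source of the central binomial coefficients, while the full Vandermonde sum
  gives the powers of two.\<close>

lemma fps_exp_compose_ln: "fps_exp c oo fps_ln 1 = fps_binomial (c :: 'a :: field_char_0)"
proof -
  have "fps_deriv (fps_exp c oo fps_ln 1) = fps_const c * (fps_exp c oo fps_ln 1) / (1 + fps_X)"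
    by (simp add: fps_compose_deriv fps_ln_deriv fps_compose_mult_distrib fps_divide_unit)
  moreover have "(fps_exp c oo fps_ln 1) $ 0 = 1"
    by simp
  ultimately show ?thesis
    using fps_binomial_ODE_unique' by blast
qed

lemma power_eq_0_mono: "p ^ M = 0 \<Longrightarrow> M \<le> i \<Longrightarrow> (p :: 'a::semiring_1) ^ i = 0"
  by (auto simp: le_iff_add power_add)

section \<open>Commutators, derivations and power series at nilpotent elements\<close>

definition comm :: "'a::ring \<Rightarrow> 'a \<Rightarrow> 'a" where
  "comm a b = a * b - b * a"

lemma comm_zero [simp]: "comm a 0 = 0"
  by (simp add: comm_def)

lemma comm_sum: "comm a (sum f S) = (\<Sum>i\<in>S. comm a (f i))"
  by (simp add: comm_def sum_distrib_left sum_distrib_right sum_subtractf)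

lemma funpow_comm_zero [simp]: "(comm a ^^ n) 0 = 0"
  by (induction n) auto

lemma funpow_comm_sum: "(comm a ^^ n) (sum f S) = (\<Sum>i\<in>S. (comm a ^^ n) (f i))"
  by (induction n) (simp_all add: comm_sum)

text \<open>\<open>comm p\<close> is the difference of left and right multiplication by p, which
  commute. Its r-th power is a combination of p^i d p^j with i + j = r, and one exponent reaches M
  once r >= 2M. The outer powers of p make the induction close.\<close>

lemma funpow_comm_vanish:
  fixes p :: "'a::ring_1"
  assumes "p ^ M = 0" "2 * M \<le> r"
  shows "(comm p ^^ r) d = 0"
proof -
  have "2 * M \<le> r + i + j \<Longrightarrow> p ^ i * (comm p ^^ r) d * p ^ j = 0" for i j
  proof (induction r arbitrary: i j)
    case 0
    then have "M \<le> i \<or> M \<le> j"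
      by linarith
    then have "p ^ i = 0 \<or> p ^ j = 0"
      using power_eq_0_mono[OF assms(1)] by blast
    then show ?case
      by auto
  next
    case (Suc r)
    have "p ^ i * (comm p ^^ Suc r) d * p ^ j
        = p ^ Suc i * (comm p ^^ r) d * p ^ j - p ^ i * (comm p ^^ r) d * p ^ Suc j"
      unfolding power_Suc2[of p i] power_Suc[of p j]
      by (simp add: comm_def right_diff_distrib left_diff_distrib mult.assoc)
    then show ?case
      using Suc.IH[of "Suc i" j] Suc.IH[of i "Suc j"] Suc.prems by simp
  qed
  from this[of 0 0] assms(2) show ?thesis
    by simp
qed

locale derivation =
  fixes \<delta> :: "'a::ring_1 \<Rightarrow> 'a"
  assumes deriv_add [simp]: "\<delta> (a + b) = \<delta> a + \<delta> b"
    and deriv_mult: "\<delta> (a * b) = \<delta> a * b + a * \<delta> b"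
begin

lemma deriv_zero [simp]: "\<delta> 0 = 0"
  using deriv_add[of 0 0] by simp

lemma deriv_one [simp]: "\<delta> 1 = 0"
  using deriv_mult[of 1 1] by simp

lemma deriv_sum: "\<delta> (sum f S) = (\<Sum>i\<in>S. \<delta> (f i))"
  by (induction S rule: infinite_finite_induct) auto

text \<open>With L and R the multiplications by p, \<delta>(p^k) is the divided difference (L^k -
  R^k)/(L - R) applied to \<delta> p. Expanding L = R + \<open>comm p\<close> gives the binomials.
  In the induction, moving p past an iterated commutator splits each term in two, and Pascal's rule
  recombines them.\<close>

lemma deriv_power:
  "\<delta> (p ^ k) = (\<Sum>r<k. of_nat (k choose Suc r) * ((comm p ^^ r) (\<delta> p) * p ^ (k - 1 - r)))"
proof (induction k)
  case (Suc k)
  let ?c = "\<lambda>r. (comm p ^^ r) (\<delta> p)"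
  have step: "p * (of_nat (k choose Suc r) * (?c r * p ^ (k - 1 - r)))
     = of_nat (k choose Suc r) * (?c (Suc r) * p ^ (k - Suc r))
       + of_nat (k choose Suc r) * (?c r * p ^ (k - r))" if "r < k" for r
  proof -
    have "p ^ (k - r) = p * p ^ (k - Suc r)"
      using that by (simp flip: power_Suc add: Suc_diff_Suc)
    moreover have "p * (of_nat (k choose Suc r) * (?c r * p ^ (k - 1 - r)))
      = of_nat (k choose Suc r) * (p * ?c r * p ^ (k - Suc r))"
      by (metis (no_types, lifting) diff_diff_left mult.assoc mult_of_nat_commute plus_1_eq_Suc)
    ultimately show ?thesis
      by (simp add: comm_def algebra_simps)
  qed
  have "\<delta> (p ^ Suc k) = \<delta> p * p ^ k
      + (\<Sum>r<k. of_nat (k choose Suc r) * (?c (Suc r) * p ^ (k - Suc r)))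
      + (\<Sum>r<k. of_nat (k choose Suc r) * (?c r * p ^ (k - r)))"
    using step by (simp add: deriv_mult Suc.IH sum_distrib_left sum.distrib)
  also have "(\<Sum>r<k. of_nat (k choose Suc r) * (?c r * p ^ (k - r)))
      = (\<Sum>r<Suc k. of_nat (k choose Suc r) * (?c r * p ^ (k - r)))"
    by (simp add: binomial_eq_0)
  also have "\<delta> p * p ^ k + (\<Sum>r<k. of_nat (k choose Suc r) * (?c (Suc r) * p ^ (k - Suc r)))
      = (\<Sum>r<Suc k. of_nat (k choose r) * (?c r * p ^ (k - r)))"
    by (subst sum.lessThan_Suc_shift) simp
  finally show ?case
    by (simp add: sum.distrib [symmetric] distrib_right [symmetric] del: sum.lessThan_Suc)
qed auto

end

text \<open>A Q-algebra, given by its structure map into the center. The same locale then serves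
  endomorphisms and power series over them.\<close>

locale rat_algebra =
  fixes sc :: "rat \<Rightarrow> 'a::ring_1"
  assumes sc_add: "sc (a + b) = sc a + sc b"
    and sc_mult: "sc (a * b) = sc a * sc b"
    and sc_1 [simp]: "sc 1 = 1"
    and sc_central: "sc a * x = x * sc a"
begin

lemma sc_0 [simp]: "sc 0 = 0"
  using sc_add[of 0 0] by simp

lemma sc_minus: "sc (- a) = - sc a"
  using sc_add[of a "- a"] by (simp add: minus_unique)

lemma sc_sum: "sc (sum f S) = (\<Sum>i\<in>S. sc (f i))"
  by (induction S rule: infinite_finite_induct) (auto simp: sc_add)

lemma sc_of_nat: "sc (of_nat n) = of_nat n"
  by (induction n) (auto simp: sc_add)

lemma sc_left_commute: "x * (sc a * y) = sc a * (x * y)"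
  by (metis mult.assoc sc_central)

lemma sc_sc: "sc a * (sc b * x) = sc (a * b) * x"
  by (simp add: sc_mult mult.assoc)

lemma sc_mult_sc: "sc a * x * (sc b * y) = sc (a * b) * (x * y)"
  by (metis mult.assoc sc_central sc_mult)

lemma comm_sc: "comm x (sc a * u) = sc a * comm x u"
  unfolding comm_def right_diff_distrib sc_left_commute mult.assoc ..

lemma funpow_comm_sc: "(comm x ^^ n) (sc a * u) = sc a * (comm x ^^ n) u"
  by (induction n) (simp_all add: comm_sc)

lemma power_sc: "(sc a * x) ^ n = sc (a ^ n) * x ^ n"
  by (induction n) (simp_all add: sc_mult_sc)

text \<open>Evaluation cut off at M terms. When p^M = 0 it is multiplicative in the series and
  larger cut-offs give the same value.\<close>

definition app :: "nat \<Rightarrow> rat fps \<Rightarrow> 'a \<Rightarrow> 'a" where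
  "app M \<phi> p = (\<Sum>k<M. sc (\<phi> $ k) * p ^ k)"

lemma app_eq_app:
  assumes "p ^ M = 0" "M \<le> N"
  shows "app N \<phi> p = app M \<phi> p"
  unfolding app_def
proof (rule sum.mono_neutral_right)
  show "\<forall>i\<in>{..<N} - {..<M}. sc (\<phi> $ i) * p ^ i = 0"
    using power_eq_0_mono[OF assms(1)] by (auto simp: not_less)
qed (use assms in auto)

lemma app_mult:
  assumes "p ^ M = 0"
  shows "app M (\<phi> * \<psi>) p = app M \<phi> p * app M \<psi> p"
proof -
  let ?g = "\<lambda>i j. sc (\<phi> $ i * \<psi> $ j) * p ^ (i + j)"
  have "app M \<phi> p * app M \<psi> p = (\<Sum>i<M. \<Sum>j<M. ?g i j)"
    unfolding app_def sum_product
    by (intro sum.cong refl) (simp add: power_add sc_mult_sc)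
  also have "\<dots> = (\<Sum>(i, j)\<in>{..<M} \<times> {..<M}. ?g i j)"
    by (simp add: sum.cartesian_product)
  also have "\<dots> = (\<Sum>(i, j)\<in>{(i, j). i + j < M}. ?g i j)"
  proof (rule sum.mono_neutral_right)
    show "\<forall>i\<in>{..<M} \<times> {..<M} - {(i, j). i + j < M}. (case i of (i, j) \<Rightarrow> ?g i j) = 0"
      using power_eq_0_mono[OF assms] by auto (metis mult_zero_right not_less)
  qed auto
  also have "\<dots> = (\<Sum>k<M. \<Sum>i\<le>k. ?g i (k - i))"
    by (rule sum.triangle_reindex)
  also have "\<dots> = app M (\<phi> * \<psi>) p"
    by (simp add: app_def fps_mult_nth sc_sum sum_distrib_right atMost_atLeast0)
  finally show ?thesis ..
qed

lemma app_1: "0 < M \<Longrightarrow> app M 1 p = 1"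
  unfolding app_def by (subst sum.remove[of _ 0]) auto

lemma app_X: "1 < M \<Longrightarrow> app M fps_X p = p"
  unfolding app_def by (subst sum.remove[of _ 1]) auto

lemma app_add: "app M (\<phi> + \<psi>) p = app M \<phi> p + app M \<psi> p"
  by (simp add: app_def sc_add distrib_right sum.distrib)

lemma app_power: "p ^ M = 0 \<Longrightarrow> 0 < M \<Longrightarrow> app M (\<phi> ^ k) p = app M \<phi> p ^ k"
  by (induction k) (simp_all add: app_1 app_mult)

lemma app_compose:
  assumes "p ^ M = 0" "0 < M" "\<psi> $ 0 = 0"
  shows "app M (\<phi> oo \<psi>) p = app M \<phi> (app M \<psi> p)"
proof -
  have "(\<phi> oo \<psi>) $ k = (\<Sum>i<M. \<phi> $ i * (\<psi> ^ i) $ k)" if "k < M" for k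
    unfolding fps_compose_nth
    by (rule sum.mono_neutral_left) (use that assms(3) startsby_zero_power_prefix[OF assms(3)] in auto)
  then have "app M (\<phi> oo \<psi>) p = (\<Sum>k<M. \<Sum>i<M. sc (\<phi> $ i * (\<psi> ^ i) $ k) * p ^ k)"
    by (simp add: app_def sc_sum sum_distrib_right)
  also have "\<dots> = (\<Sum>i<M. sc (\<phi> $ i) * (\<Sum>k<M. sc ((\<psi> ^ i) $ k) * p ^ k))"
    by (subst sum.swap) (simp add: sum_distrib_left sc_mult mult.assoc)
  also have "\<dots> = app M \<phi> (app M \<psi> p)"
    using app_power[OF assms(1,2), of \<psi>] by (simp add: app_def)
  finally show ?thesis .
qed

lemma exp_log:
  assumes "p ^ M = 0" "1 < M"
  shows "app M (fps_exp 1) (app M (fps_ln 1) p) = 1 + p"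
proof -
  have "app M (fps_exp 1) (app M (fps_ln 1) p) = app M (1 + fps_X) p"
    using assms app_compose[of p M "fps_ln 1" "fps_exp 1"]
    by (simp add: fps_exp_compose_ln fps_binomial_1)
  then show ?thesis
    using assms by (simp add: app_add app_1 app_X)
qed

lemma app_binomial_inverse:
  assumes "p ^ M = 0" "1 < M" "Q * (1 + p) = 1"
  shows "app M (fps_binomial (- of_nat r)) p = Q ^ r"
proof -
  let ?a = "app M (fps_binomial (- 1)) p"
  have "(1 + p) * ?a = app M (fps_binomial (1 + - 1)) p"
    using assms unfolding fps_binomial_add_mult
    by (simp add: app_mult fps_binomial_1 app_add app_1 app_X)
  then have "(1 + p) * ?a = 1"
    using assms by (simp add: app_1)
  then have "?a = Q"
    using assms(3) by (metis mult.assoc mult.left_neutral mult.right_neutral)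
  moreover have "fps_binomial (- 1) ^ r = (fps_binomial (- of_nat r) :: rat fps)"
    by (simp add: fps_binomial_power)
  ultimately show ?thesis
    using app_power[of p M "fps_binomial (- 1)" r] assms by simp
qed

end

locale rat_algebra_derivation = rat_algebra sc + derivation \<delta>
  for sc :: "rat \<Rightarrow> 'a::ring_1" and \<delta> +
  assumes sc_deriv: "\<delta> (sc a * u) = sc a * \<delta> u"
begin

text \<open>
  With \<open>L\<close> and \<open>R\<close> the left and right multiplications by \<open>1 + p\<close>, the left hand side is the divided
  difference \<open>(log L - log R) / (L - R)\<close> applied to \<open>\<delta> p\<close>, and the right hand side is
  \<open>log (L R\<^sup>-\<^sup>1) / (L R\<^sup>-\<^sup>1 - 1)\<close> applied to \<open>\<delta> p * Q\<close>.
\<close>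

lemma deriv_log:
  assumes p: "p ^ M = 0" "1 < M" and Q: "Q * (1 + p) = 1" "(1 + p) * Q = 1"
  shows "\<delta> (app M (fps_ln 1) p) =
    (\<Sum>r<2 * M. sc ((- 1) ^ r / of_nat (Suc r)) * ((\<lambda>u. (1 + p) * u * Q - u) ^^ r) (\<delta> p * Q))"
proof -
  let ?c = "\<lambda>r. (comm p ^^ r) (\<delta> p)"
  let ?g = "\<lambda>r j. sc ((- 1) ^ (r + j) / of_nat (Suc r) * of_nat ((r + j) choose r)) * (?c r * p ^ j)"
  have summand: "\<delta> (sc (fps_ln 1 $ Suc k) * p ^ Suc k) = (\<Sum>r\<le>k. ?g r (k - r))" for k
  proof -
    \<comment> \<open>Absorption into the binomial turns the 1/(k + 1) of the logarithm into 1/(r +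
      1).\<close>
    have coeff: "(fps_ln 1 $ Suc k :: rat) * of_nat (Suc k choose Suc r)
        = (- 1) ^ k / of_nat (Suc r) * of_nat (k choose r)" for r
    proof -
      have "(of_nat (Suc r) :: rat) * of_nat (Suc k choose Suc r) = of_nat (Suc k) * of_nat (k choose r)"
        by (simp only: Suc_times_binomial_eq of_nat_mult [symmetric] mult.commute)
      then show ?thesis
        by (simp add: fps_ln_nth divide_simps del: of_nat_Suc) (simp add: mult_ac)
    qed
    have "\<delta> (sc (fps_ln 1 $ Suc k) * p ^ Suc k) = (\<Sum>r\<le>k. sc (fps_ln 1 $ Suc k) *
         (of_nat (Suc k choose Suc r) * (?c r * p ^ (k - r))))"
      by (simp add: sc_deriv deriv_power sum_distrib_left lessThan_Suc_atMost
          del: power_Suc binomial_Suc_Suc)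
    also have "\<dots> = (\<Sum>r\<le>k. sc (fps_ln 1 $ Suc k * of_nat (Suc k choose Suc r)) *
         (?c r * p ^ (k - r)))"
      by (simp add: sc_mult sc_of_nat mult.assoc del: binomial_Suc_Suc)
    finally show ?thesis
      unfolding coeff by simp
  qed
  \<comment> \<open>With cut-off 3M + 1 the triangle r + j < 3M contains the rectangle r < 2M, j <
    M, outside of which p^j or the r-fold commutator is 0.\<close>
  have "\<delta> (app M (fps_ln 1) p) = \<delta> (app (Suc (3 * M)) (fps_ln 1) p)"
    using app_eq_app[OF p(1), of "Suc (3 * M)"] by simp
  also have "\<dots> = (\<Sum>k<3 * M. \<Sum>r\<le>k. ?g r (k - r))"
    unfolding app_def sum.lessThan_Suc_shift by (simp add: deriv_sum summand del: power_Suc)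
  also have "\<dots> = (\<Sum>(r, j)\<in>{(r, j). r + j < 3 * M}. ?g r j)"
    by (rule sum.triangle_reindex [symmetric])
  also have "\<dots> = (\<Sum>(r, j)\<in>{..<2 * M} \<times> {..<M}. ?g r j)"
  proof (rule sum.mono_neutral_right)
    have "finite ({..3 * M} \<times> {..3 * M})"
      by simp
    then show "finite {(r, j). r + j < 3 * M}"
      by (rule finite_subset [rotated]) auto
    have "?c r * p ^ j = 0" if "\<not> (r < 2 * M \<and> j < M)" for r j
      using that power_eq_0_mono[OF p(1), of j] funpow_comm_vanish[OF p(1), of r "\<delta> p"]
      by (auto simp: not_less)
    then have 0: "?g r j = 0" if "\<not> (r < 2 * M \<and> j < M)" for r j
      using that by simp
    show "\<forall>i\<in>{(r, j). r + j < 3 * M} - {..<2 * M} \<times> {..<M}. (case i of (r, j) \<Rightarrow> ?g r j) = 0"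
      by (intro ballI) (auto intro!: 0 simp only: split_paired_all prod.case)
  qed auto
  also have "\<dots> = (\<Sum>r<2 * M. sc ((- 1) ^ r / of_nat (Suc r)) *
      (?c r * app M (fps_binomial (- of_nat (Suc r))) p))"
  proof -
    \<comment> \<open>For fixed r the coefficients in j are those of (1 + x)^(-(r + 1)), so the
      inner sum becomes Q^(r + 1).\<close>
    have coeff: "(- 1) ^ (r + j) / of_nat (Suc r) * of_nat ((r + j) choose r)
        = (- 1) ^ r / of_nat (Suc r) * ((- of_nat (Suc r) :: rat) gchoose j)" for r j
    proof -
      have "(- of_nat (Suc r) :: rat) gchoose j = (- 1) ^ j * of_nat ((r + j) choose j)"
        using gbinomial_minus[of "of_nat (Suc r) :: rat" j] by (simp add: binomial_gbinomial add_ac)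
      then show ?thesis
        using binomial_symmetric[of r "r + j"] by (simp add: power_add)
    qed
    have "sc (a * b) * (x * y) = sc a * (x * (sc b * y))" for a b x y
      by (simp add: sc_mult mult.assoc sc_left_commute[of x])
    then show ?thesis
      unfolding coeff
      by (simp add: sum.cartesian_product [symmetric] app_def sum_distrib_left
          del: of_nat_Suc times_divide_eq_left times_divide_eq_right)
  qed
  also have "\<dots> = (\<Sum>r<2 * M. sc ((- 1) ^ r / of_nat (Suc r)) * (?c r * Q ^ Suc r))"
    by (simp only: app_binomial_inverse[OF p Q(1)])
  finally have log: "\<delta> (app M (fps_ln 1) p) =
      (\<Sum>r<2 * M. sc ((- 1) ^ r / of_nat (Suc r)) * (?c r * Q ^ Suc r))" .
  have "?c r * Q ^ Suc r = ((\<lambda>u. (1 + p) * u * Q - u) ^^ r) (\<delta> p * Q)" for r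
  proof (induction r)
    case (Suc r)
    have pQ: "p * Q = Q * p"
      using Q by (metis add_left_cancel distrib_left distrib_right mult.left_neutral mult.right_neutral)
    \<comment> \<open>Conjugation by 1 + p minus the identity is \<open>comm p\<close> followed by
      right multiplication by Q. As Q commutes with p, r iterations collect Q^r; the starting value
      supplies the last Q.\<close>
    have 1: "(1 + p) * u * Q - u = comm p u * Q" for u
    proof -
      have "comm p u * Q = ((1 + p) * u - u * (1 + p)) * Q"
        by (simp add: comm_def algebra_simps)
      also have "\<dots> = (1 + p) * u * Q - u"
        using Q by (simp add: left_diff_distrib mult.assoc)
      finally show ?thesis ..
    qed
    have "comm p (u * Q ^ Suc r) = comm p u * Q ^ Suc r" for u
    proof -
      have "Q ^ Suc r * p = p * Q ^ Suc r"
        using pQ by (metis power_commuting_commutes)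
      then show ?thesis
        by (simp add: comm_def left_diff_distrib mult.assoc del: power_Suc)
    qed
    then have "comm p (?c r * Q ^ Suc r) * Q = ?c (Suc r) * Q ^ Suc (Suc r)"
      by (simp add: mult.assoc power_commutes)
    then show ?case
      using Suc.IH 1[of "?c r * Q ^ Suc r"] by simp
  qed simp
  then show ?thesis
    by (simp only: log)
qed

end

section \<open>The Baker--Campbell--Hausdorff theorem\<close>

fun nested_comm :: "'a::ring list \<Rightarrow> 'a" where
  "nested_comm [] = 0"
| "nested_comm [x] = x"
| "nested_comm (x # y # zs) = comm x (nested_comm (y # zs))"

lemma nested_comm_Cons: "w \<noteq> [] \<Longrightarrow> nested_comm (x # w) = comm x (nested_comm w)"
  by (cases w) auto

lemma nested_comm_replicate_append:
  "w \<noteq> [] \<Longrightarrow> nested_comm (replicate i x @ w) = (comm x ^^ i) (nested_comm w)"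
  by (induction i) (auto simp: nested_comm_Cons)

text \<open>The two innermost letters of a constant word commute.\<close>

lemma nested_comm_replicate: "nested_comm (replicate i x) = (if i = 1 then x else 0)"
proof -
  have "nested_comm (replicate k x @ [x, x]) = 0" for k
    by (subst nested_comm_replicate_append) (auto simp: comm_def)
  moreover have "replicate (Suc (Suc k)) x = replicate k x @ [x, x]" for k
    by (simp add: replicate_app_Cons_same)
  ultimately show ?thesis
    by (cases i; cases "i - 1") (simp_all del: replicate.simps(2) add: replicate.simps(2)[of 0])
qed

text \<open>The construction of \<open>dynkin_word\<close> over an arbitrary type, so that it also
  applies to endomorphisms.\<close>

definition word :: "'a \<Rightarrow> 'a \<Rightarrow> (nat \<times> nat) list \<Rightarrow> 'a list" where
  "word x y rs = concat (map (\<lambda>(r, s). replicate r x @ replicate s y) rs)"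

definition blocks :: "nat \<Rightarrow> nat \<Rightarrow> (nat \<times> nat) list set" where
  "blocks k n = {rs. length rs = k \<and> (\<forall>(r, s)\<in>set rs. 0 < r + s) \<and> dynkin_size rs = n}"

text \<open>The factorial part of \<open>dynkin_coeff\<close>. Sign and number of blocks come from
  the logarithm, the number of letters from the Euler derivative.\<close>

definition weight :: "(nat \<times> nat) list \<Rightarrow> rat" where
  "weight rs = 1 / prod_list (map (\<lambda>(r, s). fact r * fact s) rs)"

definition pairs_le :: "nat \<Rightarrow> (nat \<times> nat) set" where
  "pairs_le n = {(i, j). i + j \<le> n}"

lemma finite_pairs_le [simp]: "finite (pairs_le n)"
  by (rule finite_subset[of _ "{..n} \<times> {..n}"]) (auto simp: pairs_le_def)

lemma length_le_dynkin_size: "\<forall>(r, s)\<in>set rs. 0 < r + s \<Longrightarrow> length rs \<le> dynkin_size rs"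
  by (induction rs) (auto simp: dynkin_size_def)

lemma finite_blocks [simp]: "finite (blocks k n)"
proof (cases "k = 0")
  case True
  then have "blocks k n \<subseteq> {[]}"
    by (auto simp: blocks_def)
  then show ?thesis
    by (rule finite_subset) simp
next
  case False
  then have "blocks k n \<subseteq> dynkin_indices n"
    by (auto simp: blocks_def dynkin_indices_def)
  then show ?thesis
    by (rule finite_subset) (rule finite_dynkin_indices)
qed

lemma blocks_empty: "n < k \<Longrightarrow> blocks k n = {}"
  unfolding blocks_def using length_le_dynkin_size leD by blast

lemma blocks_Suc:
  "blocks (Suc k) n = (\<lambda>(ij, rs). ij # rs) `
     (SIGMA ij:pairs_le n - {(0, 0)}. blocks k (n - (fst ij + snd ij)))"
proof (intro equalityI subsetI)
  fix rs assume "rs \<in> blocks (Suc k) n"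
  then obtain i j ss where "rs = (i, j) # ss" "length ss = k" "0 < i + j"
      "\<forall>(r, s)\<in>set ss. 0 < r + s" "i + j + dynkin_size ss = n"
    by (cases rs) (auto simp: blocks_def dynkin_size_def)
  then show "rs \<in> (\<lambda>(ij, rs). ij # rs) `
     (SIGMA ij:pairs_le n - {(0, 0)}. blocks k (n - (fst ij + snd ij)))"
    by (intro image_eqI[of _ _ "((i, j), ss)"]) (auto simp: pairs_le_def blocks_def)
qed (auto simp: blocks_def pairs_le_def dynkin_size_def)

lemma sum_blocks_Suc:
  "(\<Sum>rs\<in>blocks (Suc k) n. f rs)
    = (\<Sum>(i, j)\<in>pairs_le n - {(0, 0)}. \<Sum>rs\<in>blocks k (n - (i + j)). f ((i, j) # rs))"
proof -
  have "inj_on (\<lambda>(ij, rs). ij # rs) A" for A :: "((nat \<times> nat) \<times> (nat \<times> nat) list) set"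
    by (auto simp: inj_on_def)
  then show ?thesis
    unfolding blocks_Suc by (subst sum.reindex) (auto simp: sum.Sigma case_prod_beta)
qed

lemma dynkin_indices_eq: "dynkin_indices l = (\<Union>n\<in>{..l}. \<Union>k\<in>{..<n}. blocks (Suc k) n)"
proof (intro equalityI subsetI)
  fix rs assume "rs \<in> dynkin_indices l"
  then have "rs \<noteq> []" "\<forall>(r, s)\<in>set rs. 0 < r + s" "dynkin_size rs \<le> l"
    by (auto simp: dynkin_indices_def)
  moreover from this have "length rs \<le> dynkin_size rs"
    using length_le_dynkin_size by blast
  moreover have "Suc (length rs - 1) = length rs"
    using \<open>rs \<noteq> []\<close> by (simp add: Suc_diff_1)
  ultimately have "rs \<in> blocks (Suc (length rs - 1)) (dynkin_size rs)"
      "length rs - 1 < dynkin_size rs" "dynkin_size rs \<le> l"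
    by (simp_all only: blocks_def mem_Collect_eq Suc_le_eq [symmetric])
  then show "rs \<in> (\<Union>n\<in>{..l}. \<Union>k\<in>{..<n}. blocks (Suc k) n)"
    by blast
qed (auto simp: blocks_def dynkin_indices_def)

lemma sum_dynkin_indices:
  "(\<Sum>rs\<in>dynkin_indices l. f rs) = (\<Sum>n\<le>l. \<Sum>k<n. \<Sum>rs\<in>blocks (Suc k) n. f rs)"
proof -
  have "(\<Sum>rs\<in>dynkin_indices l. f rs) = (\<Sum>n\<le>l. \<Sum>rs\<in>(\<Union>k\<in>{..<n}. blocks (Suc k) n). f rs)"
    unfolding dynkin_indices_eq 
    by (rule sum.UNION_disjoint) (simp, simp, auto simp: blocks_def)
  also have "\<dots> = (\<Sum>n\<le>l. \<Sum>k<n. \<Sum>rs\<in>blocks (Suc k) n. f rs)"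
    by (intro sum.cong refl sum.UNION_disjoint) (simp, simp, auto simp: blocks_def)
  finally show ?thesis .
qed

section \<open>Exponentials exp(sx) as power series over the algebra\<close>

definition euler :: "'a::ring_1 fps \<Rightarrow> 'a fps" where
  "euler A = fps_X * fps_deriv A"

lemma euler_nth: "euler A $ n = of_nat n * A $ n"
  by (cases n) (auto simp: euler_def)

context rat_algebra
begin

lemma rat_algebra_fps: "rat_algebra (\<lambda>c. fps_const (sc c))"
proof unfold_locales
  show "fps_const (sc a) * x = x * fps_const (sc a)" for a x
    by (rule fps_ext) (simp add: sc_central[of a])
qed (auto simp: sc_add sc_mult)

lemma rat_algebra_derivation_fps: "rat_algebra_derivation (\<lambda>c. fps_const (sc c)) euler"
proof -
  interpret F: rat_algebra "\<lambda>c. fps_const (sc c)"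
    by (rule rat_algebra_fps)
  show ?thesis
  proof unfold_locales
    show "euler (a * b) = euler a * b + a * euler b" for a b :: "'a fps"
    proof -
      have "fps_X * (a * c) = a * (fps_X * c)" for c
        by (metis fps_mult_fps_X_commute mult.assoc)
      then show ?thesis
        by (simp add: euler_def distrib_left mult.assoc)
    qed
    show "euler (fps_const (sc a) * u) = fps_const (sc a) * euler u" for a u
      by (simp add: fps_eq_iff euler_nth) (metis mult.assoc mult_of_nat_commute)
  qed (simp add: euler_def distrib_left)
qed

lemma of_nat_cancel: "of_nat (Suc n) * (u :: 'a) = of_nat (Suc n) * v \<Longrightarrow> u = v"
proof -
  assume "of_nat (Suc n) * u = of_nat (Suc n) * v"
  then have "sc (1 / of_nat (Suc n)) * (sc (of_nat (Suc n)) * u)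
      = sc (1 / of_nat (Suc n)) * (sc (of_nat (Suc n)) * v)"
    by (simp only: sc_of_nat)
  then show ?thesis
    unfolding sc_sc by simp
qed

definition fexp :: "'a \<Rightarrow> 'a fps" where
  "fexp x = Abs_fps (\<lambda>n. sc (1 / fact n) * x ^ n)"

lemma fexp_nth: "fexp x $ n = sc (1 / fact n) * x ^ n"
  by (simp add: fexp_def)

lemma euler_fexp: "euler (fexp x) = fps_X * (fps_const x * fexp x)"
proof (rule fps_ext)
  fix n
  show "euler (fexp x) $ n = (fps_X * (fps_const x * fexp x)) $ n"
  proof (cases n)
    case (Suc k)
    have "euler (fexp x) $ Suc k = sc (of_nat (Suc k)) * (sc (1 / fact (Suc k)) * x ^ Suc k)"
      by (simp only: euler_nth fexp_nth sc_of_nat)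
    also have "\<dots> = sc (1 / fact k) * (x * x ^ k)"
      unfolding sc_sc by (simp add: field_simps del: of_nat_Suc)
    finally show ?thesis
      using Suc by (simp add: fexp_nth sc_left_commute[of x])
  qed (simp add: euler_nth)
qed

lemma fexp_commute: "fps_const x * fexp x = fexp x * fps_const x"
  by (rule fps_ext) (simp add: fexp_nth sc_left_commute[of x] mult.assoc power_commutes)

text \<open>The Euler derivative of the product vanishes, which in a Q-algebra leaves only the
  constant coefficient.\<close>

lemma fexp_inverse: "fexp x * fexp (- x) = 1"
proof -
  interpret F: rat_algebra_derivation "\<lambda>c. fps_const (sc c)" euler
    by (rule rat_algebra_derivation_fps)
  have X: "A * (fps_X * B) = fps_X * (A * B)" for A B :: "'a fps"
    by (metis fps_mult_fps_X_commute mult.assoc)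
  have "euler (fexp x * fexp (- x))
      = fps_X * (fps_const x * fexp x * fexp (- x) + fexp x * fps_const (- x) * fexp (- x))"
    by (simp add: F.deriv_mult euler_fexp X distrib_left mult.assoc del: fps_const_neg)
  also have "\<dots> = 0"
    unfolding fexp_commute by (simp add: mult.assoc flip: fps_const_neg)
  finally have 0: "euler (fexp x * fexp (- x)) = 0" .
  show ?thesis
  proof (rule fps_ext)
    fix n
    show "(fexp x * fexp (- x)) $ n = 1 $ n"
    proof (cases n)
      case 0
      then show ?thesis
        by (simp add: fexp_nth)
    next
      case (Suc k)
      have "of_nat (Suc k) * (fexp x * fexp (- x)) $ Suc k = of_nat (Suc k) * 0"
        using 0 euler_nth[of "fexp x * fexp (- x)" "Suc k"] by simp
      then show ?thesis
        using Suc of_nat_cancel by fastforce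
    qed
  qed
qed

text \<open>H = exp(sx) u exp(-sx) satisfies s H' = s [x, H], that is (n + 1) H_(n+1) = [x, H_n],
  the recursion of exp(s ad x) u.\<close>

lemma fexp_conjugate_const:
  "(fexp x * fps_const u * fexp (- x)) $ n = sc (1 / fact n) * (comm x ^^ n) u"
proof (induction n)
  case 0
  then show ?case
    by (simp add: fexp_nth)
next
  case (Suc n)
  interpret F: rat_algebra_derivation "\<lambda>c. fps_const (sc c)" euler
    by (rule rat_algebra_derivation_fps)
  let ?H = "fexp x * fps_const u * fexp (- x)"
  have X: "A * (fps_X * B) = fps_X * (A * B)" for A B :: "'a fps"
    by (metis fps_mult_fps_X_commute mult.assoc)
  have const: "euler (fps_const u) = 0"
    by (simp add: euler_def)
  have "fexp (- x) * fps_const x = fps_const x * fexp (- x)"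
    using fexp_commute[of "- x"] by (simp flip: fps_const_neg)
  then have "euler ?H = fps_X * (fps_const x * ?H - ?H * fps_const x)"
    by (simp add: F.deriv_mult euler_fexp const X right_diff_distrib mult.assoc
        flip: fps_const_neg)
  then have "of_nat (Suc n) * ?H $ Suc n = comm x (?H $ n)"
    using euler_nth[of ?H "Suc n"] by (simp add: comm_def)
  also have "\<dots> = of_nat (Suc n) * (sc (1 / fact (Suc n)) * (comm x ^^ Suc n) u)"
    unfolding sc_of_nat [symmetric] sc_sc
    by (subst Suc.IH) (simp add: comm_sc field_simps del: of_nat_Suc)
  finally show ?case
    using of_nat_cancel by blast
qed

text \<open>The constant case extends to series because s is central: the induction splits off the
  constant term of u and one factor s from the rest.\<close>

lemma fexp_conjugate:
  "(fexp x * u * fexp (- x)) $ n = (\<Sum>i\<le>n. sc (1 / fact i) * (comm x ^^ i) (u $ (n - i)))"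
proof (induction n arbitrary: u)
  case 0
  then show ?case
    using fexp_conjugate_const[of x "u $ 0" 0] by simp
next
  case (Suc n)
  let ?v = "Abs_fps (\<lambda>n. u $ Suc n)"
  have u: "u = fps_const (u $ 0) + fps_X * ?v"
    by (rule fps_ext) (simp add: fps_X_mult_nth)
  have X: "A * (fps_X * B) = fps_X * (A * B)" for A B :: "'a fps"
    by (metis fps_mult_fps_X_commute mult.assoc)
  have "fexp x * u * fexp (- x)
     = fexp x * fps_const (u $ 0) * fexp (- x) + fps_X * (fexp x * ?v * fexp (- x))"
    by (subst u) (simp add: distrib_left distrib_right X mult.assoc)
  then have "(fexp x * u * fexp (- x)) $ Suc n = sc (1 / fact (Suc n)) * (comm x ^^ Suc n) (u $ 0)
     + (fexp x * ?v * fexp (- x)) $ n"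
    by (simp only: fps_add_nth fexp_conjugate_const fps_X_mult_nth) simp
  then show ?case
    unfolding Suc.IH by (simp add: Suc_diff_le del: funpow.simps)
qed

text \<open>The part of Dynkin's series with k blocks and n letters, stripped of the factor
  (-1)^(k-1)/(k n).\<close>

definition dynkin_sum :: "'a \<Rightarrow> 'a \<Rightarrow> nat \<Rightarrow> nat \<Rightarrow> 'a" where
  "dynkin_sum x y k n = (\<Sum>rs\<in>blocks k n. sc (weight rs) * nested_comm (word x y rs))"

text \<open>Removing the first block removes the outermost commutators. This requires a nonempty
  remaining word, hence at least two blocks.\<close>

lemma dynkin_sum_Suc:
  "dynkin_sum x y (Suc (Suc k)) n = (\<Sum>(i, j)\<in>pairs_le n - {(0, 0)}.
     sc (1 / (fact i * fact j)) * (comm x ^^ i) ((comm y ^^ j) (dynkin_sum x y (Suc k) (n - (i + j)))))"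
proof -
  have "nested_comm (word x y ((i, j) # rs)) = (comm x ^^ i) ((comm y ^^ j) (nested_comm (word x y rs)))"
    if "rs \<in> blocks (Suc k) m" for i j rs m
  proof -
    have "word x y rs \<noteq> []"
      using that by (cases rs) (auto simp: blocks_def word_def)
    then show ?thesis
      by (simp add: word_def nested_comm_replicate_append)
  qed
  moreover have "weight ((i, j) # rs) = 1 / (fact i * fact j) * weight rs" for i j rs
    by (simp add: weight_def)
  ultimately show ?thesis
    unfolding dynkin_sum_def sum_blocks_Suc[of _ "Suc k"]
    by (intro sum.cong refl) (auto simp: funpow_comm_sum funpow_comm_sc sum_distrib_left sc_sc)
qed

text \<open>In a single block x^i y^j the innermost commutator is [y, y] or [x, x], unless j = 1 or
  the block is just x.\<close>

lemma dynkin_sum_1: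
  "dynkin_sum x y (Suc 0) (Suc n) = (if n = 0 then x else 0) + sc (1 / fact n) * (comm x ^^ n) y"
proof -
  let ?f = "\<lambda>i j. sc (1 / (fact i * fact j)) * nested_comm (replicate i x @ replicate j y)"
  have blocks: "blocks 0 m = (if m = 0 then {[]} else {})" for m
    by (auto simp: blocks_def dynkin_size_def)
  have "dynkin_sum x y (Suc 0) (Suc n) = (\<Sum>(i, j)\<in>pairs_le (Suc n) - {(0, 0)}.
      if i + j = Suc n then ?f i j else 0)"
    unfolding dynkin_sum_def sum_blocks_Suc
    by (intro sum.cong refl) (auto simp: blocks pairs_le_def weight_def word_def split: if_splits)
  also have "\<dots> = (\<Sum>(i, j)\<in>{(Suc n, 0), (n, 1)}. if i + j = Suc n then ?f i j else 0)"
  proof (rule sum.mono_neutral_right)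
    have "nested_comm (replicate i x @ replicate j y) = 0" if "1 < j" for i j
      using that by (subst nested_comm_replicate_append) (auto simp: nested_comm_replicate)
    then show "\<forall>ij\<in>pairs_le (Suc n) - {(0, 0)} - {(Suc n, 0), (n, 1)}.
        (case ij of (i, j) \<Rightarrow> if i + j = Suc n then ?f i j else 0) = 0"
      by (clarsimp simp: pairs_le_def) (metis Suc_lessI add.right_neutral add_Suc_right neq0_conv
          add_right_cancel One_nat_def mult_zero_right)
  qed (simp, auto simp: pairs_le_def)
  also have "\<dots> = (if n = 0 then x else 0) + sc (1 / fact n) * (comm x ^^ n) y"
    using nested_comm_replicate[of "Suc n" x]
    by (simp add: nested_comm_replicate_append[of "[y]"])
  finally show ?thesis .
qed

lemma dynkin_sum_0: "0 < k \<Longrightarrow> dynkin_sum x y k 0 = 0"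
  by (simp add: dynkin_sum_def blocks_empty)

text \<open>(\<delta> P) P^-1 = s (x + exp(s ad x) y) generates the one-block sums. The operator
  Ad_P - 1 = exp(s ad x) exp(s ad y) - 1 prepends one block; the subtracted 1 is the excluded pair
  (0, 0).\<close>

lemma dynkin_sum_conjugate:
  fixes x y :: 'a
  defines "P \<equiv> fexp x * fexp y" and "Q \<equiv> fexp (- y) * fexp (- x)"
  shows "((\<lambda>u. P * u * Q - u) ^^ r) (euler P * Q) $ n = dynkin_sum x y (Suc r) n"
proof (induction r arbitrary: n)
  case 0
  interpret F: rat_algebra_derivation "\<lambda>c. fps_const (sc c)" euler
    by (rule rat_algebra_derivation_fps)
  have X: "A * (fps_X * B) = fps_X * (A * B)" for A B :: "'a fps"
    by (metis fps_mult_fps_X_commute mult.assoc)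
  have inv: "fexp z * (fexp (- z) * A) = A" for z A
    using fexp_inverse[of z] by (metis mult.assoc mult.left_neutral)
  have "euler P * Q = fps_X * (fps_const x + fexp x * fps_const y * fexp (- x))"
    unfolding P_def Q_def F.deriv_mult euler_fexp
    by (simp add: distrib_left distrib_right X inv fexp_inverse mult.assoc)
  then show ?case
    by (cases n) (simp_all add: dynkin_sum_0 dynkin_sum_1 fexp_conjugate_const)
next
  case (Suc r)
  let ?D = "\<lambda>u. P * u * Q - u"
  have D: "?D u $ n = (\<Sum>(i, j)\<in>pairs_le n - {(0, 0)}.
     sc (1 / (fact i * fact j)) * (comm x ^^ i) ((comm y ^^ j) (u $ (n - (i + j)))))" for u n
  proof -
    let ?g = "\<lambda>i j. sc (1 / (fact i * fact j)) * (comm x ^^ i) ((comm y ^^ j) (u $ (n - (i + j))))"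
    have "(P * u * Q) $ n = (fexp x * (fexp y * u * fexp (- y)) * fexp (- x)) $ n"
      by (simp add: P_def Q_def mult.assoc)
    also have "\<dots> = (\<Sum>i\<le>n. \<Sum>j\<le>n - i. ?g i j)"
      by (simp add: fexp_conjugate funpow_comm_sum funpow_comm_sc sum_distrib_left sc_sc)
    also have "\<dots> = (\<Sum>(i, j)\<in>pairs_le n. ?g i j)"
      by (subst sum.Sigma) (auto simp: pairs_le_def intro!: sum.cong)
    also have "\<dots> = u $ n + (\<Sum>(i, j)\<in>pairs_le n - {(0, 0)}. ?g i j)"
      by (subst sum.remove[of _ "(0, 0)"]) (simp, auto simp: pairs_le_def)
    finally show ?thesis
      by simp
  qed
  have "(?D ^^ Suc r) (euler P * Q) $ n = ?D ((?D ^^ r) (euler P * Q)) $ n"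
    by simp
  then show ?case
    unfolding D dynkin_sum_Suc Suc.IH .
qed

end

section \<open>Filtered nilpotent algebras and evaluation at s = 1\<close>

locale nilpotent_algebra = rat_algebra sc for sc :: "rat \<Rightarrow> 'a::ring_1" +
  fixes fil :: "nat \<Rightarrow> 'a set" and l :: nat
  assumes fil_zero: "0 \<in> fil n"
    and fil_add: "a \<in> fil n \<Longrightarrow> b \<in> fil n \<Longrightarrow> a + b \<in> fil n"
    and fil_mult: "a \<in> fil i \<Longrightarrow> b \<in> fil j \<Longrightarrow> a * b \<in> fil (i + j)"
    and fil_sc: "sc c \<in> fil 0"
    and fil_top: "l < n \<Longrightarrow> a \<in> fil n \<Longrightarrow> a = 0"
    and l_pos: "0 < l"
begin

lemma fil_sum: "(\<And>i. i \<in> S \<Longrightarrow> f i \<in> fil n) \<Longrightarrow> sum f S \<in> fil n"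
  by (induction S rule: infinite_finite_induct) (auto simp: fil_zero fil_add)

lemma fil_scale: "a \<in> fil n \<Longrightarrow> sc c * a \<in> fil n"
  using fil_mult[OF fil_sc, of a n c] by simp

lemma fil_power: "a \<in> fil 1 \<Longrightarrow> a ^ n \<in> fil n"
proof (induction n)
  case 0
  then show ?case
    using fil_sc[of 1] by simp
next
  case (Suc n)
  then show ?case
    using fil_mult[of a 1 "a ^ n" n] by simp
qed

text \<open>The coefficient of s^n lies in \<open>fil n\<close>, which is 0 for n > l. This makes
  setting s = 1 a finite and multiplicative operation.\<close>

definition graded :: "'a fps \<Rightarrow> bool" where
  "graded A \<longleftrightarrow> (\<forall>n. A $ n \<in> fil n)"

lemma graded_mult: "graded A \<Longrightarrow> graded B \<Longrightarrow> graded (A * B)"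
  unfolding graded_def fps_mult_nth
proof (intro allI fil_sum)
  fix n i :: nat
  assume "\<forall>n. A $ n \<in> fil n" "\<forall>n. B $ n \<in> fil n" "i \<in> {0..n}"
  then show "A $ i * B $ (n - i) \<in> fil n"
    using fil_mult[of "A $ i" i "B $ (n - i)" "n - i"] by simp
qed

lemma graded_const: "graded (fps_const (sc c))"
  by (simp add: graded_def fil_zero fil_sc)

lemma graded_1: "graded 1"
  using graded_const[of 1] by simp

lemma graded_power: "graded A \<Longrightarrow> graded (A ^ n)"
  by (induction n) (auto simp: graded_1 graded_mult)

lemma graded_add: "graded A \<Longrightarrow> graded B \<Longrightarrow> graded (A + B)"
  by (simp add: graded_def fil_add)

lemma graded_sum: "(\<And>i. i \<in> S \<Longrightarrow> graded (f i)) \<Longrightarrow> graded (sum f S)"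
  by (simp add: graded_def fps_sum_nth fil_sum)

lemma graded_fexp: "x \<in> fil 1 \<Longrightarrow> graded (fexp x)"
  by (simp add: graded_def fexp_nth fil_scale fil_power)

text \<open>Two bounds meet at l: without constant term in A, the power A^(l+1) has no coefficients
  of s^n with n <= l, and those with n > l lie in \<open>fil n\<close>, which is 0.\<close>

lemma graded_nilpotent:
  assumes "graded A" "A $ 0 = 0"
  shows "A ^ Suc l = 0"
proof (rule fps_ext)
  fix n
  show "(A ^ Suc l) $ n = 0 $ n"
  proof (cases "n < Suc l")
    case True
    have "A ^ k $ n = 0" if "n < k" for k n
      using that
    proof (induction k arbitrary: n)
      case (Suc k)
      then show ?case
        unfolding power_Suc fps_mult_nth
      proof (intro sum.neutral ballI)
        fix i assume "i \<in> {0..n}"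
        then show "A $ i * A ^ k $ (n - i) = 0"
          using Suc.IH[of "n - i"] Suc.prems assms(2) by (cases "i = 0") auto
      qed
    qed simp
    then show ?thesis
      using True by (simp del: power_Suc)
  next
    case False
    then show ?thesis
      using graded_power[OF assms(1), of "Suc l"] fil_top[of n "(A ^ Suc l) $ n"]
      by (simp add: graded_def del: power_Suc)
  qed
qed

definition ev :: "'a fps \<Rightarrow> 'a" where
  "ev A = (\<Sum>n\<le>l. A $ n)"

lemma ev_mult:
  assumes "graded A" "graded B"
  shows "ev (A * B) = ev A * ev B"
proof -
  have "ev (A * B) = (\<Sum>k<Suc l. \<Sum>i\<le>k. A $ i * B $ (k - i))"
    unfolding ev_def fps_mult_nth lessThan_Suc_atMost atMost_atLeast0 ..
  also have "\<dots> = (\<Sum>(i, j)\<in>{(i, j). i + j < Suc l}. A $ i * B $ j)"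
    by (rule sum.triangle_reindex [symmetric])
  also have "\<dots> = (\<Sum>(i, j)\<in>{..l} \<times> {..l}. A $ i * B $ j)"
  proof (rule sum.mono_neutral_left)
    have "A $ i * B $ j = 0" if "l < i + j" for i j
      using fil_top[OF that fil_mult] assms by (simp add: graded_def)
    then show "\<forall>ij\<in>{..l} \<times> {..l} - {(i, j). i + j < Suc l}. (case ij of (i, j) \<Rightarrow> A $ i * B $ j) = 0"
      by auto (metis not_less_eq)
  qed auto
  finally show ?thesis
    by (simp add: ev_def sum_product sum.cartesian_product)
qed

lemma ev_const: "ev (fps_const c) = c"
  unfolding ev_def by (subst sum.remove[of _ 0]) auto

lemma ev_power: "graded A \<Longrightarrow> ev (A ^ n) = ev A ^ n"
  using ev_const[of 1] by (induction n) (simp_all add: ev_mult graded_power)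

lemma ev_fexp: "ev (fexp x) = app (Suc l) (fps_exp 1) x"
  by (simp add: ev_def app_def fexp_nth lessThan_Suc_atMost)

lemma ev_sum: "ev (sum f S) = (\<Sum>i\<in>S. ev (f i))"
  unfolding ev_def fps_sum_nth by (rule sum.swap)

theorem bch_exp:
  assumes x: "x \<in> fil 1" and y: "y \<in> fil 1"
  shows "app (Suc l) (fps_exp 1) (\<Sum>rs\<in>dynkin_indices l. sc (dynkin_coeff rs) * nested_comm (word x y rs))
    = app (Suc l) (fps_exp 1) x * app (Suc l) (fps_exp 1) y"
proof -
  interpret F: rat_algebra_derivation "\<lambda>c. fps_const (sc c)" euler
    by (rule rat_algebra_derivation_fps)
  define P where "P = fexp x * fexp y"
  define Q where "Q = fexp (- y) * fexp (- x)"
  define p where "p = P - 1"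
  define W where "W = F.app (Suc l) (fps_ln 1) p"
  have P: "P = 1 + p"
    by (simp add: p_def)
  have graded_P: "graded P"
    unfolding P_def using x y by (intro graded_mult graded_fexp)
  have graded_p: "graded p"
    using graded_add[OF graded_P graded_const[of "- 1"]]
    by (simp add: p_def sc_minus flip: fps_const_neg)
  have "p $ 0 = 0"
    by (simp add: p_def P_def fexp_nth)
  then have nil: "p ^ Suc l = 0"
    using graded_p graded_nilpotent by blast
  have l: "1 < Suc l"
    using l_pos by simp
  have inv: "fexp z * (fexp (- z) * A) = A" "fexp (- z) * (fexp z * A) = A" for z A
    using fexp_inverse[of z] fexp_inverse[of "- z"] by (metis mult.assoc mult.left_neutral minus_minus)+
  have PQ: "P * Q = 1"
    by (simp add: P_def Q_def mult.assoc inv fexp_inverse)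
  have QP: "Q * P = 1"
    using fexp_inverse[of "- y"] by (simp add: P_def Q_def mult.assoc inv)
  have euler_p: "euler p = euler P"
    by (simp add: p_def euler_def)
  have exp_W: "F.app (Suc l) (fps_exp 1) W = P"
    unfolding W_def P by (rule F.exp_log[OF nil l])
  have graded_W: "graded W"
    unfolding W_def F.app_def by (intro graded_sum graded_mult graded_const graded_power graded_p)
  have W0: "W $ 0 = 0"
  proof -
    have "sc (fps_ln 1 $ k) * (p ^ k) $ 0 = 0" for k
      using \<open>p $ 0 = 0\<close> by (cases k) auto
    then show ?thesis
      unfolding W_def F.app_def fps_sum_nth by (intro sum.neutral) simp
  qed
  have W: "W $ n = (\<Sum>k<n. \<Sum>rs\<in>blocks (Suc k) n. sc (dynkin_coeff rs) * nested_comm (word x y rs))"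
    if n: "n \<le> l" for n
  proof (cases n)
    case 0
    then show ?thesis
      using W0 by simp
  next
    case (Suc m)
    have "of_nat n * W $ n = euler W $ n"
      by (simp add: euler_nth)
    also have "\<dots> = (\<Sum>r<2 * Suc l. sc ((- 1) ^ r / of_nat (Suc r)) * dynkin_sum x y (Suc r) n)"
      unfolding W_def F.deriv_log[OF nil l QP[unfolded P] PQ[unfolded P]] P [symmetric] euler_p
        fps_sum_nth fps_mult_left_const_nth dynkin_sum_conjugate[where x = x and y = y, folded P_def Q_def] ..
    \<comment> \<open>Every block contains a letter, so the sum over r stops at n; n <= l keeps this
      below the cut-off 2 (l + 1).\<close>
    also have "\<dots> = (\<Sum>r<n. sc ((- 1) ^ r / of_nat (Suc r)) * dynkin_sum x y (Suc r) n)"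
      by (rule sum.mono_neutral_right) (use n in \<open>auto simp: dynkin_sum_def blocks_empty\<close>)
    also have "\<dots> = of_nat n *
        (\<Sum>k<n. \<Sum>rs\<in>blocks (Suc k) n. sc (dynkin_coeff rs) * nested_comm (word x y rs))"
    proof -
      have "(- 1) ^ k / of_nat (Suc k) * weight rs = of_nat n * dynkin_coeff rs"
        if "rs \<in> blocks (Suc k) n" for k rs
        using that Suc by (simp add: blocks_def weight_def dynkin_coeff_def field_simps del: of_nat_Suc)
      then show ?thesis
        unfolding sc_of_nat [symmetric] dynkin_sum_def sum_distrib_left sc_sc
        by (intro sum.cong refl) (simp del: of_nat_Suc)
    qed
    finally show ?thesis
      using Suc of_nat_cancel by blast
  qed
  \<comment> \<open>Evaluation at s = 1 respects sums and products of graded series, so it commutes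
    with the truncated exponential.\<close>
  have "ev (F.app (Suc l) (fps_exp 1) W) = app (Suc l) (fps_exp 1) (ev W)"
    unfolding F.app_def app_def
    by (simp add: ev_sum ev_mult graded_const graded_power graded_W ev_const ev_power del: sum.lessThan_Suc power_Suc)
  moreover have "ev W = (\<Sum>rs\<in>dynkin_indices l. sc (dynkin_coeff rs) * nested_comm (word x y rs))"
    using W by (simp add: ev_def sum_dynkin_indices)
  moreover have "ev P = app (Suc l) (fps_exp 1) x * app (Suc l) (fps_exp 1) y"
    using x y by (simp add: P_def ev_mult graded_fexp ev_fexp)
  ultimately show ?thesis
    using exp_W by simp
qed

end

section \<open>The adjoint representation\<close>

abbreviation lookup :: "lie \<Rightarrow> nat \<times> nat \<Rightarrow> rat" where
  "lookup \<equiv> Poly_Mapping.lookup"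

abbreviation X :: "nat \<times> nat \<Rightarrow> lie" where
  "X p \<equiv> Poly_Mapping.single p 1"

lemma lookup_scale [simp]: "lookup (scale c x) p = c * lookup x p"
  by (simp add: scale_def Poly_Mapping.map.rep_eq when_def)

lemma scale_add: "scale c (x + y) = scale c x + scale c y"
  by (rule poly_mapping_eqI) (simp add: lookup_add algebra_simps)

lemma scale_zero [simp]: "scale c 0 = 0" "scale 0 x = 0"
  by (simp_all add: poly_mapping_eqI)

lemma scale_one [simp]: "scale 1 x = x"
  by (simp add: poly_mapping_eqI)

lemma scale_diff: "scale c (x - y) = scale c x - scale c y"
  by (rule poly_mapping_eqI) (simp add: lookup_minus algebra_simps)

lemma lie_eq_sum_single: "x = (\<Sum>p\<in>Poly_Mapping.keys x. Poly_Mapping.single p (lookup x p))"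
proof (rule poly_mapping_eqI)
  fix q
  show "lookup x q = lookup (\<Sum>p\<in>Poly_Mapping.keys x. Poly_Mapping.single p (lookup x p)) q"
    by (simp add: lookup_sum lookup_single when_def in_keys_iff)
qed

lemma lie_induct [case_names zero single add]:
  assumes "P 0" "\<And>p c. P (Poly_Mapping.single p c)" "\<And>x y. P x \<Longrightarrow> P y \<Longrightarrow> P (x + y)"
  shows "P (x :: lie)"
proof -
  have "P (\<Sum>p\<in>A. Poly_Mapping.single p (lookup x p))" for A
    by (induction A rule: infinite_finite_induct) (auto intro: assms)
  then show ?thesis
    using lie_eq_sum_single[of x] by metis
qed

text \<open>The sum over supports becomes a convolution over a box that depends only on the target
  point, so bilinearity and truncation can be checked term by term.\<close>

lemma lookup_lie_bracket:
  "lookup (lie_bracket x y) (a, b) =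
    (\<Sum>(i, j)\<in>{..a} \<times> {..b}. lookup x (i, j) * lookup y (a - i, b - j) * of_int (skew (i, j) (a - i, b - j)))"
proof -
  let ?g = "\<lambda>p q. lookup x p * lookup y q * of_int (skew p q)"
  let ?r = "\<lambda>p. (a - fst p, b - snd p)"
  have inner: "(\<Sum>q\<in>Poly_Mapping.keys y. ?g p q when p + q = (a, b))
      = (if p \<in> {..a} \<times> {..b} then ?g p (?r p) else 0)" for p
  proof -
    have "(\<Sum>q\<in>Poly_Mapping.keys y. ?g p q when p + q = (a, b))
      = (\<Sum>q\<in>Poly_Mapping.keys y. if q = ?r p then (if p \<in> {..a} \<times> {..b} then ?g p (?r p) else 0) else 0)"
      by (intro sum.cong refl) (cases p, auto simp: when_def)
    then show ?thesis
      by (auto simp: in_keys_iff)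
  qed
  have "lookup (lie_bracket x y) (a, b)
      = (\<Sum>p\<in>Poly_Mapping.keys x. if p \<in> {..a} \<times> {..b} then ?g p (?r p) else 0)"
    by (simp only: lie_bracket_def lookup_sum lookup_single inner)
  also have "\<dots> = (\<Sum>p\<in>Poly_Mapping.keys x \<inter> ({..a} \<times> {..b}). ?g p (?r p))"
    by (simp add: sum.inter_restrict)
  also have "\<dots> = (\<Sum>p\<in>{..a} \<times> {..b}. ?g p (?r p))"
    by (rule sum.mono_neutral_left) (auto simp: in_keys_iff)
  finally show ?thesis
    by (simp add: case_prod_beta)
qed

lemma lie_bracket_add_left: "lie_bracket (x + y) z = lie_bracket x z + lie_bracket y z"
  by (rule poly_mapping_eqI)
    (auto simp: lookup_lie_bracket lookup_add algebra_simps sum.distrib [symmetric] intro!: sum.cong)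

lemma lie_bracket_add_right: "lie_bracket x (y + z) = lie_bracket x y + lie_bracket x z"
  by (rule poly_mapping_eqI)
    (auto simp: lookup_lie_bracket lookup_add algebra_simps sum.distrib [symmetric] intro!: sum.cong)

lemma lie_bracket_scale_left: "lie_bracket (scale c x) y = scale c (lie_bracket x y)"
  by (rule poly_mapping_eqI) (auto simp: lookup_lie_bracket sum_distrib_left intro!: sum.cong)

lemma lie_bracket_scale_right: "lie_bracket x (scale c y) = scale c (lie_bracket x y)"
  by (rule poly_mapping_eqI) (auto simp: lookup_lie_bracket sum_distrib_left intro!: sum.cong)

lemma lie_bracket_zero [simp]: "lie_bracket 0 y = 0" "lie_bracket x 0 = 0"
  by (simp_all add: lie_bracket_def)

lemma lie_bracket_single:
  "lie_bracket (Poly_Mapping.single p c) (Poly_Mapping.single q d)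
    = Poly_Mapping.single (p + q) (c * d * of_int (skew p q))"
  by (simp add: lie_bracket_def)

lemma skew_add [simp]: "skew (p + q) r = skew p r + skew q r" "skew p (q + r) = skew p q + skew p r"
  by (simp_all add: skew_def algebra_simps)

lemma skew_swap: "skew q p = - skew p q"
  by (simp add: skew_def)

text \<open>On basis vectors the identity reduces to bilinearity and antisymmetry of
  \<open>skew\<close>.\<close>

lemma jacobi:
  "lie_bracket (lie_bracket x y) z = lie_bracket x (lie_bracket y z) - lie_bracket y (lie_bracket x z)"
proof (induction x rule: lie_induct)
  case (single p c)
  show ?case
  proof (induction y rule: lie_induct)
    case (single q d)
    show ?case
    proof (induction z rule: lie_induct)
      case (single r e)
      show ?case
        by (simp add: lie_bracket_single add_ac skew_swap[of q p] single_diff [symmetric] algebra_simps)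
    qed (simp_all add: lie_bracket_add_left lie_bracket_add_right algebra_simps)
  qed (simp_all add: lie_bracket_add_left lie_bracket_add_right algebra_simps)
qed (simp_all add: lie_bracket_add_left lie_bracket_add_right algebra_simps)

text \<open>The endomorphisms are made a type so that they can be an instance of
  \<open>ring_1\<close>, to which the results on nilpotent algebras apply.\<close>

typedef lie_end = "{T :: lie \<Rightarrow> lie. (\<forall>x y. T (x + y) = T x + T y) \<and> (\<forall>c x. T (scale c x) = scale c (T x))}"
  morphisms act Abs_lie_end
  by (rule exI[of _ "\<lambda>x. x"]) simp

setup_lifting type_definition_lie_end

lemma act_add: "act T (x + y) = act T x + act T y"
  and act_scale: "act T (scale c x) = scale c (act T x)"
  using act[of T] by auto

instantiation lie_end :: ring_1
begin

lift_definition zero_lie_end :: lie_end is "\<lambda>x. 0"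
  by auto

lift_definition one_lie_end :: lie_end is "\<lambda>x. x"
  by auto

lift_definition plus_lie_end :: "lie_end \<Rightarrow> lie_end \<Rightarrow> lie_end" is "\<lambda>S T x. S x + T x"
  by (auto simp: scale_add algebra_simps)

lift_definition uminus_lie_end :: "lie_end \<Rightarrow> lie_end" is "\<lambda>S x. - S x"
  by (auto intro: poly_mapping_eqI)

lift_definition minus_lie_end :: "lie_end \<Rightarrow> lie_end \<Rightarrow> lie_end" is "\<lambda>S T x. S x - T x"
  by (auto simp: scale_diff)

lift_definition times_lie_end :: "lie_end \<Rightarrow> lie_end \<Rightarrow> lie_end" is "\<lambda>S T x. S (T x)"
  by auto

instance
proof
  show "(0 :: lie_end) \<noteq> 1"
  proof
    assume "(0 :: lie_end) = 1"
    then have "act 0 (X (0, 0)) = act 1 (X (0, 0))"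
      by simp
    then show False
      using lookup_single_eq[of "(0 :: nat, 0 :: nat)" "1 :: rat"]
      by (simp add: zero_lie_end.rep_eq one_lie_end.rep_eq)
  qed
qed (transfer; auto simp: algebra_simps fun_eq_iff)+

end

lemmas act_simps [simp] = zero_lie_end.rep_eq one_lie_end.rep_eq plus_lie_end.rep_eq
  uminus_lie_end.rep_eq minus_lie_end.rep_eq times_lie_end.rep_eq

lemma lie_end_eqI: "(\<And>x. act S x = act T x) \<Longrightarrow> S = T"
  by transfer auto

lemma act_zero [simp]: "act T 0 = 0"
  using act_add[of T 0 0] by simp

lemma act_sum: "act (sum f A) x = (\<Sum>i\<in>A. act (f i) x)"
  by (induction A rule: infinite_finite_induct) auto

lift_definition scalar :: "rat \<Rightarrow> lie_end" is "\<lambda>c x. scale c x"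
  by (auto intro: poly_mapping_eqI simp: lookup_add algebra_simps)

lemmas act_scalar [simp] = scalar.rep_eq

interpretation rat_algebra scalar
proof
  show "scalar a * T = T * scalar a" for a T
    by (rule lie_end_eqI) (simp add: act_scale)
qed (auto intro!: lie_end_eqI poly_mapping_eqI simp: lookup_add algebra_simps)

definition restr :: "(nat \<times> nat) set \<Rightarrow> lie \<Rightarrow> lie" where
  "restr S x = (\<Sum>p\<in>Poly_Mapping.keys x \<inter> S. Poly_Mapping.single p (lookup x p))"

lemma lookup_restr [simp]: "lookup (restr S x) q = (if q \<in> S then lookup x q else 0)"
  by (auto simp: restr_def lookup_sum lookup_single when_def in_keys_iff)

lemma trunc_eq_restr: "trunc l x = restr {p. deg p \<le> l} x"
  by (simp add: trunc_def restr_def Int_def conj_commute)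

lemma lookup_trunc [simp]: "lookup (trunc l x) q = (if deg q \<le> l then lookup x q else 0)"
  by (simp add: trunc_eq_restr)

lemma restr_lie_bracket_left:
  assumes "\<And>p q. p + q \<in> S \<Longrightarrow> p \<in> T"
  shows "restr S (lie_bracket (restr T x) y) = restr S (lie_bracket x y)"
proof (rule poly_mapping_eqI)
  fix r :: "nat \<times> nat"
  obtain a b where r: "r = (a, b)"
    by (cases r)
  have "(i, j) \<in> T" if "(a, b) \<in> S" "i \<le> a" "j \<le> b" for i j
    using that assms[of "(i, j)" "(a - i, b - j)"] by simp
  then show "lookup (restr S (lie_bracket (restr T x) y)) r = lookup (restr S (lie_bracket x y)) r"
    unfolding r by (auto simp: lookup_lie_bracket intro!: sum.cong)
qed

lemma restr_lie_bracket_right: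
  assumes "\<And>p q. p + q \<in> S \<Longrightarrow> q \<in> T"
  shows "restr S (lie_bracket x (restr T y)) = restr S (lie_bracket x y)"
proof (rule poly_mapping_eqI)
  fix r :: "nat \<times> nat"
  obtain a b where r: "r = (a, b)"
    by (cases r)
  have "(a - i, b - j) \<in> T" if "(a, b) \<in> S" "i \<le> a" "j \<le> b" for i j
    using that assms[of "(i, j)" "(a - i, b - j)"] by simp
  then show "lookup (restr S (lie_bracket x (restr T y))) r = lookup (restr S (lie_bracket x y)) r"
    unfolding r by (auto simp: lookup_lie_bracket intro!: sum.cong)
qed

text \<open>For \<open>S\<close> = \<open>rank2 l\<close> this is the adjoint action on the quotient
  by the ideal spanned by the other basis vectors, realised inside \<open>lie\<close>.\<close>

lift_definition ad :: "(nat \<times> nat) set \<Rightarrow> lie \<Rightarrow> lie_end" is "\<lambda>S x y. restr S (lie_bracket x y)"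
  by (auto intro!: poly_mapping_eqI simp: lie_bracket_add_right lie_bracket_scale_right lookup_add)

lemmas act_ad = ad.rep_eq

lemma ad_add: "ad S (x + y) = ad S x + ad S y"
  by (auto intro!: lie_end_eqI poly_mapping_eqI simp: act_ad lie_bracket_add_left lookup_add)

lemma ad_zero [simp]: "ad S 0 = 0"
  using ad_add[of S 0 0] by simp

lemma ad_sum: "ad S (sum f A) = (\<Sum>i\<in>A. ad S (f i))"
  by (induction A rule: infinite_finite_induct) (auto simp: ad_add)

lemma ad_scale: "ad S (scale c x) = scalar c * ad S x"
  by (auto intro!: lie_end_eqI poly_mapping_eqI simp: act_ad lie_bracket_scale_left)

definition raises :: "nat \<Rightarrow> lie_end \<Rightarrow> bool" where
  "raises n T \<longleftrightarrow> (\<forall>z d. (\<forall>p. deg p < d \<longrightarrow> lookup z p = 0) \<longrightarrow>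
     (\<forall>p. deg p < d + n \<longrightarrow> lookup (act T z) p = 0))"

text \<open>The complement of \<open>rank2 l\<close> is closed under adding points, so its span is an ideal.\<close>

definition rank2 :: "nat \<Rightarrow> (nat \<times> nat) set" where
  "rank2 l = {p. deg p \<le> l \<and> snd p \<le> 2}"

lemma rank2_add: "p + q \<in> rank2 l \<Longrightarrow> p \<in> rank2 l" "p + q \<in> rank2 l \<Longrightarrow> q \<in> rank2 l"
  by (auto simp: rank2_def deg_def)

lemma restr_rank2_lie_bracket:
  "restr (rank2 l) (lie_bracket x (restr (rank2 l) y)) = restr (rank2 l) (lie_bracket x y)"
  by (rule restr_lie_bracket_right) (rule rank2_add(2))

text \<open>
  The projection onto the span of \<open>rank2 l\<close> is imposed only in positive filtration degree, because
  the identity has to lie in degree 0.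
\<close>

definition fil :: "nat \<Rightarrow> nat \<Rightarrow> lie_end set" where
  "fil l n = {T. raises n T \<and> (\<forall>z. act T (restr (rank2 l) z) = restr (rank2 l) (act T z)) \<and>
     (0 < n \<longrightarrow> (\<forall>z. restr (rank2 l) (act T z) = act T z))}"

lemma raises_mult: "raises i S \<Longrightarrow> raises j T \<Longrightarrow> raises (i + j) (S * T)"
  unfolding raises_def times_lie_end.rep_eq add.commute[of i j] add.assoc [symmetric] by blast

lemma nilpotent_algebra_fil:
  assumes "0 < l"
  shows "nilpotent_algebra scalar (fil l) l"
proof unfold_locales
  let ?\<pi> = "restr (rank2 l)"
  show "0 \<in> fil l n" for n
    by (auto simp: fil_def raises_def intro: poly_mapping_eqI)
  show "a + b \<in> fil l n" if "a \<in> fil l n" "b \<in> fil l n" for a b n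
  proof -
    have "?\<pi> (x + y) = ?\<pi> x + ?\<pi> y" for x y
      by (rule poly_mapping_eqI) (simp add: lookup_add)
    then show ?thesis
      using that by (auto simp: fil_def raises_def lookup_add)
  qed
  show "a * b \<in> fil l (i + j)" if "a \<in> fil l i" "b \<in> fil l j" for a b i j
    using that raises_mult[of i a j b] unfolding fil_def by auto metis
  show "scalar c \<in> fil l 0" for c
    by (auto simp: fil_def raises_def intro!: poly_mapping_eqI)
  \<comment> \<open>The output starts in degree n > l, but it is supported in
    \<open>rank2 l\<close>, where degrees are at most l.\<close>
  show "a = 0" if "l < n" "a \<in> fil l n" for a n
  proof (intro lie_end_eqI poly_mapping_eqI)
    fix z p
    have "lookup (act a z) p = 0" if "deg p \<le> l"
    proof -
      have "\<forall>z d. (\<forall>p. deg p < d \<longrightarrow> lookup z p = 0) \<longrightarrow> (\<forall>p. deg p < d + n \<longrightarrow> lookup (act a z) p = 0)"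
        using \<open>a \<in> fil l n\<close> by (simp add: fil_def raises_def)
      from this[rule_format, of 0 z p] show ?thesis
        using that \<open>l < n\<close> by simp
    qed
    moreover have "act a z = ?\<pi> (act a z)"
      using that by (simp add: fil_def)
    then have "lookup (act a z) p = (if p \<in> rank2 l then lookup (act a z) p else 0)"
      by (metis lookup_restr)
    ultimately show "lookup (act a z) p = lookup (act 0 z) p"
      by (auto simp: rank2_def split: if_splits)
  qed
qed (use assms in auto)

lemma ad_fil:
  assumes "lookup x (0, 0) = 0"
  shows "ad (rank2 l) x \<in> fil l 1"
proof -
  have "raises 1 (ad (rank2 l) x)"
    unfolding raises_def
  proof (intro allI impI)
    fix z d and p :: "nat \<times> nat"
    assume z: "\<forall>p. deg p < d \<longrightarrow> lookup z p = 0" and p: "deg p < d + 1"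
    obtain a b where ab: "p = (a, b)"
      by (cases p)
    have "lookup x (i, j) * lookup z (a - i, b - j) = 0" if "i \<le> a" "j \<le> b" for i j
    proof (cases "i = 0 \<and> j = 0")
      case False
      then have "deg (a - i, b - j) < d"
        using that p unfolding ab deg_def by auto
      then show ?thesis
        using z by simp
    qed (use assms in auto)
    then show "lookup (act (ad (rank2 l) x) z) p = 0"
      unfolding ab act_ad by (auto simp: lookup_lie_bracket intro!: sum.neutral)
  qed
  moreover have "restr (rank2 l) (lie_bracket x (restr (rank2 l) z))
      = restr (rank2 l) (restr (rank2 l) (lie_bracket x z))" for z
    unfolding restr_rank2_lie_bracket by (auto intro: poly_mapping_eqI)
  moreover have "restr (rank2 l) (restr (rank2 l) z) = restr (rank2 l) z" for z
    by (auto intro: poly_mapping_eqI)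
  ultimately show ?thesis
    by (simp add: fil_def act_ad)
qed

text \<open>This is the Jacobi identity; projecting between successive brackets changes nothing
  because the kernel of the projection is an ideal.\<close>

lemma ad_bracket_trunc:
  "ad (rank2 l) (bracket_trunc l x y) = comm (ad (rank2 l) x) (ad (rank2 l) y)"
proof (rule lie_end_eqI)
  fix z
  let ?\<pi> = "restr (rank2 l)"
  have diff: "?\<pi> (u - v) = ?\<pi> u - ?\<pi> v" for u v
    by (rule poly_mapping_eqI) (simp add: lookup_minus)
  have "?\<pi> (lie_bracket (trunc l (lie_bracket x y)) z) = ?\<pi> (lie_bracket (lie_bracket x y) z)"
    unfolding trunc_eq_restr by (rule restr_lie_bracket_left) (auto simp: rank2_def deg_def)
  also have "\<dots> = ?\<pi> (lie_bracket x (?\<pi> (lie_bracket y z))) - ?\<pi> (lie_bracket y (?\<pi> (lie_bracket x z)))"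
    unfolding jacobi diff restr_rank2_lie_bracket ..
  finally show "act (ad (rank2 l) (bracket_trunc l x y)) z = act (comm (ad (rank2 l) x) (ad (rank2 l) y)) z"
    by (simp add: act_ad bracket_trunc_def comm_def)
qed

lemma ad_nested_bracket:
  "ad (rank2 l) (nested_bracket l ws) = nested_comm (map (ad (rank2 l)) ws)"
  by (induction l ws rule: nested_bracket.induct) (simp_all add: ad_bracket_trunc)

lemma ad_bch:
  "ad (rank2 l) (bch l x y) = (\<Sum>rs\<in>dynkin_indices l.
     scalar (dynkin_coeff rs) * nested_comm (word (ad (rank2 l) x) (ad (rank2 l) y) rs))"
proof -
  have "map f (dynkin_word x y rs) = word (f x) (f y) rs" for f :: "lie \<Rightarrow> lie_end" and rs
    by (induction rs) (auto simp: dynkin_word_def word_def)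
  then show ?thesis
    by (simp add: bch_def ad_sum ad_scale ad_nested_bracket)
qed

definition Ad :: "nat \<Rightarrow> lie \<Rightarrow> lie_end" where
  "Ad l x = app (Suc l) (fps_exp 1) (ad (rank2 l) x)"

text \<open>The homomorphism property that stands in for the group laws of \<open>bch\<close>:
  ordered products become compositions of endomorphisms.\<close>

lemma Ad_bch:
  assumes "lookup x (0, 0) = 0" "lookup y (0, 0) = 0" "0 < l"
  shows "Ad l (bch l x y) = Ad l x * Ad l y"
proof -
  interpret N: nilpotent_algebra scalar "fil l" l
    using assms(3) by (rule nilpotent_algebra_fil)
  show ?thesis
    unfolding Ad_def ad_bch using assms by (intro N.bch_exp ad_fil)
qed

section \<open>Gradings and the group law\<close>

lemma bch_decompose:
  assumes "0 < l"
  shows "bch l x y = x + y + (\<Sum>rs\<in>{rs \<in> dynkin_indices l. 2 \<le> dynkin_size rs}.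
     scale (dynkin_coeff rs) (nested_bracket l (dynkin_word x y rs)))"
    (is "_ = _ + sum ?f ?A")
proof -
  have "rs = [(1, 0)] \<or> rs = [(0, 1)]" if "rs \<in> dynkin_indices l" "dynkin_size rs < 2" for rs
  proof -
    have "length rs \<le> 1"
      using that length_le_dynkin_size[of rs] by (simp add: dynkin_indices_def)
    moreover have "rs \<noteq> []" "\<forall>(r, s)\<in>set rs. 0 < r + s"
      using that by (auto simp: dynkin_indices_def)
    ultimately obtain i j where "rs = [(i, j)]" "0 < i + j"
      by (cases rs) auto
    then show ?thesis
      using that by (auto simp: dynkin_size_def)
  qed
  then have "dynkin_indices l \<subseteq> {[(1, 0)], [(0, 1)]} \<union> ?A"
    using not_less by blast
  moreover have "{[(1, 0)], [(0, 1)]} \<subseteq> dynkin_indices l"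
    using assms by (simp add: dynkin_indices_def dynkin_size_def)
  ultimately have "dynkin_indices l = {[(1, 0)], [(0, 1)]} \<union> ?A"
    by blast
  moreover have "sum ?f ({[(1, 0)], [(0, 1)]} \<union> ?A) = sum ?f {[(1, 0)], [(0, 1)]} + sum ?f ?A"
    by (rule sum.union_disjoint) (auto simp: dynkin_size_def finite_dynkin_indices)
  moreover have "sum ?f {[(1, 0)], [(0, 1)]} = x + y"
    by (simp add: dynkin_coeff_def dynkin_word_def dynkin_size_def)
  ultimately show ?thesis
    by (simp add: bch_def)
qed

lemma length_dynkin_word: "length (dynkin_word x y rs) = dynkin_size rs"
  by (induction rs) (auto simp: dynkin_word_def dynkin_size_def)

lemma set_word: "set (word x y rs) \<subseteq> {x, y}"
proof (induction rs)
  case (Cons ij rs)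
  obtain r s where ij: "ij = (r, s)"
    by (cases ij)
  have word: "word x y (ij # rs) = replicate r x @ replicate s y @ word x y rs"
    by (simp add: word_def ij)
  have "set (replicate r x) \<subseteq> {x, y}" "set (replicate s y) \<subseteq> {x, y}"
    unfolding set_replicate_conv_if by simp_all
  with Cons show ?case
    unfolding word set_append by blast
qed (simp add: word_def)

lemma set_dynkin_word: "set (dynkin_word x y rs) \<subseteq> {x, y}"
  using set_word[of x y rs] by (simp only: word_def dynkin_word_def)

lemma lookup_bch_additive:
  assumes "0 < l"
    and "\<And>w. set w \<subseteq> {x, y} \<Longrightarrow> 2 \<le> length w \<Longrightarrow> lookup (nested_bracket l w) p = 0"
  shows "lookup (bch l x y) p = lookup x p + lookup y p"
proof -
  have "lookup (nested_bracket l (dynkin_word x y rs)) p = 0" if "2 \<le> dynkin_size rs" for rs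
    using assms(2)[OF set_dynkin_word] that by (simp add: length_dynkin_word)
  then show ?thesis
    unfolding bch_decompose[OF assms(1)] by (simp add: lookup_add lookup_sum)
qed

lemma lookup_bracket_trunc:
  "lookup (bracket_trunc l x y) p = (if deg p \<le> l then lookup (lie_bracket x y) p else 0)"
  by (simp add: bracket_trunc_def)

text \<open>Any two points of row 0 have zero \<open>skew\<close>, so the quotient by the span of
  the rows b > 0 is abelian.\<close>

lemma lookup_lie_bracket_fst: "lookup (lie_bracket x y) (a, 0) = 0"
  unfolding lookup_lie_bracket by (rule sum.neutral) (auto simp: skew_def)

lemma nested_bracket_cases:
  assumes "2 \<le> length w"
  obtains u w' where "w = u # w'" "w' \<noteq> []" "nested_bracket l w = bracket_trunc l u (nested_bracket l w')"
  using assms by (cases "(l, w)" rule: nested_bracket.cases) auto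

lemma lookup_bch_fst:
  assumes "0 < l"
  shows "lookup (bch l x y) (a, 0) = lookup x (a, 0) + lookup y (a, 0)"
proof (rule lookup_bch_additive[OF assms])
  fix w :: "lie list" assume "2 \<le> length w"
  then show "lookup (nested_bracket l w) (a, 0) = 0"
    by (rule nested_bracket_cases[of w l]) (simp add: lookup_bracket_trunc lookup_lie_bracket_fst)
qed

lemma bch_0: "bch 0 x y = 0"
proof -
  have "dynkin_indices 0 = {}"
    using length_le_dynkin_size by (fastforce simp: dynkin_indices_def)
  then show ?thesis
    by (simp add: bch_def)
qed

lemma lookup_bch_const: "lookup x (0, 0) = 0 \<Longrightarrow> lookup y (0, 0) = 0 \<Longrightarrow> lookup (bch l x y) (0, 0) = 0"
  by (cases "l = 0") (simp_all add: bch_0 lookup_bch_fst)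

lemma lookup_bch_deg:
  assumes "lookup x p = 0" "lookup y p = 0" "l < deg p"
  shows "lookup (bch l x y) p = 0"
proof (cases "l = 0")
  case False
  have "lookup (bch l x y) p = lookup x p + lookup y p"
  proof (rule lookup_bch_additive)
    fix w :: "lie list" assume "2 \<le> length w"
    then show "lookup (nested_bracket l w) p = 0"
      by (rule nested_bracket_cases[of w l]) (use assms in \<open>simp add: lookup_bracket_trunc\<close>)
  qed (use False in auto)
  then show ?thesis
    using assms by simp
qed (simp add: bch_0)

text \<open>Equality modulo degrees at least l, for elements without component at (0, 0). Truncated
  brackets depend only on these classes: in degree at most l, two factors of positive degree both
  have degree below l.\<close>

definition agree :: "nat \<Rightarrow> lie \<Rightarrow> lie \<Rightarrow> bool" where
  "agree l x y \<longleftrightarrow> lookup x (0, 0) = 0 \<and> lookup y (0, 0) = 0 \<and> (\<forall>p. deg p < l \<longrightarrow> lookup x p = lookup y p)"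

lemma bracket_trunc_agree:
  assumes "agree l x x'" "agree l y y'"
  shows "bracket_trunc l x y = bracket_trunc l x' y'"
proof (rule poly_mapping_eqI)
  fix p :: "nat \<times> nat"
  obtain a b where p: "p = (a, b)"
    by (cases p)
  have "lookup x (i, j) * lookup y (a - i, b - j) = lookup x' (i, j) * lookup y' (a - i, b - j)"
    if "a + b \<le> l" "i \<le> a" "j \<le> b" for i j
  proof (cases "(i, j) = (0, 0) \<or> (a - i, b - j) = (0, 0)")
    case True
    then show ?thesis
      using assms by (elim disjE) (simp_all add: agree_def)
  next
    case False
    then have "deg (i, j) < l" "deg (a - i, b - j) < l"
      using that by (auto simp: deg_def)
    then show ?thesis
      using assms by (simp add: agree_def)
  qed
  then show "lookup (bracket_trunc l x y) p = lookup (bracket_trunc l x' y') p"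
    unfolding p lookup_bracket_trunc lookup_lie_bracket deg_def
    by (auto intro!: sum.cong)
qed

lemma agree_bracket_trunc: "agree l (bracket_trunc l x y) (bracket_trunc l x y)"
  by (simp add: agree_def lookup_bracket_trunc lookup_lie_bracket_fst)

lemma agree_nested_bracket:
  "list_all2 (agree l) w w' \<Longrightarrow> agree l (nested_bracket l w) (nested_bracket l w')"
proof (induction l w arbitrary: w' rule: nested_bracket.induct)
  case (3 l x y zs)
  then obtain x' y' zs' where w': "w' = x' # y' # zs'" and x: "agree l x x'"
      and l: "list_all2 (agree l) (y # zs) (y' # zs')"
    by (auto simp: list_all2_Cons1)
  show ?case
    using bracket_trunc_agree[OF x "3.IH"[OF l]] by (simp add: w' agree_bracket_trunc)
qed (auto simp: list_all2_Cons1 agree_def)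

lemma nested_bracket_agree:
  assumes "list_all2 (agree l) w w'" "2 \<le> length w"
  shows "nested_bracket l w = nested_bracket l w'"
proof -
  obtain x y zs where w: "w = x # y # zs"
    using assms(2) by (cases w rule: remdups_adj.cases) auto
  then obtain x' y' zs' where w': "w' = x' # y' # zs'" and x: "agree l x x'"
      and l: "list_all2 (agree l) (y # zs) (y' # zs')"
    using assms(1) by (auto simp: list_all2_Cons1)
  show ?thesis
    using bracket_trunc_agree[OF x agree_nested_bracket[OF l]] by (simp add: w w')
qed

text \<open>Only the linear part of \<open>bch\<close> depends on components of degree l or more;
  hence elements concentrated in top degree are central.\<close>

lemma bch_agree:
  assumes "0 < l" "agree l x x'" "agree l y y'"
  shows "bch l x y - (x + y) = bch l x' y' - (x' + y')"
proof -
  have "list_all2 (agree l) (dynkin_word x y rs) (dynkin_word x' y' rs)" for rs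
  proof (induction rs)
    case (Cons ij rs)
    have "list_all2 (agree l) (replicate i x) (replicate i x')"
         "list_all2 (agree l) (replicate i y) (replicate i y')" for i
      using assms by (auto simp: list_all2_conv_all_nth)
    with Cons show ?case
      by (cases ij) (auto simp: dynkin_word_def intro!: list_all2_appendI)
  qed (simp add: dynkin_word_def)
  then have "nested_bracket l (dynkin_word x y rs) = nested_bracket l (dynkin_word x' y' rs)"
    if "2 \<le> dynkin_size rs" for rs
    using that nested_bracket_agree by (simp add: length_dynkin_word)
  then show ?thesis
    unfolding bch_decompose[OF assms(1)] by simp
qed

lemma lie_bracket_self [simp]: "lie_bracket x x = 0"
proof -
  have "lie_bracket x y = - lie_bracket y x" for x y
  proof (induction x rule: lie_induct)
    case (single p c)
    show ?case
    proof (induction y rule: lie_induct)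
      case (single q d)
      then show ?case
        by (simp add: lie_bracket_single add_ac skew_swap[of q p] single_uminus [symmetric] algebra_simps)
    qed (simp_all add: lie_bracket_add_left lie_bracket_add_right)
  qed (simp_all add: lie_bracket_add_left lie_bracket_add_right)
  from this[of x x] show ?thesis
    by (intro poly_mapping_eqI) (metis lookup_uminus lookup_zero neg_equal_zero)
qed

lemma bch_zero_left:
  assumes "0 < l"
  shows "bch l 0 y = y"
proof -
  have zero: "bracket_trunc l u v = 0" if "u \<in> {0, y}" "v \<in> {0, y}" for u v l
    using that by (auto intro!: poly_mapping_eqI simp: lookup_bracket_trunc)
  have "nested_bracket l w \<in> {0, y} \<and> (2 \<le> length w \<longrightarrow> nested_bracket l w = 0)" if "set w \<subseteq> {0, y}" for w
    using that by (induction l w rule: nested_bracket.induct) (auto simp: zero)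
  then show ?thesis
    by (intro poly_mapping_eqI) (subst lookup_bch_additive, use assms in auto)
qed

definition top_degree :: "nat \<Rightarrow> lie \<Rightarrow> bool" where
  "top_degree l z \<longleftrightarrow> (\<forall>p. deg p < l \<longrightarrow> lookup z p = 0)"

lemma bch_top_right:
  assumes "0 < l" "lookup x (0, 0) = 0" "lookup y (0, 0) = 0" "top_degree l z"
  shows "bch l x (y + z) = bch l x y + z"
proof -
  have "agree l x x" "agree l (y + z) y"
    using assms by (auto simp: agree_def top_degree_def lookup_add deg_def)
  then show ?thesis
    using bch_agree[OF assms(1), of x x "y + z" y] by (simp add: algebra_simps)
qed

lemma bch_top_left:
  assumes "0 < l" "lookup y (0, 0) = 0" "top_degree l z"
  shows "bch l z y = z + y"
proof -
  have "agree l z 0" "agree l y y"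
    using assms by (auto simp: agree_def top_degree_def deg_def)
  then show ?thesis
    using bch_agree[OF assms(1), of z 0 y y] bch_zero_left[OF assms(1), of y] by (simp add: algebra_simps)
qed

section \<open>Compatibility of \<open>bch\<close> with truncation\<close>

lemma trunc_add: "trunc l (x + y) = trunc l x + trunc l y"
  by (rule poly_mapping_eqI) (simp add: lookup_add)

lemma trunc_zero [simp]: "trunc l 0 = 0"
  by (rule poly_mapping_eqI) simp

lemma trunc_scale: "trunc l (scale c x) = scale c (trunc l x)"
  by (rule poly_mapping_eqI) simp

lemma trunc_sum: "trunc l (sum f A) = (\<Sum>i\<in>A. trunc l (f i))"
  by (induction A rule: infinite_finite_induct) (auto simp: trunc_add)

lemma trunc_bracket_trunc:
  "trunc l (bracket_trunc (Suc l) x y) = bracket_trunc l (trunc l x) (trunc l y)"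
proof -
  have "trunc l (lie_bracket (trunc l x) (trunc l y)) = trunc l (lie_bracket x y)"
    unfolding trunc_eq_restr
    by (subst restr_lie_bracket_left, fastforce simp: deg_def)
      (rule restr_lie_bracket_right, simp add: deg_def)
  moreover have "trunc l (trunc (Suc l) z) = trunc l z" for z
    by (rule poly_mapping_eqI) simp
  ultimately show ?thesis
    by (simp add: bracket_trunc_def)
qed

lemma trunc_nested_bracket:
  "trunc l (nested_bracket (Suc l) w) = nested_bracket l (map (trunc l) w)"
  by (induction "Suc l" w rule: nested_bracket.induct) (simp_all add: trunc_bracket_trunc)

text \<open>Each letter starts in degree 1, so a bracket of n letters starts in degree n.\<close>

lemma lookup_nested_bracket_deg:
  assumes "\<forall>x\<in>set w. lookup x (0, 0) = 0" "deg p < length w"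
  shows "lookup (nested_bracket l w) p = 0"
  using assms
proof (induction l w arbitrary: p rule: nested_bracket.induct)
  case (2 l x)
  then show ?case
    by (cases p) (simp add: deg_def)
next
  case (3 l x y zs)
  obtain a b where p: "p = (a, b)"
    by (cases p)
  have "lookup x (i, j) * lookup (nested_bracket l (y # zs)) (a - i, b - j) = 0" if "i \<le> a" "j \<le> b" for i j
  proof (cases "(i, j) = (0, 0)")
    case False
    then have "deg (a - i, b - j) < length (y # zs)"
      using that 3(3) unfolding p deg_def by auto
    then show ?thesis
      using 3 by simp
  qed (use 3 in simp)
  then show ?case
    unfolding p by (auto simp: lookup_bracket_trunc lookup_lie_bracket intro!: sum.neutral)
qed simp

lemma trunc_bch:
  assumes "lookup x (0, 0) = 0" "lookup y (0, 0) = 0"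
  shows "trunc l (bch (Suc l) x y) = bch l (trunc l x) (trunc l y)"
proof -
  let ?f = "\<lambda>rs. scale (dynkin_coeff rs) (nested_bracket l (dynkin_word (trunc l x) (trunc l y) rs))"
  have "map (trunc l) (dynkin_word x y rs) = dynkin_word (trunc l x) (trunc l y) rs" for rs
    by (induction rs) (auto simp: dynkin_word_def)
  then have "trunc l (bch (Suc l) x y) = sum ?f (dynkin_indices (Suc l))"
    by (simp add: bch_def trunc_sum trunc_scale trunc_nested_bracket)
  \<comment> \<open>The additional words have l + 1 letters and contribute nothing in degree at most
    l.\<close>
  also have "\<dots> = sum ?f (dynkin_indices l)"
  proof (rule sum.mono_neutral_right)
    show "\<forall>rs\<in>dynkin_indices (Suc l) - dynkin_indices l. ?f rs = 0"
    proof
      fix rs assume "rs \<in> dynkin_indices (Suc l) - dynkin_indices l"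
      then have size: "dynkin_size rs = Suc l"
        by (auto simp: dynkin_indices_def)
      have "lookup (nested_bracket l (dynkin_word (trunc l x) (trunc l y) rs)) p = 0" for p
      proof (cases "deg p \<le> l")
        case True
        then show ?thesis
          using assms set_dynkin_word[of "trunc l x" "trunc l y" rs] size
          by (intro lookup_nested_bracket_deg) (auto simp: length_dynkin_word deg_def)
      next
        case False
        have "lookup (nested_bracket l w) p = 0" if "set w \<subseteq> {trunc l x, trunc l y}" for w
          using that False
          by (induction l w rule: nested_bracket.induct) (auto simp: lookup_bracket_trunc)
        then show ?thesis
          using set_dynkin_word by blast
      qed
      then show "?f rs = 0"
        by (simp add: poly_mapping_eqI)
    qed
  qed (simp add: finite_dynkin_indices, auto simp: dynkin_indices_def)
  also have "\<dots> = bch l (trunc l x) (trunc l y)"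
    by (simp add: bch_def)
  finally show ?thesis .
qed

section \<open>Ordered products\<close>

text \<open>Dividing by a + b rather than by a keeps the denominator positive at (0, b) as well. The
  order becomes lexicographic in slope and degree.\<close>

definition slope :: "nat \<times> nat \<Rightarrow> rat" where
  "slope p = of_nat (snd p) / of_nat (deg p)"

lemma deg_pos: "p \<in> Nplus \<Longrightarrow> 0 < deg p"
  by (cases p) (auto simp: Nplus_def deg_def)

lemma slope_less_iff:
  assumes "p \<in> Nplus" "q \<in> Nplus"
  shows "slope p < slope q \<longleftrightarrow> skew p q < 0"
proof -
  have "slope p < slope q \<longleftrightarrow> (of_nat (snd p * deg q) :: rat) < of_nat (snd q * deg p)"
    using assms[THEN deg_pos] by (simp add: slope_def divide_simps mult.commute)
  also have "\<dots> \<longleftrightarrow> snd p * deg q < snd q * deg p"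
    by (simp only: of_nat_less_iff)
  also have "\<dots> \<longleftrightarrow> int (snd p * deg q) < int (snd q * deg p)"
    by (simp only: of_nat_less_iff)
  also have "\<dots> \<longleftrightarrow> skew p q < 0"
    by (simp add: skew_def deg_def algebra_simps)
  finally show ?thesis .
qed

lemma of_nat_slope:
  assumes "p \<in> Nplus"
  shows "(of_nat (snd p) :: rat) = slope p * of_nat (deg p)"
    "(of_nat (fst p) :: rat) = (1 - slope p) * of_nat (deg p)"
proof -
  show 1: "(of_nat (snd p) :: rat) = slope p * of_nat (deg p)"
    using deg_pos[OF assms] by (simp add: slope_def)
  show "(of_nat (fst p) :: rat) = (1 - slope p) * of_nat (deg p)"
    unfolding left_diff_distrib 1 [symmetric] by (simp add: deg_def)
qed

lemma slope_deg_inj: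
  assumes "p \<in> Nplus" "q \<in> Nplus" "slope p = slope q" "deg p = deg q"
  shows "p = q"
proof -
  have "(of_nat (snd p) :: rat) = of_nat (snd q)" "(of_nat (fst p) :: rat) = of_nat (fst q)"
    using assms by (simp_all only: of_nat_slope)
  then show ?thesis
    by (simp add: prod_eq_iff)
qed

lemma Nplus_less_iff:
  assumes "p \<in> Nplus" "q \<in> Nplus"
  shows "Nplus_less p q \<longleftrightarrow> slope p < slope q \<or> slope p = slope q \<and> deg p < deg q"
proof -
  have pos: "0 < deg p" "0 < deg q"
    using assms by (auto intro: deg_pos)
  have "(\<exists>k::rat. 1 \<le> k \<and> of_nat (fst q) = k * of_nat (fst p) \<and> of_nat (snd q) = k * of_nat (snd p))
      \<longleftrightarrow> slope p = slope q \<and> deg p \<le> deg q" (is "?L \<longleftrightarrow> ?R")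
  proof
    assume ?L
    then obtain k :: rat where k: "1 \<le> k" "of_nat (fst q) = k * of_nat (fst p)" "of_nat (snd q) = k * of_nat (snd p)"
      by blast
    then have d: "of_nat (deg q) = k * of_nat (deg p)"
      by (simp add: deg_def algebra_simps)
    moreover have "1 * (of_nat (deg p) :: rat) \<le> k * of_nat (deg p)"
      using k(1) by (rule mult_right_mono) simp
    ultimately have "deg p \<le> deg q"
      by (simp only: mult_1 of_nat_le_iff flip: d)
    then show ?R
      using k d pos by (simp add: slope_def)
  next
    assume ?R
    then show ?L
      using pos
      \<comment> \<open>On a ray the proportionality factor is the ratio of the degrees.\<close>
      by (intro exI[of _ "of_nat (deg q) / of_nat (deg p)"])
        (simp add: of_nat_slope[OF assms(1)] of_nat_slope[OF assms(2)])
  qed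
  moreover have "p = q" if "slope p = slope q" "deg p = deg q"
    using assms that by (rule slope_deg_inj)
  ultimately show ?thesis
    unfolding Nplus_less_def Nplus_le_def slope_less_iff[OF assms, symmetric]
    by (auto simp: order.order_iff_strict)
qed

lemma sorted_Nplus_exists:
  assumes "finite S" "S \<subseteq> Nplus"
  shows "\<exists>ps. sorted_wrt Nplus_less ps \<and> set ps = S"
  using assms
proof (induction S rule: finite_induct)
  case (insert p S)
  then obtain ps where ps: "sorted_wrt Nplus_less ps" "set ps = S"
    by auto
  let ?qs = "filter (\<lambda>q. Nplus_less q p) ps @ p # filter (\<lambda>q. Nplus_less p q) ps"
  have p: "p \<in> Nplus" and S: "q \<in> Nplus" if "q \<in> S" for q
    using insert.prems that by auto
  have total: "Nplus_less q p \<or> Nplus_less p q" if "q \<in> S" for q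
  proof -
    have "q \<noteq> p"
      using that insert.hyps by auto
    then have "slope p \<noteq> slope q \<or> deg p \<noteq> deg q"
      using p[OF that] S[OF that] slope_deg_inj[of p q] by auto
    then show ?thesis
      using p[OF that] S[OF that] by (auto simp: Nplus_less_iff)
  qed
  have "sorted_wrt Nplus_less ?qs"
    using ps insert.prems by (auto simp: sorted_wrt_append sorted_wrt_filter Nplus_less_iff subset_eq)
  moreover have "set ?qs = insert p S"
    using total ps(2) by auto
  ultimately show ?case
    by blast
qed simp

lemma sorted_Nplus_unique:
  assumes "sorted_wrt Nplus_less ps" "sorted_wrt Nplus_less qs" "set ps = set qs" "set ps \<subseteq> Nplus"
  shows "ps = qs"
  using assms
proof (induction ps arbitrary: qs)
  case (Cons p ps)
  then obtain q qs' where qs: "qs = q # qs'"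
    by (cases qs) auto
  have asym: "\<not> Nplus_less y x" if "Nplus_less x y" "x \<in> Nplus" "y \<in> Nplus" for x y
    using that by (auto simp: Nplus_less_iff)
  have irrefl: "\<not> Nplus_less x x" for x
    by (simp add: Nplus_less_def)
  have "p = q"
  proof (rule ccontr)
    assume "p \<noteq> q"
    then have "Nplus_less p q" "Nplus_less q p"
      using Cons.prems unfolding qs by auto
    moreover have "p \<in> Nplus" "q \<in> Nplus"
      using Cons.prems unfolding qs by auto
    ultimately show False
      using asym by blast
  qed
  moreover have "p \<notin> set ps" "q \<notin> set qs'"
    using Cons.prems irrefl[of p] irrefl[of q] unfolding qs by auto
  then have "set ps = set qs'"
    using Cons.prems(3) \<open>p = q\<close> unfolding qs by auto
  ultimately show ?case
    using Cons.IH[of qs'] Cons.prems unfolding qs by auto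
qed simp

definition sorted_points :: "nat \<Rightarrow> (nat \<times> nat) list" where
  "sorted_points l = (SOME ps. sorted_wrt Nplus_less ps \<and> set ps = {p \<in> Nplus. deg p \<le> l})"

lemma finite_deg_le: "finite {p. deg p \<le> l}"
  by (rule finite_subset[of _ "{..l} \<times> {..l}"]) (auto simp: deg_def)

lemma sorted_points:
  "sorted_wrt Nplus_less (sorted_points l)" "set (sorted_points l) = {p \<in> Nplus. deg p \<le> l}"
proof -
  have "finite {p \<in> Nplus. deg p \<le> l}"
    using finite_deg_le by (rule finite_subset [rotated]) auto
  then have "\<exists>ps. sorted_wrt Nplus_less ps \<and> set ps = {p \<in> Nplus. deg p \<le> l}"
    by (rule sorted_Nplus_exists) auto
  from someI_ex[OF this] show "sorted_wrt Nplus_less (sorted_points l)"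
      "set (sorted_points l) = {p \<in> Nplus. deg p \<le> l}"
    by (auto simp: sorted_points_def)
qed

lemma sorted_points_unique:
  "sorted_wrt Nplus_less ps \<Longrightarrow> set ps = {p \<in> Nplus. deg p \<le> l} \<Longrightarrow> ps = sorted_points l"
  using sorted_points by (intro sorted_Nplus_unique) auto

lemma filter_sorted_points: "filter (\<lambda>p. deg p \<le> l) (sorted_points (Suc l)) = sorted_points l"
  by (rule sorted_points_unique) (auto simp: sorted_wrt_filter sorted_points)

lemma distinct_sorted_points: "distinct (sorted_points l)"
proof -
  have "sorted_wrt Nplus_less ps \<Longrightarrow> distinct ps" for ps
    by (induction ps) (auto simp: Nplus_less_def)
  then show ?thesis
    using sorted_points(1) by blast
qed

section \<open>Dilogarithm elements\<close>

lemma lookup_dilog: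
  "lookup (dilog p l) q = (if deg q \<le> l then
     \<Sum>j\<in>{1..l}. if (j * fst p, j * snd p) = q then (- 1) ^ (j + 1) / of_nat j ^ 2 else 0 else 0)"
  unfolding dilog_def lookup_trunc lookup_sum lookup_single when_def ..

lemma lookup_dilog_multiple:
  assumes "p \<in> Nplus" "0 < j" "deg (j * fst p, j * snd p) \<le> l"
  shows "lookup (dilog p l) (j * fst p, j * snd p) = (- 1) ^ (j + 1) / of_nat j ^ 2"
proof -
  have inj: "(i * fst p, i * snd p) = (j * fst p, j * snd p) \<longleftrightarrow> i = j" for i
    using assms(1) by (cases p) (auto simp: Nplus_def)
  \<comment> \<open>The multiple j p has degree at least j, so j survives the cut-off j <= l in
    \<open>dilog\<close>.\<close>
  have "j * 1 \<le> j * deg p"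
    using deg_pos[OF assms(1)] by (intro mult_le_mono2) simp
  also have "\<dots> \<le> l"
    using assms(3) by (simp add: deg_def algebra_simps)
  finally show ?thesis
    using assms by (simp only: lookup_dilog inj) (simp add: inj)
qed

lemma lookup_dilog_zero:
  assumes "\<And>j. 0 < j \<Longrightarrow> q \<noteq> (j * fst p, j * snd p)"
  shows "lookup (dilog p l) q = 0"
proof -
  have "(j * fst p, j * snd p) \<noteq> q" if "j \<in> {1..l}" for j
    using assms[of j] that by auto
  then show ?thesis
    by (simp add: lookup_dilog)
qed

lemma lookup_dilog_const: "p \<in> Nplus \<Longrightarrow> lookup (dilog p l) (0, 0) = 0"
  by (rule lookup_dilog_zero) (cases p, auto simp: Nplus_def)

lemma trunc_dilog:
  assumes "p \<in> Nplus"
  shows "trunc l (dilog p (Suc l)) = dilog p l"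
proof (rule poly_mapping_eqI)
  fix q
  show "lookup (trunc l (dilog p (Suc l))) q = lookup (dilog p l) q"
  proof (cases "\<exists>j>0. q = (j * fst p, j * snd p)")
    case True
    then obtain j where "0 < j" "q = (j * fst p, j * snd p)"
      by blast
    then show ?thesis
      using lookup_dilog_multiple[OF assms, of j "Suc l"] lookup_dilog_multiple[OF assms, of j l]
      by (cases "deg q \<le> l") (auto simp: lookup_dilog)
  next
    case False
    then have "lookup (dilog p k) q = 0" for k
      by (intro lookup_dilog_zero) blast
    then show ?thesis
      by simp
  qed
qed

text \<open>The multiples 2p, 3p, ... already exceed degree l.\<close>

lemma dilog_top:
  assumes "p \<in> Nplus" "deg p = l"
  shows "dilog p l = X p"
proof (rule poly_mapping_eqI)
  fix q
  have "l < deg (j * fst p, j * snd p)" if "1 < j" for j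
  proof -
    have "2 * deg p \<le> j * deg p"
      using that by (intro mult_le_mono1) simp
    then show ?thesis
      using assms(2) deg_pos[OF assms(1)] by (simp add: deg_def algebra_simps)
  qed
  then show "lookup (dilog p l) q = lookup (X p) q"
  proof (cases "q = p")
    case True
    then show ?thesis
      using lookup_dilog_multiple[OF assms(1), of 1 l] assms by simp
  next
    case False
    have "lookup (dilog p l) q = 0"
    proof (cases "deg q \<le> l")
      case True
      have "q \<noteq> (j * fst p, j * snd p)" if "0 < j" for j
        using that True False \<open>\<And>j. 1 < j \<Longrightarrow> l < deg (j * fst p, j * snd p)\<close>[of j]
        by (cases "j = 1") auto
      then show ?thesis
        by (rule lookup_dilog_zero)
    qed (simp add: lookup_dilog)
    then show ?thesis
      using False by (simp add: lookup_single_not_eq)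
  qed
qed

section \<open>Existence and uniqueness of the ordered factorization\<close>

definition ordered_prod :: "nat \<Rightarrow> (nat \<times> nat \<Rightarrow> rat) \<Rightarrow> (nat \<times> nat) list \<Rightarrow> lie" where
  "ordered_prod l u ps = foldr (bch l) (map (\<lambda>p. scale (u p) (dilog p l)) ps) 0"

lemma ordered_prod_Nil [simp]: "ordered_prod l u [] = 0"
  by (simp add: ordered_prod_def)

lemma ordered_prod_Cons [simp]:
  "ordered_prod l u (p # ps) = bch l (scale (u p) (dilog p l)) (ordered_prod l u ps)"
  by (simp add: ordered_prod_def)

lemma lookup_ordered_prod_const: "set ps \<subseteq> Nplus \<Longrightarrow> lookup (ordered_prod l u ps) (0, 0) = 0"
  by (induction ps) (auto simp: lookup_bch_const lookup_dilog_const)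

lemma lookup_ordered_prod_deg: "l < deg p \<Longrightarrow> lookup (ordered_prod l u ps) p = 0"
  by (induction ps) (auto simp: lookup_bch_deg lookup_dilog)

lemma ordered_prod_cong: "(\<And>p. p \<in> set ps \<Longrightarrow> u p = v p) \<Longrightarrow> ordered_prod l u ps = ordered_prod l v ps"
  by (induction ps) auto

lemma trunc_ordered_prod:
  "set ps \<subseteq> Nplus \<Longrightarrow> trunc l (ordered_prod (Suc l) u ps) = ordered_prod l u ps"
  by (induction ps)
    (auto simp: trunc_bch lookup_dilog_const lookup_ordered_prod_const trunc_scale trunc_dilog)

text \<open>Factors of top degree are multiples of single basis vectors and central, so they leave
  the product as a sum.\<close>

lemma ordered_prod_split:
  assumes "set ps \<subseteq> {p \<in> Nplus. deg p \<le> Suc l}"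
  shows "ordered_prod (Suc l) u ps = ordered_prod (Suc l) u (filter (\<lambda>p. deg p \<le> l) ps)
     + (\<Sum>p\<leftarrow>filter (\<lambda>p. deg p = Suc l) ps. Poly_Mapping.single p (u p))"
  using assms
proof (induction ps)
  case (Cons p ps)
  let ?z = "\<Sum>p\<leftarrow>filter (\<lambda>p. deg p = Suc l) ps. Poly_Mapping.single p (u p)"
  let ?y = "ordered_prod (Suc l) u (filter (\<lambda>p. deg p \<le> l) ps)"
  have top: "top_degree (Suc l) ?z"
    by (induction ps) (auto simp: top_degree_def lookup_add lookup_single when_def)
  have y: "lookup ?y (0, 0) = 0"
    using Cons.prems by (intro lookup_ordered_prod_const) auto
  have z: "lookup ?z (0, 0) = 0"
    using top by (simp add: top_degree_def deg_def)
  show ?case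
  proof (cases "deg p \<le> l")
    case True
    then have "ordered_prod (Suc l) u (p # ps) = bch (Suc l) (scale (u p) (dilog p (Suc l))) (?y + ?z)"
      using Cons by simp
    also have "\<dots> = bch (Suc l) (scale (u p) (dilog p (Suc l))) ?y + ?z"
      using Cons.prems by (intro bch_top_right top y) (auto simp: lookup_dilog_const)
    finally show ?thesis
      using True by simp
  next
    case False
    then have deg: "deg p = Suc l" and p: "p \<in> Nplus"
      using Cons.prems by auto
    have X: "scale (u p) (dilog p (Suc l)) = Poly_Mapping.single p (u p)"
      using dilog_top[OF p deg] by (auto intro!: poly_mapping_eqI simp: lookup_single when_def)
    have "ordered_prod (Suc l) u (p # ps) = bch (Suc l) (Poly_Mapping.single p (u p)) (?y + ?z)"
      using Cons X by simp
    also have "\<dots> = Poly_Mapping.single p (u p) + (?y + ?z)"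
      using deg y z by (intro bch_top_left) (auto simp: top_degree_def lookup_add lookup_single when_def)
    finally show ?thesis
      using False deg by (simp add: algebra_simps)
  qed
qed simp

lemma ordered_prod_sorted_points_Suc:
  "ordered_prod (Suc l) u (sorted_points (Suc l)) = ordered_prod (Suc l) u (sorted_points l)
     + (\<Sum>p\<in>{p. deg p = Suc l}. Poly_Mapping.single p (u p))"
proof -
  have "set (filter (\<lambda>p. deg p = Suc l) (sorted_points (Suc l))) = {p. deg p = Suc l}"
    by (auto simp: sorted_points Nplus_def deg_def)
  then have "(\<Sum>p\<leftarrow>filter (\<lambda>p. deg p = Suc l) (sorted_points (Suc l)). Poly_Mapping.single p (u p))
     = (\<Sum>p\<in>{p. deg p = Suc l}. Poly_Mapping.single p (u p))"
    by (subst sum_list_distinct_conv_sum_set) (simp_all add: distinct_sorted_points)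
  then show ?thesis
    by (subst ordered_prod_split) (auto simp: sorted_points filter_sorted_points)
qed

text \<open>The system for the exponents is triangular: at top degree the unknown \<open>u p\<close>
  enters with coefficient 1, and the rest involves lower degrees only.\<close>

lemma lookup_ordered_prod_Suc:
  assumes "deg p = Suc l"
  shows "lookup (ordered_prod (Suc l) u (sorted_points (Suc l))) p
    = lookup (ordered_prod (Suc l) u (sorted_points l)) p + u p"
proof -
  have "finite {p. deg p = Suc l}"
    using finite_deg_le[of "Suc l"] by (rule finite_subset [rotated]) auto
  then have "lookup (\<Sum>p\<in>{p. deg p = Suc l}. Poly_Mapping.single p (u p)) p = u p"
    using assms by (simp add: lookup_sum lookup_single when_def)
  then show ?thesis
    by (simp add: ordered_prod_sorted_points_Suc lookup_add)
qed

lemma is_ordered_product_iff: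
  "is_ordered_product (\<lambda>p. G_pow (dilog p) (u p)) g \<longleftrightarrow> (\<forall>l. g l = ordered_prod l u (sorted_points l))"
proof -
  have sp: "sorted_wrt Nplus_less ps \<and> set ps = {p \<in> Nplus. deg p \<le> l} \<longleftrightarrow> ps = sorted_points l" for ps l
    using sorted_points[of l] sorted_points_unique[of ps l] by blast
  have "(\<exists>ps. sorted_wrt Nplus_less ps \<and> set ps = {p \<in> Nplus. deg p \<le> l} \<and>
        g l = foldr (monoid.mult (G_trunc l)) (map (\<lambda>p. G_pow (dilog p) (u p) l) ps) \<one>\<^bsub>G_trunc l\<^esub>)
      \<longleftrightarrow> g l = ordered_prod l u (sorted_points l)" for l
    unfolding conj_assoc [symmetric] sp by (simp add: G_trunc_def G_pow_def ordered_prod_def)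
  then show ?thesis
    by (simp add: is_ordered_product_def)
qed

text \<open>
  Elements of degree \<open>l\<close> are central in \<open>G_trunc l\<close>, so that the exponents are determined one degree
  at a time.
\<close>

primrec exponent_seq :: "(nat \<Rightarrow> lie) \<Rightarrow> nat \<Rightarrow> nat \<times> nat \<Rightarrow> rat" where
  "exponent_seq g 0 = (\<lambda>p. 0)"
| "exponent_seq g (Suc l) = (\<lambda>p. if deg p = Suc l
     then lookup (g (Suc l)) p - lookup (ordered_prod (Suc l) (exponent_seq g l) (sorted_points l)) p
     else exponent_seq g l p)"

text \<open>This justifies the definite description in \<open>exponents\<close>. The three
  hypotheses say that \<open>g\<close> is an element of \<open>G_lim\<close>.\<close>

lemma ordered_product_exists_unique:
  assumes g: "\<And>l. trunc l (g (Suc l)) = g l" "\<And>l. lookup (g l) (0, 0) = 0"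
    "\<And>l p. l < deg p \<Longrightarrow> lookup (g l) p = 0"
  shows "\<exists>!u. u \<in> extensional Nplus \<and> is_ordered_product (\<lambda>p. G_pow (dilog p) (u p)) g"
proof (rule ex_ex1I)
  \<comment> \<open>The value at p is fixed at stage \<open>deg p\<close> and is not changed later;
    the restriction gives the default value demanded by \<open>extensional\<close>.\<close>
  define u where "u = restrict (\<lambda>p. exponent_seq g (deg p) p) Nplus"
  have seq: "exponent_seq g l p = exponent_seq g (deg p) p" if "deg p \<le> l" for l p
    using that by (induction l) (auto simp: le_Suc_eq)
  have u: "u p = exponent_seq g l p" if "p \<in> Nplus" "deg p \<le> l" for l p
    using that seq[OF that(2)] by (simp add: u_def)
  have "g l = ordered_prod l u (sorted_points l)" for l
  proof (induction l)
    case 0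
    have "sorted_points 0 = []"
    proof -
      have "set (sorted_points 0) = {}"
        unfolding sorted_points using deg_pos by auto
      then show ?thesis
        by simp
    qed
    moreover have "lookup (g 0) p = 0" for p
      using g(2)[of 0] g(3)[of 0 p] by (cases "p = (0, 0)"; cases p) (auto simp: deg_def)
    ultimately show ?case
      by (simp add: poly_mapping_eqI)
  next
    case (Suc l)
    show ?case
    proof (rule poly_mapping_eqI)
      fix p
      consider "deg p \<le> l" | "deg p = Suc l" | "Suc l < deg p"
        by linarith
      then show "lookup (g (Suc l)) p = lookup (ordered_prod (Suc l) u (sorted_points (Suc l))) p"
      proof cases
        case 1
        have "set (sorted_points (Suc l)) \<subseteq> Nplus" "set (sorted_points l) \<subseteq> Nplus"
          by (auto simp: sorted_points)
        then have "trunc l (ordered_prod (Suc l) u (sorted_points (Suc l))) = trunc l (g (Suc l))"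
          unfolding g(1) Suc.IH
          by (intro poly_mapping_eqI) (auto simp: ordered_prod_sorted_points_Suc trunc_add
              trunc_ordered_prod lookup_add trunc_sum lookup_sum lookup_single when_def intro!: sum.neutral)
        then have "lookup (trunc l (ordered_prod (Suc l) u (sorted_points (Suc l)))) p = lookup (trunc l (g (Suc l))) p"
          by simp
        then show ?thesis
          using 1 by simp
      next
        case 2
        have "ordered_prod (Suc l) u (sorted_points l) = ordered_prod (Suc l) (exponent_seq g l) (sorted_points l)"
          by (intro ordered_prod_cong u) (auto simp: sorted_points)
        moreover have "u p = exponent_seq g (Suc l) p"
          using 2 by (intro u) (auto simp: Nplus_def deg_def)
        ultimately show ?thesis
          using 2 by (simp add: lookup_ordered_prod_Suc)
      next
        case 3
        then show ?thesis
          by (simp add: g(3) lookup_ordered_prod_deg)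
      qed
    qed
  qed
  moreover have "u \<in> extensional Nplus"
    by (simp add: u_def)
  ultimately show "\<exists>u. u \<in> extensional Nplus \<and> is_ordered_product (\<lambda>p. G_pow (dilog p) (u p)) g"
    unfolding is_ordered_product_iff by blast
next
  fix u v
  assume "u \<in> extensional Nplus \<and> is_ordered_product (\<lambda>p. G_pow (dilog p) (u p)) g"
    and "v \<in> extensional Nplus \<and> is_ordered_product (\<lambda>p. G_pow (dilog p) (v p)) g"
  then have ext: "u \<in> extensional Nplus" "v \<in> extensional Nplus"
    and "\<forall>l. g l = ordered_prod l u (sorted_points l)" "\<forall>l. g l = ordered_prod l v (sorted_points l)"
    unfolding is_ordered_product_iff by auto
  then have eq: "ordered_prod l u (sorted_points l) = ordered_prod l v (sorted_points l)" for l
    by simp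
  have "\<forall>p\<in>Nplus. deg p \<le> l \<longrightarrow> u p = v p" for l
  proof (induction l)
    case 0
    then show ?case
      using deg_pos by (metis le_zero_eq less_numeral_extra(3))
  next
    case (Suc l)
    then have "ordered_prod (Suc l) u (sorted_points l) = ordered_prod (Suc l) v (sorted_points l)"
      by (intro ordered_prod_cong) (auto simp: sorted_points)
    then have "u p = v p" if "deg p = Suc l" for p
      using eq[of "Suc l"] lookup_ordered_prod_Suc[OF that, of u] lookup_ordered_prod_Suc[OF that, of v]
      by simp
    then show ?case
      using Suc by (auto simp: le_Suc_eq)
  qed
  then show "u = v"
    using ext by (intro extensionalityI[of _ Nplus]) auto
qed

lemma exponents_ordered_product:
  "bch l (scale (of_nat n) (dilog (0, 1) l)) (scale (of_nat m) (dilog (1, 0) l))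
     = ordered_prod l (exponents m n) (sorted_points l)"
proof -
  define g where "g = G_pow (dilog (0, 1)) (of_nat n) \<otimes>\<^bsub>G_lim\<^esub> G_pow (dilog (1, 0)) (of_nat m)"
  have g_eq: "g l = bch l (scale (of_nat n) (dilog (0, 1) l)) (scale (of_nat m) (dilog (1, 0) l))" for l
    by (simp add: g_def G_lim_def G_trunc_def G_pow_def)
  have N: "(0, 1) \<in> Nplus" "(1, 0) \<in> Nplus"
    by (auto simp: Nplus_def)
  have "\<exists>!u. u \<in> extensional Nplus \<and> is_ordered_product (\<lambda>p. G_pow (dilog p) (u p)) g"
  proof (rule ordered_product_exists_unique)
    show "trunc l (g (Suc l)) = g l" for l
      using N by (simp add: g_eq trunc_bch lookup_dilog_const trunc_scale trunc_dilog)
    show "lookup (g l) (0, 0) = 0" for l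
      using N by (simp add: g_eq lookup_bch_const lookup_dilog_const)
    show "lookup (g l) p = 0" if "l < deg p" for l p
      using that by (simp add: g_eq lookup_bch_deg lookup_dilog)
  qed
  from theI'[OF this] have "is_ordered_product (\<lambda>p. G_pow (dilog p) (exponents m n p)) g"
    unfolding exponents_def g_def by simp
  then show ?thesis
    unfolding is_ordered_product_iff using g_eq by simp
qed

section \<open>Comparison of the adjoint actions\<close>

lemma lookup_ordered_prod_fst:
  assumes "0 < l"
  shows "lookup (ordered_prod l u ps) (a, 0) = (\<Sum>p\<leftarrow>ps. u p * lookup (dilog p l) (a, 0))"
  by (induction ps) (simp_all add: lookup_bch_fst[OF assms])

text \<open>\<open>bch\<close> is additive on row 0, so there m log [1,0] equals the sum of the
  u_(i,0) log [i,0]. By induction only i = 1 and i = a can contribute at (a, 0).\<close>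

lemma exponents_fst:
  assumes "0 < a"
  shows "exponents m n (a, 0) = (if a = 1 then of_nat m else 0)"
  using assms
proof (induction a rule: less_induct)
  case (less a)
  let ?u = "exponents m n"
  let ?c = "(- 1) ^ (a + 1) / of_nat a ^ 2 :: rat"
  let ?f = "\<lambda>p. ?u p * lookup (dilog p a) (a, 0)"
  have N: "(1, 0) \<in> Nplus" "(a, 0) \<in> Nplus" "(0, 1) \<in> Nplus"
    using less.prems by (auto simp: Nplus_def)
  have d1: "lookup (dilog (1, 0) a) (a, 0) = ?c"
    using lookup_dilog_multiple[OF N(1) less.prems, of a] by (simp add: deg_def)
  have "lookup (dilog (0, 1) a) (a, 0) = 0"
    by (rule lookup_dilog_zero) auto
  then have "of_nat m * ?c = lookup (ordered_prod a ?u (sorted_points a)) (a, 0)"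
    unfolding exponents_ordered_product [symmetric] using less.prems d1 by (simp add: lookup_bch_fst)
  also have "\<dots> = (\<Sum>p\<in>{p \<in> Nplus. deg p \<le> a}. ?f p)"
    using less.prems distinct_sorted_points[of a]
    by (simp add: lookup_ordered_prod_fst sum_list_distinct_conv_sum_set sorted_points)
  also have "\<dots> = (\<Sum>p\<in>{(1, 0), (a, 0)}. ?f p)"
  proof (rule sum.mono_neutral_right)
    show "finite {p \<in> Nplus. deg p \<le> a}"
      using finite_deg_le by (rule finite_subset [rotated]) auto
    show "{(1, 0), (a, 0)} \<subseteq> {p \<in> Nplus. deg p \<le> a}"
      using N less.prems by (auto simp: deg_def)
    show "\<forall>p\<in>{p \<in> Nplus. deg p \<le> a} - {(1, 0), (a, 0)}. ?f p = 0"
    proof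
      fix p assume p: "p \<in> {p \<in> Nplus. deg p \<le> a} - {(1, 0), (a, 0)}"
      obtain i j where ij: "p = (i, j)"
        by (cases p)
      show "?f p = 0"
      proof (cases "j = 0")
        case True
        then have "0 < i" "i < a" "i \<noteq> 1"
          using p ij by (auto simp: Nplus_def deg_def)
        then show ?thesis
          using less.IH[of i] True ij by simp
      next
        case False
        then have "lookup (dilog p a) (a, 0) = 0"
          by (intro lookup_dilog_zero) (auto simp: ij)
        then show ?thesis
          by simp
      qed
    qed
  qed
  finally have sum: "of_nat m * ?c = (\<Sum>p\<in>{(1, 0), (a, 0)}. ?f p)" .
  show ?case
  proof (cases "a = 1")
    case True
    then show ?thesis
      using sum d1 by simp
  next
    case False
    have "lookup (dilog (a, 0) a) (a, 0) = 1"
      using dilog_top[OF N(2), of a] by (simp add: deg_def)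
    moreover have "?u (1, 0) = of_nat m"
      using less.IH[of 1] False less.prems by simp
    ultimately show ?thesis
      using sum False d1 by simp
  qed
qed

lemma act_app:
  "act (app M \<phi> T) z = (\<Sum>k<M. scale (\<phi> $ k) (act (T ^ k) z))"
  by (simp add: app_def act_sum)

lemma app_zero_arg: "0 < M \<Longrightarrow> app M (fps_exp 1) 0 = 1"
  unfolding app_def by (subst sum.remove[of _ 0]) (auto simp: power_0_left)

lemma Ad_zero [simp]: "Ad l 0 = 1"
  by (simp add: Ad_def app_zero_arg)

lemma Ad_scale: "Ad l (scale c x) = app (Suc l) (fps_exp c) (ad (rank2 l) x)"
  unfolding Ad_def ad_scale app_def
  by (intro sum.cong refl) (simp add: power_sc sc_sc)

lemma Ad_ordered_prod:
  assumes "0 < l" "set ps \<subseteq> Nplus"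
  shows "Ad l (ordered_prod l u ps) = prod_list (map (\<lambda>p. Ad l (scale (u p) (dilog p l))) ps)"
  using assms(2)
  by (induction ps) (simp_all add: Ad_bch assms(1) lookup_ordered_prod_const lookup_dilog_const)

lemma filter_sorted_split:
  assumes "sorted_wrt R ps" "\<And>p q. R p q \<Longrightarrow> q \<in> set ps \<Longrightarrow> p \<in> set ps \<Longrightarrow> Q q \<Longrightarrow> Q p"
  shows "ps = filter Q ps @ filter (\<lambda>p. \<not> Q p) ps"
  using assms
proof (induction ps)
  case (Cons p ps)
  have IH: "ps = filter Q ps @ filter (\<lambda>p. \<not> Q p) ps"
    using Cons.prems by (intro Cons.IH) auto
  show ?case
  proof (cases "Q p")
    case True
    then show ?thesis
      using IH by simp
  next
    case False
    then have "\<forall>q\<in>set ps. \<not> Q q"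
      using Cons.prems by auto
    then show ?thesis
      using False by (simp add: filter_empty_conv)
  qed
qed simp

lemma prod_list_single:
  fixes f :: "'b \<Rightarrow> 'a::monoid_mult"
  assumes "distinct ps" "q \<in> set ps" "\<And>p. p \<in> set ps \<Longrightarrow> p \<noteq> q \<Longrightarrow> f p = 1"
  shows "prod_list (map f ps) = f q"
proof -
  have one: "prod_list (map f qs) = 1" if "\<And>p. p \<in> set qs \<Longrightarrow> f p = 1" for qs
    using that by (induction qs) auto
  obtain xs ys where ps: "ps = xs @ q # ys"
    using assms(2) by (meson split_list)
  have "prod_list (map f xs) = 1" "prod_list (map f ys) = 1"
    using assms(1,3) unfolding ps by (auto intro!: one)
  then show ?thesis
    unfolding ps by simp
qed

definition positive_points :: "nat \<Rightarrow> (nat \<times> nat) list" where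
  "positive_points l = filter (\<lambda>p. snd p \<noteq> 0) (sorted_points l)"

text \<open>The points (a, 0) have slope 0 and come first, and among them only (1, 0) can have a
  nonzero exponent. Hence [1,0]^m splits off on the left.\<close>

lemma Ad_exponents:
  assumes "0 < l"
  shows "Ad l (scale (of_nat n) (dilog (0, 1) l)) * Ad l (scale (of_nat m) (dilog (1, 0) l))
    = Ad l (scale (of_nat m) (dilog (1, 0) l)) *
      prod_list (map (\<lambda>p. Ad l (scale (exponents m n p) (dilog p l))) (positive_points l))"
proof -
  let ?A = "\<lambda>p. Ad l (scale (exponents m n p) (dilog p l))"
  let ?ps = "filter (\<lambda>p. snd p = 0) (sorted_points l)"
  have N: "(0, 1) \<in> Nplus" "(1, 0) \<in> Nplus"
    by (auto simp: Nplus_def)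
  have "snd p = 0" if "Nplus_less p q" "p \<in> Nplus" "q \<in> Nplus" "snd q = 0" for p q
  proof -
    have "slope p \<le> slope q"
      using that Nplus_less_iff by auto
    then show ?thesis
      using that deg_pos[of p] by (simp add: slope_def divide_le_0_iff)
  qed
  then have split: "sorted_points l = ?ps @ positive_points l"
    unfolding positive_points_def
    by (intro filter_sorted_split[OF sorted_points(1)]) (auto simp: sorted_points)
  have "prod_list (map ?A ?ps) = ?A (1, 0)"
  proof (rule prod_list_single)
    show "(1, 0) \<in> set ?ps"
      using assms N by (simp add: sorted_points deg_def)
    show "?A p = 1" if "p \<in> set ?ps" "p \<noteq> (1, 0)" for p
    proof -
      define a where "a = fst p"
      have p: "p = (a, 0)"
        using that by (simp add: a_def prod_eq_iff)
      then have "0 < a" "a \<noteq> 1"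
        using that by (auto simp: sorted_points Nplus_def)
      then show ?thesis
        using exponents_fst[of a m n] p by simp
    qed
  qed (simp add: distinct_sorted_points)
  also have "\<dots> = Ad l (scale (of_nat m) (dilog (1, 0) l))"
    using exponents_fst[of 1 m n] by simp
  finally have "prod_list (map ?A (sorted_points l))
     = Ad l (scale (of_nat m) (dilog (1, 0) l)) * prod_list (map ?A (positive_points l))"
    by (subst split) simp
  moreover have "prod_list (map ?A (sorted_points l)) = Ad l (ordered_prod l (exponents m n) (sorted_points l))"
    by (rule Ad_ordered_prod [symmetric]) (use assms in \<open>auto simp: sorted_points\<close>)
  ultimately show ?thesis
    unfolding exponents_ordered_product [symmetric] using assms N by (simp add: Ad_bch lookup_dilog_const)
qed

section \<open>Action of [1,0] on rows\<close>

definition row :: "nat \<Rightarrow> lie \<Rightarrow> rat fps" where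
  "row b z = Abs_fps (\<lambda>a. lookup z (a, b))"

lemma row_nth [simp]: "row b z $ a = lookup z (a, b)"
  by (simp add: row_def)

lemma lookup_ad:
  "lookup (act (ad (rank2 l) x) z) (a, b) = (if (a, b) \<in> rank2 l then
     \<Sum>i\<le>a. \<Sum>j\<le>b. lookup x (i, j) * lookup z (a - i, b - j) * of_int (skew (i, j) (a - i, b - j)) else 0)"
  by (simp add: act_ad lookup_lie_bracket sum.cartesian_product)

lemma lookup_ad_dilog_10:
  assumes "(a, b) \<in> rank2 l"
  shows "lookup (act (ad (rank2 l) (dilog (1, 0) l)) z) (a, b)
    = (fps_const (- of_nat b) * fps_ln 1 * row b z) $ a"
proof -
  let ?x = "dilog (1, 0) l"
  have N: "(1, 0) \<in> Nplus"
    by (auto simp: Nplus_def)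
  have x: "lookup ?x (i, j) = 0" if "0 < j" for i j
    using that by (intro lookup_dilog_zero) auto
  \<comment> \<open>\<open>skew (i, 0) (a - i, b)\<close> is -i b; it cancels one factor of i^2 in
    the dilogarithm and leaves the coefficients of -b log (1 + x).\<close>
  have x0: "lookup ?x (i, 0) * y * of_int (skew (i, 0) (a - i, b)) = - of_nat b * fps_ln 1 $ i * y"
    if "i \<le> a" for i y
  proof (cases "i = 0")
    case False
    have "lookup ?x (i, 0) = (- 1) ^ (i + 1) / of_nat i ^ 2"
      using lookup_dilog_multiple[OF N, of i l] False that assms by (simp add: rank2_def deg_def)
    then show ?thesis
      using False by (cases i) (simp_all add: fps_ln_nth skew_def power2_eq_square del: of_nat_Suc)
  qed (use lookup_dilog_const[OF N] in simp)
  have "lookup (act (ad (rank2 l) ?x) z) (a, b)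
      = (\<Sum>i\<le>a. lookup ?x (i, 0) * lookup z (a - i, b) * of_int (skew (i, 0) (a - i, b)))"
  proof -
    have "(\<Sum>j\<le>b. lookup ?x (i, j) * A j * B j) = lookup ?x (i, 0) * A 0 * B 0" for i A B
      by (subst sum.remove[of _ 0]) (auto simp: x simp del: One_nat_def)
    then show ?thesis
      unfolding lookup_ad if_P[OF assms] by simp
  qed
  also have "\<dots> = (\<Sum>i\<le>a. - of_nat b * fps_ln 1 $ i * lookup z (a - i, b))"
    by (intro sum.cong refl x0) simp
  finally show ?thesis
    by (simp only: fps_mult_nth[of "fps_const (- of_nat b) * fps_ln 1"] fps_mult_left_const_nth
        row_nth atMost_atLeast0)
qed

lemma fps_mult_nth_cong:
  "(\<And>i. i \<le> n \<Longrightarrow> a $ i = b $ i) \<Longrightarrow> (c * a) $ n = (c * b) $ n"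
  unfolding fps_mult_nth by (intro sum.cong refl) auto

lemma rank2_le: "(a, b) \<in> rank2 l \<Longrightarrow> i \<le> a \<Longrightarrow> (i, b) \<in> rank2 l"
  by (auto simp: rank2_def deg_def)

lemma lookup_Ad_dilog_10:
  assumes "(a, b) \<in> rank2 l"
  shows "lookup (act (Ad l (scale c (dilog (1, 0) l))) z) (a, b)
    = (fps_binomial (- of_nat b * c) * row b z) $ a"
proof -
  let ?T = "ad (rank2 l) (dilog (1, 0) l)"
  let ?L = "fps_const (- of_nat b) * fps_ln 1 :: rat fps"
  have power: "lookup (act (?T ^ k) z) (a, b) = (?L ^ k * row b z) $ a" if "(a, b) \<in> rank2 l" for k a
    using that
  proof (induction k arbitrary: a)
    case (Suc k)
    have "lookup (act (?T ^ Suc k) z) (a, b) = (?L * row b (act (?T ^ k) z)) $ a"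
      using lookup_ad_dilog_10[OF Suc.prems] by simp
    also have "\<dots> = (?L * (?L ^ k * row b z)) $ a"
      using Suc rank2_le by (intro fps_mult_nth_cong) simp
    finally show ?case
      by (simp add: mult.assoc)
  qed simp
  \<comment> \<open>Cutting the exponential off after k = l is exact here: log (1 + x)^k starts with
    x^k, and only coefficients i <= a <= l occur.\<close>
  have coeff: "(fps_binomial (- of_nat b * c) :: rat fps) $ i = (\<Sum>k<Suc l. fps_exp c $ k * (?L ^ k) $ i)" if "i \<le> a" for i
  proof -
    have "i \<le> l"
      using that assms by (auto simp: rank2_def deg_def)
    have "fps_binomial (- of_nat b * c) $ i = (\<Sum>k = 0..i. fps_exp (- of_nat b * c) $ k * (fps_ln 1 ^ k) $ i)"
      unfolding fps_exp_compose_ln [symmetric] fps_compose_nth ..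
    also have "\<dots> = (\<Sum>k<Suc l. fps_exp (- of_nat b * c) $ k * (fps_ln 1 ^ k) $ i)"
      by (rule sum.mono_neutral_left)
        (use \<open>i \<le> l\<close> startsby_zero_power_prefix[of "fps_ln 1 :: rat fps"] in auto)
    also have "\<dots> = (\<Sum>k<Suc l. fps_exp c $ k * (?L ^ k) $ i)"
      unfolding fps_exp_nth power_mult_distrib fps_const_power fps_mult_left_const_nth
      by (intro sum.cong refl) (simp add: mult_ac)
    finally show ?thesis .
  qed
  have "lookup (act (Ad l (scale c (dilog (1, 0) l))) z) (a, b)
      = (\<Sum>k<Suc l. fps_exp c $ k * (?L ^ k * row b z) $ a)"
    unfolding Ad_scale act_app lookup_sum lookup_scale power[OF assms] ..
  also have "\<dots> = ((\<Sum>k<Suc l. fps_const (fps_exp c $ k) * ?L ^ k) * row b z) $ a"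
    by (simp add: sum_distrib_right fps_sum_nth mult.assoc del: sum.lessThan_Suc)
  also have "\<dots> = (row b z * (\<Sum>k<Suc l. fps_const (fps_exp c $ k) * ?L ^ k)) $ a"
    by (simp only: mult.commute)
  also have "\<dots> = (row b z * fps_binomial (- of_nat b * c)) $ a"
    by (rule fps_mult_nth_cong) (simp only: coeff fps_sum_nth fps_mult_left_const_nth)
  finally show ?thesis
    by (simp only: mult.commute)
qed

section \<open>Action of the remaining factors on rows 0, 1 and 2\<close>

lemma lookup_ad_power_zero:
  assumes "\<And>i. lookup x (i, 0) = 0" "b < k"
  shows "lookup (act (ad (rank2 l) x ^ k) z) (a, b) = 0"
  using assms(2)
proof (induction k arbitrary: a b)
  case (Suc k)
  have "lookup x (i, j) * lookup (act (ad (rank2 l) x ^ k) z) (a - i, b - j) = 0" if "j \<le> b" for i j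
    using assms(1) Suc.IH[of "b - j" "a - i"] Suc.prems that by (cases "j = 0") auto
  then show ?case
    by (auto simp: lookup_ad intro!: sum.neutral)
qed simp

text \<open>Bracketing with \<open>x\<close> moves up at least one row, so on row b the exponential
  series stops after b steps.\<close>

lemma lookup_Ad_positive:
  assumes x: "\<And>i. lookup x (i, 0) = 0" and "2 \<le> l"
  shows "lookup (act (Ad l x) z) (a, 0) = lookup z (a, 0)"
    "lookup (act (Ad l x) z) (a, 1) = lookup z (a, 1) + lookup (act (ad (rank2 l) x) z) (a, 1)"
    "lookup (act (Ad l x) z) (a, 2) = lookup z (a, 2) + lookup (act (ad (rank2 l) x) z) (a, 2)
       + lookup (act (ad (rank2 l) x) (act (ad (rank2 l) x) z)) (a, 2) / 2"
proof -
  let ?T = "ad (rank2 l) x"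
  have *: "lookup (act (Ad l x) z) (a, b) = (\<Sum>k\<le>b. lookup (act (?T ^ k) z) (a, b) / fact k)" if "b \<le> 2" for b
  proof -
    have "lookup (act (Ad l x) z) (a, b) = (\<Sum>k<Suc l. lookup (act (?T ^ k) z) (a, b) / fact k)"
      by (simp only: Ad_def act_app lookup_sum lookup_scale) simp
    also have "\<dots> = (\<Sum>k\<le>b. lookup (act (?T ^ k) z) (a, b) / fact k)"
      using that assms(2) lookup_ad_power_zero[OF x, of b]
      by (intro sum.mono_neutral_right) (auto simp: not_le)
    finally show ?thesis .
  qed
  show "lookup (act (Ad l x) z) (a, 0) = lookup z (a, 0)"
    using *[of 0] by simp
  show "lookup (act (Ad l x) z) (a, 1) = lookup z (a, 1) + lookup (act ?T z) (a, 1)"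
    using *[of 1] by simp
  show "lookup (act (Ad l x) z) (a, 2) = lookup z (a, 2) + lookup (act ?T z) (a, 2)
       + lookup (act ?T (act ?T z)) (a, 2) / 2"
    using *[of 2] by (simp add: numeral_2_eq_2)
qed

lemma lookup_ad_0: "lookup (act (ad (rank2 l) x) z) (0, b) = 0"
  by (simp add: lookup_ad skew_def)

lemma lookup_ad_1:
  assumes "\<And>i. lookup x (i, 0) = 0" "Suc k + 1 \<le> l"
  shows "lookup (act (ad (rank2 l) x) z) (Suc k, 1) =
    (\<Sum>i\<le>Suc k. lookup x (i, 1) * lookup z (Suc k - i, 0) * of_nat (Suc k - i))"
proof -
  have "(Suc k, 1) \<in> rank2 l"
    using assms(2) by (simp add: rank2_def deg_def)
  then show ?thesis
    unfolding lookup_ad by (simp add: assms(1) skew_def)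
qed

lemma lookup_ad_2:
  assumes "\<And>i. lookup x (i, 0) = 0" "Suc k + 2 \<le> l"
  shows "lookup (act (ad (rank2 l) x) z) (Suc k, 2) =
    (\<Sum>i\<le>Suc k. lookup x (i, 1) * lookup z (Suc k - i, 1) * (of_nat (Suc k) - 2 * of_nat i))
    + 2 * (\<Sum>i\<le>Suc k. lookup x (i, 2) * lookup z (Suc k - i, 0) * of_nat (Suc k - i))"
proof -
  have "lookup (act (ad (rank2 l) x) z) (Suc k, 2) =
    (\<Sum>i\<le>Suc k. lookup x (i, 1) * lookup z (Suc k - i, 1) * of_int (skew (i, 1) (Suc k - i, 1))
      + lookup x (i, 2) * lookup z (Suc k - i, 0) * of_int (skew (i, 2) (Suc k - i, 0)))"
  proof -
    have "(Suc k, 2) \<in> rank2 l"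
      using assms(2) by (simp add: rank2_def deg_def)
    then show ?thesis
      unfolding lookup_ad by (simp add: assms(1) numeral_2_eq_2)
  qed
  also have "\<dots> = (\<Sum>i\<le>Suc k. lookup x (i, 1) * lookup z (Suc k - i, 1) * (of_nat (Suc k) - 2 * of_nat i)
      + 2 * (lookup x (i, 2) * lookup z (Suc k - i, 0) * of_nat (Suc k - i)))"
    by (intro sum.cong refl) (simp add: skew_def of_nat_diff)
  finally show ?thesis
    by (simp only: sum.distrib sum_distrib_left)
qed

text \<open>An invariant of the images of X_(1,0) under the factors with b > 0. A bracket against
  row 0 then picks out one coefficient, and the zeros in column 0 remove boundary terms.\<close>

definition normalized :: "nat \<Rightarrow> lie \<Rightarrow> bool" where
  "normalized l z \<longleftrightarrow> (\<forall>a\<le>l. lookup z (a, 0) = (if a = 1 then 1 else 0)) \<and> lookup z (0, 1) = 0 \<and> lookup z (0, 2) = 0"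

lemma sum_normalized:
  assumes "normalized l z" "Suc k \<le> l"
  shows "(\<Sum>i\<le>Suc k. f i * lookup z (Suc k - i, 0) * of_nat (Suc k - i)) = f k"
proof -
  have "(\<Sum>i\<le>Suc k. f i * lookup z (Suc k - i, 0) * of_nat (Suc k - i))
      = (\<Sum>i\<le>Suc k. if i = k then f k else 0)"
    using assms by (intro sum.cong refl) (auto simp: normalized_def)
  then show ?thesis
    by simp
qed

lemma lookup_dilog_snd:
  assumes "snd p \<noteq> 0" "i + b \<le> l"
  shows "b = 0 \<Longrightarrow> lookup (dilog p l) (i, b) = 0"
    "b = 1 \<Longrightarrow> lookup (dilog p l) (i, b) = (if p = (i, 1) then 1 else 0)"
    "b = 2 \<Longrightarrow> lookup (dilog p l) (i, b) = (if p = (i, 2) then 1 else if snd p = 1 \<and> 2 * fst p = i then - 1 / 4 else 0)"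
proof -
  have N: "p \<in> Nplus"
    using assms(1) by (cases p) (auto simp: Nplus_def)
  show "lookup (dilog p l) (i, b) = 0" if "b = 0"
    using assms(1) that by (intro lookup_dilog_zero) auto
  show "lookup (dilog p l) (i, b) = (if p = (i, 1) then 1 else 0)" if "b = 1"
  proof (cases "p = (i, 1)")
    case True
    then show ?thesis
      using lookup_dilog_multiple[OF N, of 1 l] assms(2) that by (simp add: deg_def)
  next
    case False
    then show ?thesis
      using that by (subst lookup_dilog_zero) (auto simp: prod_eq_iff)
  qed
  show "lookup (dilog p l) (i, b) = (if p = (i, 2) then 1 else if snd p = 1 \<and> 2 * fst p = i then - 1 / 4 else 0)"
    if "b = 2"
  proof -
    consider "p = (i, 2)" | "snd p = 1" "2 * fst p = i" | "p \<noteq> (i, 2)" "\<not> (snd p = 1 \<and> 2 * fst p = i)"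
      by blast
    then show ?thesis
    proof cases
      case 1
      then show ?thesis
        using lookup_dilog_multiple[OF N, of 1 l] assms(2) that by (simp add: deg_def)
    next
      case 2
      then have "p \<noteq> (i, 2)"
        by (cases p) auto
      then show ?thesis
        using 2 lookup_dilog_multiple[OF N, of 2 l] assms(2) that by (simp add: deg_def)
    next
      case 3
      have "(i, b) \<noteq> (j * fst p, j * snd p)" if "0 < j" for j
      proof
        assume *: "(i, b) = (j * fst p, j * snd p)"
        then have "j * snd p = 2"
          using \<open>b = 2\<close> by simp
        then have "j \<le> 2"
          by (metis assms(1) dvdI dvd_imp_le zero_less_numeral)
        then have "j = 1 \<or> j = 2"
          using that by linarith
        then show False
          using * 3 \<open>b = 2\<close> by (auto simp: prod_eq_iff)
      qed
      then show ?thesis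
        using 3 by (subst lookup_dilog_zero) auto
    qed
  qed
qed

lemma normalized_X: "normalized l (X (1, 0))"
  by (auto simp: normalized_def lookup_single when_def)

text \<open>The index \<open>Suc k\<close> is the shift by X_(1,0). In row 2 the factor 2 of 2c and
  the weight k + 1 - 2i for p = (i, 1) are values of \<open>skew\<close>. The last term combines
  c^2/2 from second order of the exponential with 2 (-c/4) from the j = 2 term of the
  dilogarithm.\<close>

lemma Ad_dilog_positive:
  fixes c :: rat
  assumes p: "snd p \<noteq> 0" and z: "normalized l z" and l: "2 \<le> l"
  defines "z' \<equiv> act (Ad l (scale c (dilog p l))) z"
  shows "normalized l z'"
    "k + 2 \<le> l \<Longrightarrow> lookup z' (Suc k, 1) = lookup z (Suc k, 1) + (if p = (k, 1) then c else 0)"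
    "k + 3 \<le> l \<Longrightarrow> lookup z' (Suc k, 2) = lookup z (Suc k, 2) + (if p = (k, 2) then 2 * c else 0)
       + (if snd p = 1 \<and> fst p \<le> k then c * lookup z (Suc (k - fst p), 1) * (of_nat k + 1 - 2 * of_nat (fst p)) else 0)
       + (if snd p = 1 \<and> 2 * fst p = k then c ^ 2 / 2 - c / 2 else 0)"
proof -
  define x where "x = scale c (dilog p l)"
  let ?T = "ad (rank2 l) x"
  have z'_eq: "z' = act (Ad l x) z"
    by (simp add: z'_def x_def)
  have x0: "lookup x (i, 0) = 0" for i
    using p by (simp add: x_def lookup_dilog_zero)
  have x1: "lookup x (i, 1) = (if p = (i, 1) then c else 0)" if "i + 1 \<le> l" for i
    using lookup_dilog_snd(2)[OF p that] by (simp add: x_def)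
  have x2: "lookup x (i, 2) = (if p = (i, 2) then c else if snd p = 1 \<and> 2 * fst p = i then - c / 4 else 0)"
    if "i + 2 \<le> l" for i
    using lookup_dilog_snd(3)[OF p that] by (simp add: x_def)
  show "normalized l z'"
    using z by (simp add: normalized_def z'_eq lookup_Ad_positive[OF x0 l] lookup_ad_0
        lookup_Ad_positive(2)[OF x0 l, unfolded One_nat_def])
  have T1: "lookup (act ?T z) (Suc k, 1) = (if p = (k, 1) then c else 0)" if "k + 2 \<le> l" for k
  proof -
    have "lookup (act ?T z) (Suc k, 1) = lookup x (k, 1)"
      using that sum_normalized[OF z, of k] by (subst lookup_ad_1[OF x0]) auto
    then show ?thesis
      using that x1[of k] by simp
  qed
  show "lookup z' (Suc k, 1) = lookup z (Suc k, 1) + (if p = (k, 1) then c else 0)" if "k + 2 \<le> l"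
    unfolding z'_eq using T1[OF that] by (simp only: lookup_Ad_positive[OF x0 l])
  show "lookup z' (Suc k, 2) = lookup z (Suc k, 2) + (if p = (k, 2) then 2 * c else 0)
       + (if snd p = 1 \<and> fst p \<le> k then c * lookup z (Suc (k - fst p), 1) * (of_nat k + 1 - 2 * of_nat (fst p)) else 0)
       + (if snd p = 1 \<and> 2 * fst p = k then c ^ 2 / 2 - c / 2 else 0)" if k: "k + 3 \<le> l"
  proof -
    have sum1: "(\<Sum>i\<le>Suc k. lookup x (i, 1) * lookup w (Suc k - i, 1) * (of_nat (Suc k) - 2 * of_nat i))
       = (if snd p = 1 \<and> fst p \<le> k then c * lookup w (Suc (k - fst p), 1) * (of_nat k + 1 - 2 * of_nat (fst p)) else 0)"
      if "lookup w (0, 1) = 0" for w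
    proof -
      have "(\<Sum>i\<le>Suc k. lookup x (i, 1) * lookup w (Suc k - i, 1) * (of_nat (Suc k) - 2 * of_nat i))
        = (\<Sum>i\<le>Suc k. if i = fst p then (if snd p = 1 then c * lookup w (Suc k - i, 1) * (of_nat (Suc k) - 2 * of_nat i) else 0) else 0)"
        using k by (intro sum.cong refl) (auto simp: x1[unfolded One_nat_def] prod_eq_iff)
      also have "\<dots> = (if fst p \<le> Suc k \<and> snd p = 1 then c * lookup w (Suc k - fst p, 1) * (of_nat (Suc k) - 2 * of_nat (fst p)) else 0)"
        by (simp del: sum.atMost_Suc of_nat_Suc)
      finally show ?thesis
        using that by (cases "fst p \<le> k") (auto simp: Suc_diff_le le_Suc_eq)
    qed
    have sum2: "(\<Sum>i\<le>Suc k. lookup x (i, 2) * lookup z (Suc k - i, 0) * of_nat (Suc k - i)) = lookup x (k, 2)"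
      using k z by (intro sum_normalized) auto
    have "(\<Sum>i\<le>Suc k. lookup x (i, 2) * lookup (act ?T z) (Suc k - i, 0) * of_nat (Suc k - i)) = 0"
      using lookup_ad_power_zero[OF x0, of 0 1] by simp
    then have TT: "lookup (act ?T (act ?T z)) (Suc k, 2)
        = (if snd p = 1 \<and> fst p \<le> k then c * lookup (act ?T z) (Suc (k - fst p), 1) * (of_nat k + 1 - 2 * of_nat (fst p)) else 0)"
      using k sum1[of "act ?T z"] by (simp only: lookup_ad_2[OF x0] lookup_ad_0)
    have TT': "lookup (act ?T (act ?T z)) (Suc k, 2) = (if snd p = 1 \<and> 2 * fst p = k then c ^ 2 else 0)"
    proof (cases "snd p = 1 \<and> fst p \<le> k")
      case True
      then show ?thesis
        using k unfolding TT by (subst T1) (auto simp: prod_eq_iff power2_eq_square)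
    qed (auto simp: TT)
    have T2: "lookup (act ?T z) (Suc k, 2)
        = (if snd p = 1 \<and> fst p \<le> k then c * lookup z (Suc (k - fst p), 1) * (of_nat k + 1 - 2 * of_nat (fst p)) else 0)
          + 2 * lookup x (k, 2)"
    proof -
      have "lookup z (0, 1) = 0"
        using z by (simp add: normalized_def)
      then show ?thesis
        using k by (subst lookup_ad_2[OF x0]) (simp, simp only: sum1 sum2)
    qed
    have X2: "lookup x (k, 2) = (if p = (k, 2) then c else if snd p = 1 \<and> 2 * fst p = k then - c / 4 else 0)"
      using k by (intro x2) simp
    show ?thesis
      unfolding z'_eq lookup_Ad_positive(3)[OF x0 l] T2 TT' X2 by auto
  qed
qed

text \<open>
  The adjoint action of \<open>dilog (1, 0)\<close> fixes \<open>X (1, 0)\<close>, so that the exponents at points \<open>(a, 1)\<close> and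
  \<open>(a, 2)\<close> can be read off the image of this vector.
\<close>

definition orbit :: "nat \<Rightarrow> (nat \<times> nat \<Rightarrow> rat) \<Rightarrow> (nat \<times> nat) list \<Rightarrow> lie" where
  "orbit l u ps = act (prod_list (map (\<lambda>p. Ad l (scale (u p) (dilog p l))) ps)) (X (1, 0))"

lemma orbit_Nil [simp]: "orbit l u [] = X (1, 0)"
  by (simp add: orbit_def)

lemma orbit_Cons [simp]: "orbit l u (p # ps) = act (Ad l (scale (u p) (dilog p l))) (orbit l u ps)"
  by (simp add: orbit_def)

lemma normalized_orbit:
  "2 \<le> l \<Longrightarrow> \<forall>p\<in>set ps. snd p \<noteq> 0 \<Longrightarrow> normalized l (orbit l u ps)"
  by (induction ps) (auto simp: normalized_X[unfolded One_nat_def] intro!: Ad_dilog_positive(1))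

lemma lookup_orbit_1:
  assumes "k + 2 \<le> l" "distinct ps" "\<forall>p\<in>set ps. snd p \<noteq> 0"
  shows "lookup (orbit l u ps) (Suc k, 1) = (if (k, 1) \<in> set ps then u (k, 1) else 0)"
  using assms(2,3)
proof (induction ps)
  case (Cons p ps)
  have "lookup (orbit l u (p # ps)) (Suc k, 1) = lookup (orbit l u ps) (Suc k, 1) + (if p = (k, 1) then u p else 0)"
    unfolding orbit_Cons
    using Cons.prems assms(1) by (intro Ad_dilog_positive(2) normalized_orbit) auto
  then show ?case
    using Cons by auto
qed (simp add: lookup_single)

lemma Nplus_less_level_1: "Nplus_less (i, 1) (j, 1) \<Longrightarrow> j < i"
  by (auto simp: Nplus_less_def Nplus_le_def skew_def)

text \<open>The leftmost factor acts last, so (i, 1) acts on what (k - i, 1) has produced exactly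
  when it stands before it, that is when k - i < i. The case 2i = k is the action of one factor on
  its own contribution.\<close>

lemma lookup_orbit_2:
  assumes k: "k + 3 \<le> l" and "sorted_wrt Nplus_less ps" "distinct ps" "\<forall>p\<in>set ps. snd p \<noteq> 0"
  shows "lookup (orbit l u ps) (Suc k, 2) = (if (k, 2) \<in> set ps then 2 * u (k, 2) else 0) +
    (\<Sum>i\<le>k. if (i, 1) \<in> set ps then
       (if 2 * i = k then u (i, 1) ^ 2 / 2 - u (i, 1) / 2 else 0)
       + (if (k - i, 1) \<in> set ps \<and> k < 2 * i then u (i, 1) * u (k - i, 1) * (of_nat k + 1 - 2 * of_nat i) else 0)
     else 0)"
  using assms(2-)
proof (induction ps)
  case Nil
  then show ?case
    by (simp add: lookup_single)
next
  case (Cons p ps)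
  let ?sq = "\<lambda>i. if 2 * i = k then u (i, 1) ^ 2 / 2 - u (i, 1) / 2 else 0"
  let ?pr = "\<lambda>A i. if (k - i, 1) \<in> A \<and> k < 2 * i then u (i, 1) * u (k - i, 1) * (of_nat k + 1 - 2 * of_nat i) else 0"
  let ?f = "\<lambda>A i. if (i, 1) \<in> A then ?sq i + ?pr A i else 0"
  have IH: "lookup (orbit l u ps) (Suc k, 2) = (if (k, 2) \<in> set ps then 2 * u (k, 2) else 0) + (\<Sum>i\<le>k. ?f (set ps) i)"
    using Cons by simp
  have step: "lookup (orbit l u (p # ps)) (Suc k, 2) = lookup (orbit l u ps) (Suc k, 2) + (if p = (k, 2) then 2 * u p else 0)
       + (if snd p = 1 \<and> fst p \<le> k then u p * lookup (orbit l u ps) (Suc (k - fst p), 1) * (of_nat k + 1 - 2 * of_nat (fst p)) else 0)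
       + (if snd p = 1 \<and> 2 * fst p = k then u p ^ 2 / 2 - u p / 2 else 0)"
    unfolding orbit_Cons
    using Cons.prems k by (intro Ad_dilog_positive(3) normalized_orbit) auto
  show ?case
  proof (cases "snd p = 1")
    case False
    then have mem: "(i, 1) \<in> set (p # ps) \<longleftrightarrow> (i, 1) \<in> set ps" for i
      by auto
    have "(\<Sum>i\<le>k. ?f (set (p # ps)) i) = (\<Sum>i\<le>k. ?f (set ps) i)"
      by (simp only: mem)
    then show ?thesis
      using step IH False Cons.prems by auto
  next
    case True
    define i where "i = fst p"
    have p: "p = (i, 1)"
      using True by (simp add: i_def prod_eq_iff)
    have less: "j < i" if "(j, 1) \<in> set ps" for j
      using Cons.prems that p by (auto intro!: Nplus_less_level_1)
    have notin: "(i, 1) \<notin> set ps"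
      using Cons.prems p by auto
    \<comment> \<open>An old summand j could change only through k - j = i; but i > j, whereas k <
      2j means k - j < j.\<close>
    have other: "?f (set (p # ps)) j = ?f (set ps) j" if "j \<noteq> i" "j \<le> k" for j
    proof (cases "(j, 1) \<in> set ps")
      case True
      then have "j < i"
        by (rule less)
      then have "(k - j, 1) = p \<Longrightarrow> \<not> k < 2 * j"
        using p that by auto
      then show ?thesis
        using that p by auto
    qed (use that p in auto)
    have self: "?f (set (p # ps)) i = ?sq i + (if (k - i, 1) \<in> set ps then u (i, 1) * u (k - i, 1) * (of_nat k + 1 - 2 * of_nat i) else 0)"
      if "i \<le> k"
      using that less[of "k - i"] p by auto
    have sum: "(\<Sum>j\<le>k. ?f (set (p # ps)) j) = (\<Sum>j\<le>k. ?f (set ps) j) + (if i \<le> k then ?f (set (p # ps)) i else 0)"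
    proof (cases "i \<le> k")
      case True
      have "(\<Sum>j\<le>k. ?f (set (p # ps)) j) = ?f (set (p # ps)) i + (\<Sum>j\<in>{..k} - {i}. ?f (set (p # ps)) j)"
        using True by (intro sum.remove) auto
      moreover have "(\<Sum>j\<in>{..k} - {i}. ?f (set (p # ps)) j) = (\<Sum>j\<in>{..k} - {i}. ?f (set ps) j)"
        by (intro sum.cong refl other) auto
      moreover have "(\<Sum>j\<le>k. ?f (set ps) j) = ?f (set ps) i + (\<Sum>j\<in>{..k} - {i}. ?f (set ps) j)"
        using True by (intro sum.remove) auto
      ultimately show ?thesis
        using True notin by simp
    next
      case False
      then have "(\<Sum>j\<le>k. ?f (set (p # ps)) j) = (\<Sum>j\<le>k. ?f (set ps) j)"
        by (intro sum.cong refl other) auto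
      then show ?thesis
        using False by simp
    qed
    have orbit1: "lookup (orbit l u ps) (Suc (k - i), 1) = (if (k - i, 1) \<in> set ps then u (k - i, 1) else 0)"
      using Cons.prems k by (intro lookup_orbit_1) auto
    have "(k, 2) \<in> set (p # ps) \<longleftrightarrow> (k, 2) \<in> set ps"
      using p by auto
    then show ?thesis
      unfolding step IH sum using p orbit1 self by (auto simp: algebra_simps)
  qed
qed

text \<open>Multiplication by (1 + x)^c undoes (1 + x)^(-c), and coefficient k + 1 needs the product
  only up to that order.\<close>

lemma fps_binomial_solve:
  fixes r :: "rat fps"
  assumes "\<And>i. i \<le> Suc k \<Longrightarrow> (fps_binomial (- c) * r) $ i = (if i = 1 then s else 0)"
  shows "r $ Suc k = (c gchoose k) * s"
proof -
  have "fps_binomial c * fps_binomial (- c) = (1 :: rat fps)"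
    by (simp flip: fps_binomial_add_mult)
  then have "r $ Suc k = (fps_binomial c * (fps_binomial (- c) * r)) $ Suc k"
    by (simp flip: mult.assoc)
  also have "\<dots> = (fps_binomial c * (fps_const s * fps_X)) $ Suc k"
    by (rule fps_mult_nth_cong) (simp add: assms fps_X_def)
  also have "\<dots> = (fps_const s * (fps_X * fps_binomial c)) $ Suc k"
    by (simp only: mult_ac)
  finally show ?thesis
    by simp
qed

lemma act_Ad_dilog_10: "act (Ad l (scale c (dilog (1, 0) l))) (X (1, 0)) = X (1, 0)"
proof -
  let ?T = "ad (rank2 l) (dilog (1, 0) l)"
  have "act ?T (X (1, 0)) = 0"
  proof (rule poly_mapping_eqI)
    fix p :: "nat \<times> nat"
    obtain a b where p: "p = (a, b)"
      by (cases p)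
    show "lookup (act ?T (X (1, 0))) p = lookup 0 p"
    proof (cases "(a, b) \<in> rank2 l")
      case True
      have "row b (X (1, 0)) = 0" if "b \<noteq> 0"
        using that by (intro fps_ext) (simp add: lookup_single)
      then have "fps_const (- of_nat b) * fps_ln 1 * row b (X (1, 0)) = 0"
        by (cases "b = 0") simp_all
      then show ?thesis
        unfolding p lookup_ad_dilog_10[OF True] by (simp only: fps_zero_nth lookup_zero)
    next
      case False
      then show ?thesis
        unfolding p lookup_ad by simp
    qed
  qed
  then have "act (?T ^ k) (X (1, 0)) = (if k = 0 then X (1, 0) else 0)" for k
    by (cases k) (simp_all add: power_Suc2 del: power_Suc One_nat_def)
  then show ?thesis
    unfolding Ad_scale act_app by (subst sum.remove[of _ 0]) auto
qed

text \<open>As [1,0]^m fixes X_(1,0), the factorization applied to this vector reads w = [1,0]^m v,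
  where w is its image under [0,1]^n. Rows 1 and 2 of w have their only entry in column 1, and row b
  of v is (1 + x)^(bm) times row b of w.\<close>

lemma lookup_orbit_positive_points:
  fixes m n :: nat
  assumes "2 \<le> l"
  defines "v \<equiv> orbit l (exponents m n) (positive_points l)"
  shows "k + 2 \<le> l \<Longrightarrow> lookup v (Suc k, 1) = of_nat (m choose k) * of_nat n"
    "k + 3 \<le> l \<Longrightarrow> lookup v (Suc k, 2) = of_nat (2 * m choose k) * (of_nat n ^ 2 / 2 - of_nat n / 2)"
proof -
  let ?w = "act (Ad l (scale (of_nat n) (dilog (0, 1) l))) (X (1, 0))"
  have "?w = act (Ad l (scale (of_nat m) (dilog (1, 0) l))) v"
    using arg_cong[OF Ad_exponents[of l n m], of "\<lambda>T. act T (X (1, 0))"] assms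
    by (simp add: act_Ad_dilog_10[unfolded One_nat_def] orbit_def)
  then have row: "(fps_binomial (- (of_nat b * of_nat m)) * row b v) $ a = lookup ?w (a, b)"
    if "(a, b) \<in> rank2 l" for a b
    using lookup_Ad_dilog_10[OF that, of "of_nat m" v] by simp
  have p: "snd (0 :: nat, 1 :: nat) \<noteq> 0"
    by simp
  note w = Ad_dilog_positive[OF p normalized_X assms(1), where c = "of_nat n"]
  have w1: "lookup ?w (a, 1) = (if a = 1 then of_nat n else 0)" if "a + 1 \<le> l" for a
    using that w(1) w(2)[of "a - 1"] by (cases a) (auto simp: normalized_def lookup_single)
  \<comment> \<open>The entry is c^2/2 - c/2 with c = n, that is n choose 2: the self-interaction of
    p = (0, 1) at k = 0.\<close>
  have w2: "lookup ?w (a, 2) = (if a = 1 then of_nat n ^ 2 / 2 - of_nat n / 2 else 0)" if "a + 2 \<le> l" for a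
    using that w(1) w(3)[of "a - 1"] by (cases a) (auto simp: normalized_def lookup_single)
  show "lookup v (Suc k, 1) = of_nat (m choose k) * of_nat n" if "k + 2 \<le> l"
  proof -
    have "row 1 v $ Suc k = (of_nat 1 * of_nat m gchoose k) * of_nat n"
      using that by (intro fps_binomial_solve) (subst row, auto simp: rank2_def deg_def w1[unfolded One_nat_def])
    then show ?thesis
      by (simp add: binomial_gbinomial)
  qed
  show "lookup v (Suc k, 2) = of_nat (2 * m choose k) * (of_nat n ^ 2 / 2 - of_nat n / 2)" if "k + 3 \<le> l"
  proof -
    have "row 2 v $ Suc k = (of_nat 2 * of_nat m gchoose k) * (of_nat n ^ 2 / 2 - of_nat n / 2)"
      using that by (intro fps_binomial_solve) (subst row, auto simp: rank2_def deg_def w2[unfolded One_nat_def])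
    then show ?thesis
      by (simp add: binomial_gbinomial)
  qed
qed

lemma exponents_level_2:
  "2 * exponents m n (a, 2) +
    (\<Sum>i\<le>a. (if 2 * i = a then (of_nat n * of_nat (m choose i)) ^ 2 / 2 - of_nat n * of_nat (m choose i) / 2 else 0)
       + (if a < 2 * i then of_nat n ^ 2 * of_nat (m choose i) * of_nat (m choose (a - i)) * (of_nat a + 1 - 2 * of_nat i) else 0))
   = of_nat (2 * m choose a) * (of_nat n ^ 2 / 2 - of_nat n / 2)"
proof -
  let ?u = "exponents m n"
  \<comment> \<open>The degree of (a + 1, 2), where the exponent at (a, 2) is read off.\<close>
  define l where "l = a + 3"
  let ?ps = "positive_points l"
  have mem: "(i, 1) \<in> set ?ps" if "i \<le> a" for i
    using that by (auto simp: positive_points_def sorted_points l_def deg_def Nplus_def)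
  have mem2: "(a, 2) \<in> set ?ps"
    by (auto simp: positive_points_def sorted_points l_def deg_def Nplus_def)
  have ps: "sorted_wrt Nplus_less ?ps" "distinct ?ps" "\<forall>p\<in>set ?ps. snd p \<noteq> 0"
    by (auto simp: positive_points_def sorted_points(1) sorted_wrt_filter distinct_sorted_points)
  have l: "2 \<le> l" "a + 3 \<le> l"
    by (simp_all add: l_def)
  have u: "?u (i, 1) = of_nat n * of_nat (m choose i)" if "i \<le> a" for i
    using lookup_orbit_1[of i l ?ps ?u] lookup_orbit_positive_points(1)[OF l(1), of i m n] ps mem[OF that] that
    by (simp add: l_def mult.commute)
  have "lookup (orbit l ?u ?ps) (Suc a, 2) = 2 * ?u (a, 2) +
    (\<Sum>i\<le>a. if (i, 1) \<in> set ?ps then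
       (if 2 * i = a then ?u (i, 1) ^ 2 / 2 - ?u (i, 1) / 2 else 0)
       + (if (a - i, 1) \<in> set ?ps \<and> a < 2 * i then ?u (i, 1) * ?u (a - i, 1) * (of_nat a + 1 - 2 * of_nat i) else 0)
     else 0)"
    unfolding lookup_orbit_2[OF l(2) ps] if_P[OF mem2] ..
  also have "(\<Sum>i\<le>a. if (i, 1) \<in> set ?ps then
       (if 2 * i = a then ?u (i, 1) ^ 2 / 2 - ?u (i, 1) / 2 else 0)
       + (if (a - i, 1) \<in> set ?ps \<and> a < 2 * i then ?u (i, 1) * ?u (a - i, 1) * (of_nat a + 1 - 2 * of_nat i) else 0)
     else 0)
    = (\<Sum>i\<le>a. (if 2 * i = a then (of_nat n * of_nat (m choose i)) ^ 2 / 2 - of_nat n * of_nat (m choose i) / 2 else 0)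
       + (if a < 2 * i then of_nat n ^ 2 * of_nat (m choose i) * of_nat (m choose (a - i)) * (of_nat a + 1 - 2 * of_nat i) else 0))"
  proof (intro sum.cong refl)
    fix i assume "i \<in> {..a}"
    then have "i \<le> a" "a - i \<le> a"
      by auto
    then show "(if (i, 1) \<in> set ?ps then
       (if 2 * i = a then ?u (i, 1) ^ 2 / 2 - ?u (i, 1) / 2 else 0)
       + (if (a - i, 1) \<in> set ?ps \<and> a < 2 * i then ?u (i, 1) * ?u (a - i, 1) * (of_nat a + 1 - 2 * of_nat i) else 0)
     else 0) = (if 2 * i = a then (of_nat n * of_nat (m choose i)) ^ 2 / 2 - of_nat n * of_nat (m choose i) / 2 else 0)
       + (if a < 2 * i then of_nat n ^ 2 * of_nat (m choose i) * of_nat (m choose (a - i)) * (of_nat a + 1 - 2 * of_nat i) else 0)"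
      by (simp only: mem u if_True simp_thms) (simp add: power2_eq_square mult_ac)
  qed
  finally show ?thesis
    using lookup_orbit_positive_points(2)[OF l, of m n] by simp
qed

section \<open>Binomial sums\<close>

text \<open>Both sides count pairs of subsets A, B of an m-set with i and a - i elements. If the
  union has k elements, the symmetric difference has 2k - a of them, and i + k - a of these lie in
  A.\<close>

lemma binomial_mult_expand:
  assumes "i \<le> a"
  shows "(m choose i) * (m choose (a - i)) = (\<Sum>k\<in>{k. k \<le> a \<and> a \<le> 2 * k}.
    (m choose k) * (k choose (2 * k - a)) * (if i \<le> k \<and> a - k \<le> i then (2 * k - a) choose (i + k - a) else 0))"
proof -
  have "(m choose i) * (m choose (a - i)) = (\<Sum>k\<in>{i..a}. (m choose k) * ((k choose i) * (i choose (a - k))))"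
  proof (cases "i \<le> m")
    case True
    \<comment> \<open>Vandermonde splits B into t elements outside A and the rest inside; i + t is
      the size of the union.\<close>
    have "(m choose (a - i)) = (\<Sum>t\<le>a - i. (m - i choose t) * (i choose (a - i - t)))"
      using vandermonde[of "m - i" i "a - i"] True by simp
    then have "(m choose i) * (m choose (a - i)) = (\<Sum>t\<le>a - i. (m choose i) * (m - i choose t) * (i choose (a - i - t)))"
      by (simp add: sum_distrib_left mult.assoc)
    also have "\<dots> = (\<Sum>t\<le>a - i. (m choose (i + t)) * (((i + t) choose i) * (i choose (a - (i + t)))))"
    proof (intro sum.cong refl)
      fix t
      have "(m choose i) * (m - i choose t) = (m choose (i + t)) * ((i + t) choose i)"
      proof (cases "i + t \<le> m")
        case True
        then show ?thesis
          using choose_mult[of i "i + t" m] by simp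
      qed (use True in \<open>simp add: binomial_eq_0\<close>)
      then show "(m choose i) * (m - i choose t) * (i choose (a - i - t))
          = (m choose (i + t)) * (((i + t) choose i) * (i choose (a - (i + t))))"
        by (simp add: mult.assoc)
    qed
    also have "\<dots> = (\<Sum>k\<in>{i..a}. (m choose k) * ((k choose i) * (i choose (a - k))))"
      using assms by (intro sum.reindex_bij_witness[of _ "\<lambda>k. k - i" "\<lambda>t. i + t"]) auto
    finally show ?thesis .
  next
    case False
    then have "(\<Sum>k\<in>{i..a}. (m choose k) * ((k choose i) * (i choose (a - k)))) = 0"
      by (intro sum.neutral) (auto simp: binomial_eq_0)
    then show ?thesis
      using False by (simp add: binomial_eq_0)
  qed
  also have "\<dots> = (\<Sum>k\<in>{k. k \<le> a \<and> a \<le> 2 * k \<and> i \<le> k \<and> a - k \<le> i}. (m choose k) * ((k choose i) * (i choose (a - k))))"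
    by (rule sum.mono_neutral_right) (auto simp: binomial_eq_0)
  also have "\<dots> = (\<Sum>k\<in>{k. k \<le> a \<and> a \<le> 2 * k \<and> i \<le> k \<and> a - k \<le> i}. (m choose k) * (k choose (2 * k - a)) * ((2 * k - a) choose (i + k - a)))"
  proof (intro sum.cong refl)
    fix k assume "k \<in> {k. k \<le> a \<and> a \<le> 2 * k \<and> i \<le> k \<and> a - k \<le> i}"
    then have k: "k \<le> a" "a \<le> 2 * k" "i \<le> k" "a - k \<le> i"
      by auto
    have "(k choose i) * (i choose (a - k)) = (k choose (a - k)) * ((k - (a - k)) choose (i - (a - k)))"
      using k by (intro choose_mult) auto
    moreover have "(k choose (a - k)) = (k choose (2 * k - a))"
      using k binomial_symmetric[of "a - k" k] by (simp add: mult_2)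
    moreover have "k - (a - k) = 2 * k - a" "i - (a - k) = i + k - a"
      using k by auto
    ultimately show "(m choose k) * ((k choose i) * (i choose (a - k)))
        = (m choose k) * (k choose (2 * k - a)) * ((2 * k - a) choose (i + k - a))"
      by simp
  qed
  also have "\<dots> = (\<Sum>k\<in>{k. k \<le> a \<and> a \<le> 2 * k}.
    (m choose k) * (k choose (2 * k - a)) * (if i \<le> k \<and> a - k \<le> i then (2 * k - a) choose (i + k - a) else 0))"
    by (rule sum.mono_neutral_cong_left) auto
  finally show ?thesis .
qed

text \<open>The inner index r = i + k - a is the number of elements that lie in the first set
  only.\<close>

lemma sum_binomial_mult:
  fixes w :: "nat \<Rightarrow> rat"
  shows "(\<Sum>i\<le>a. w i * of_nat (m choose i) * of_nat (m choose (a - i)))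
    = (\<Sum>k\<in>{k. k \<le> a \<and> a \<le> 2 * k}. of_nat (m choose k) * of_nat (k choose (2 * k - a)) *
        (\<Sum>r\<le>2 * k - a. w (r + (a - k)) * of_nat ((2 * k - a) choose r)))"
proof -
  let ?K = "{k. k \<le> a \<and> a \<le> 2 * k}"
  let ?g = "\<lambda>k. of_nat (m choose k) * of_nat (k choose (2 * k - a)) :: rat"
  let ?e = "\<lambda>k i. if i \<le> k \<and> a - k \<le> i then of_nat ((2 * k - a) choose (i + k - a)) else 0 :: rat"
  have "w i * of_nat (m choose i) * of_nat (m choose (a - i)) = (\<Sum>k\<in>?K. ?g k * (w i * ?e k i))" if "i \<le> a" for i
  proof -
    have "(of_nat (m choose i) * of_nat (m choose (a - i)) :: rat) = (\<Sum>k\<in>?K. ?g k * ?e k i)"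
      by (simp only: of_nat_mult [symmetric] binomial_mult_expand[OF that] of_nat_sum if_distrib[of of_nat] of_nat_0)
        (simp add: of_nat_mult if_distrib cong: if_cong)
    then show ?thesis
      by (simp add: mult.assoc sum_distrib_left mult.left_commute)
  qed
  then have "(\<Sum>i\<le>a. w i * of_nat (m choose i) * of_nat (m choose (a - i)))
      = (\<Sum>i\<le>a. \<Sum>k\<in>?K. ?g k * (w i * ?e k i))"
    by (intro sum.cong refl) auto
  also have "\<dots> = (\<Sum>k\<in>?K. ?g k * (\<Sum>i\<le>a. w i * ?e k i))"
    by (subst sum.swap) (simp add: sum_distrib_left)
  also have "\<dots> = (\<Sum>k\<in>?K. ?g k * (\<Sum>r\<le>2 * k - a. w (r + (a - k)) * of_nat ((2 * k - a) choose r)))"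
  proof (intro sum.cong refl)
    fix k assume "k \<in> ?K"
    then have k: "k \<le> a" "a \<le> 2 * k"
      by auto
    have "(\<Sum>i\<le>a. w i * ?e k i) = (\<Sum>i\<in>{a - k..k}. w i * of_nat ((2 * k - a) choose (i + k - a)))"
      using k by (intro sum.mono_neutral_cong_right) auto
    also have "\<dots> = (\<Sum>r\<le>2 * k - a. w (r + (a - k)) * of_nat ((2 * k - a) choose r))"
      using k by (intro sum.reindex_bij_witness[of _ "\<lambda>r. r + (a - k)" "\<lambda>i. i + k - a"]) auto
    finally show "?g k * (\<Sum>i\<le>a. w i * ?e k i)
        = ?g k * (\<Sum>r\<le>2 * k - a. w (r + (a - k)) * of_nat ((2 * k - a) choose r))"
      by (rule arg_cong)
  qed
  finally show ?thesis .
qed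

text \<open>With e = d - 1, absorption and Pascal's rule give (2j - d) (d choose j) = d ((e choose
  (j-1)) - (e choose j)), so the upper half telescopes.\<close>

lemma sum_upper_half_binomial:
  "(\<Sum>r\<le>d. (if d < 2 * r then 2 * of_nat r - of_nat d else 0) * of_nat (d choose r) :: rat)
    = of_nat d * of_nat ((d - 1) choose (d div 2))"
proof (cases d)
  case (Suc e)
  let ?f = "\<lambda>i. - (of_nat d * of_nat (e choose i)) :: rat"
  have summand: "(2 * of_nat (Suc i) - of_nat d) * of_nat (d choose Suc i) = ?f (Suc i) - ?f i" for i
  proof -
    have "Suc i * (d choose Suc i) = d * (e choose i)"
      unfolding Suc using Suc_times_binomial_eq[of e i] by (simp add: mult.commute)
    then have 1: "(of_nat (Suc i) * of_nat (d choose Suc i) :: rat) = of_nat d * of_nat (e choose i)"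
      by (simp only: of_nat_mult [symmetric])
    have "d choose Suc i = (e choose i) + (e choose Suc i)"
      unfolding Suc by simp
    then have 2: "(of_nat (d choose Suc i) :: rat) = of_nat (e choose i) + of_nat (e choose Suc i)"
      by simp
    have "(2 * of_nat (Suc i) - of_nat d) * of_nat (d choose Suc i)
       = (2 :: rat) * (of_nat (Suc i) * of_nat (d choose Suc i)) - of_nat d * of_nat (d choose Suc i)"
      by (simp only: left_diff_distrib mult.assoc)
    also have "\<dots> = 2 * (of_nat d * of_nat (e choose i)) - of_nat d * of_nat (d choose Suc i)"
      by (simp only: 1)
    also have "\<dots> = ?f (Suc i) - ?f i"
      unfolding 2 by (simp add: algebra_simps)
    finally show ?thesis .
  qed
  have "(\<Sum>r\<le>d. (if d < 2 * r then 2 * of_nat r - of_nat d else 0) * of_nat (d choose r) :: rat)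
     = (\<Sum>i\<in>{d div 2..<d}. (2 * of_nat (Suc i) - of_nat d) * of_nat (d choose Suc i))"
  proof -
    have "(\<Sum>r\<le>d. (if d < 2 * r then 2 * of_nat r - of_nat d else 0) * of_nat (d choose r) :: rat)
       = (\<Sum>r\<in>{Suc (d div 2)..d}. (2 * of_nat r - of_nat d) * of_nat (d choose r))"
      by (intro sum.mono_neutral_cong_right) auto
    also have "\<dots> = (\<Sum>i\<in>{d div 2..<d}. (2 * of_nat (Suc i) - of_nat d) * of_nat (d choose Suc i))"
      by (intro sum.reindex_bij_witness[of _ Suc "\<lambda>r. r - 1"]) auto
    finally show ?thesis .
  qed
  also have "\<dots> = ?f d - ?f (d div 2)"
    unfolding summand by (rule sum_Suc_diff') simp
  finally show ?thesis
    using Suc by (simp add: binomial_eq_0)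
qed simp

lemma ceiling_half: "\<lceil>of_nat d / (2 :: rat)\<rceil> = int ((d + 1) div 2)"
proof (rule ceiling_unique)
  have "2 * ((d + 1) div 2) = d + d mod 2"
    by presburger
  then have "(2 * of_nat ((d + 1) div 2) :: rat) = of_nat d + of_nat (d mod 2)"
    by (metis of_nat_add of_nat_mult of_nat_numeral)
  moreover have "d mod 2 < 2"
    by simp
  then have "(of_nat (d mod 2) :: rat) \<le> 1"
    by (simp only: of_nat_le_1_iff)
  ultimately show "of_int (int ((d + 1) div 2)) - 1 < of_nat d / (2 :: rat)"
      "of_nat d / (2 :: rat) \<le> of_int (int ((d + 1) div 2))"
    by simp_all
qed

text \<open>Absorption lowers both entries by one, and ceiling(d/2) - 1 and floor(d/2) add up to d -
  1. This links the ceilings of the theorem to the telescoped form.\<close>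

lemma central_binomial_absorb:
  "((d + 1) div 2) * (d choose ((d + 1) div 2)) = d * ((d - 1) choose (d div 2))"
proof (cases d)
  case (Suc e)
  have half: "(d + 1) div 2 = Suc (e div 2)" "e - e div 2 = d div 2" "e div 2 \<le> e"
    using Suc by auto
  have "Suc (e div 2) * (Suc e choose Suc (e div 2)) = Suc e * (e choose (e div 2))"
    using Suc_times_binomial_eq[of e "e div 2"] by (simp only: mult.commute)
  also have "e choose (e div 2) = e choose (d div 2)"
    using binomial_symmetric[OF half(3)] half(2) by simp
  finally show ?thesis
    using Suc half(1) by simp
qed simp

theorem theorem7p8:
  fixes a m n :: nat
  assumes "a > 0"
  shows "exponents m n (a, 2) =
    (\<Sum>k\<in>{k::nat. (of_nat a :: rat) / 2 < of_nat k \<and> k \<le> a}.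
        of_int \<lceil>of_nat (2 * k - a) / (2::rat)\<rceil>
        * of_nat ((2 * k - a) choose nat \<lceil>of_nat (2 * k - a) / (2::rat)\<rceil>)
        * of_nat (k choose (2 * k - a)) * of_nat (m choose k) * of_nat (n choose 2))
    + (\<Sum>k\<in>{k::nat. (of_nat a :: rat) / 2 + 1 < of_nat k \<and> k \<le> a}.
        (of_nat (2 * k - a) / 2
           * of_nat ((2 * k - a - 1) choose nat \<lceil>of_nat (2 * k - a - 1) / (2::rat)\<rceil>)
         - 2 ^ (2 * k - a - 2))
        * of_nat (k choose (2 * k - a)) * of_nat (m choose k) * of_nat (n choose 1))"
proof -
  let ?K = "{k. k \<le> a \<and> a \<le> 2 * k}"
  let ?c = "\<lambda>i. of_nat (m choose i) :: rat"
  let ?N = "of_nat n :: rat"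
  let ?g = "\<lambda>k. of_nat (m choose k) * of_nat (k choose (2 * k - a)) :: rat"
  define h :: "nat \<Rightarrow> rat" where "h d = of_nat d * of_nat ((d - 1) choose (d div 2))" for d
  \<comment> \<open>\<open>S\<close> and \<open>H\<close> are the weighted and unweighted upper
    halves of the Vandermonde sum \<open>B\<close>; the middle terms \<open>M1\<close> and
    \<open>M2\<close> have no summand for odd a.\<close>
  define S where "S = (\<Sum>i\<le>a. (if a < 2 * i then 2 * of_nat i - of_nat a else 0) * ?c i * ?c (a - i))"
  define H where "H = (\<Sum>i\<le>a. (if a < 2 * i then 1 else 0) * ?c i * ?c (a - i))"
  define M1 where "M1 = (\<Sum>i\<le>a. if 2 * i = a then ?c i else 0)"
  define M2 where "M2 = (\<Sum>i\<le>a. if 2 * i = a then ?c i ^ 2 else 0)"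
  define B where "B = (of_nat (2 * m choose a) :: rat)"
  have B_sum: "B = (\<Sum>i\<le>a. 1 * ?c i * ?c (a - i))"
    using vandermonde[of m m a] by (simp add: B_def mult_2 flip: of_nat_mult of_nat_sum)
  have B_half: "B = 2 * H + M2"
  proof -
    have "(\<Sum>i\<le>a. (if 2 * i < a then 1 else 0) * ?c i * ?c (a - i)) = H"
      unfolding H_def by (intro sum.reindex_bij_witness[of _ "\<lambda>i. a - i" "\<lambda>i. a - i"]) auto
    moreover have "B = (\<Sum>i\<le>a. (if 2 * i < a then 1 else 0) * ?c i * ?c (a - i)
        + (if a < 2 * i then 1 else 0) * ?c i * ?c (a - i) + (if 2 * i = a then ?c i ^ 2 else 0))"
      unfolding B_sum by (intro sum.cong refl) (auto simp: power2_eq_square mult_2)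
    ultimately show ?thesis
      by (simp add: sum.distrib H_def M2_def)
  qed
  have "(\<Sum>i\<le>a. (if 2 * i = a then (?N * ?c i) ^ 2 / 2 - ?N * ?c i / 2 else 0)
       + (if a < 2 * i then ?N ^ 2 * ?c i * ?c (a - i) * (of_nat a + 1 - 2 * of_nat i) else 0))
    = (\<Sum>i\<le>a. ?N ^ 2 / 2 * (if 2 * i = a then ?c i ^ 2 else 0) - ?N / 2 * (if 2 * i = a then ?c i else 0)
       + (?N ^ 2 * ((if a < 2 * i then 1 else 0) * ?c i * ?c (a - i))
       - ?N ^ 2 * ((if a < 2 * i then 2 * of_nat i - of_nat a else 0) * ?c i * ?c (a - i))))"
    by (intro sum.cong refl) (auto simp: power_mult_distrib algebra_simps)
  also have "\<dots> = ?N ^ 2 / 2 * M2 - ?N / 2 * M1 + (?N ^ 2 * H - ?N ^ 2 * S)"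
    unfolding M2_def M1_def H_def S_def by (simp only: sum.distrib sum_subtractf sum_distrib_left)
  finally have "2 * exponents m n (a, 2) + (?N ^ 2 / 2 * M2 - ?N / 2 * M1 + (?N ^ 2 * H - ?N ^ 2 * S))
      = B * (?N ^ 2 / 2 - ?N / 2)"
    using exponents_level_2[of m n a] by (simp only: B_def)
  \<comment> \<open>The multiples of n^2 by \<open>H\<close> and \<open>M2\<close> cancel between
    the two sides; those of n regroup to \<open>B\<close>.\<close>
  then have u: "exponents m n (a, 2) = ?N ^ 2 / 2 * S - ?N / 4 * B + ?N / 4 * M1"
    unfolding B_half by (simp add: field_simps)
  \<comment> \<open>This separates n choose 2 from n; through n^2/2 = (n choose 2) + n/2 the sum
    \<open>S\<close> enters both parts of the result.\<close>
  have N2: "?N ^ 2 = 2 * of_nat (n choose 2) + ?N"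
  proof -
    have "2 * (n choose 2) = n * (n - 1)"
    proof -
      have "even (n * (n - 1))"
        by (cases n) auto
      then show ?thesis
        by (simp add: choose_two)
    qed
    then have "(2 * of_nat (n choose 2) :: rat) = ?N * of_nat (n - 1)"
      by (metis of_nat_mult of_nat_numeral)
    then show ?thesis
      by (cases n) (simp_all add: power2_eq_square algebra_simps)
  qed
  have S: "S = (\<Sum>k\<in>?K. ?g k * h (2 * k - a))"
  proof -
    have eq: "(\<Sum>r\<le>2 * k - a. (if a < 2 * (r + (a - k)) then 2 * of_nat (r + (a - k)) - of_nat a else 0) * of_nat ((2 * k - a) choose r))
        = h (2 * k - a)" if "k \<in> ?K" for k
    proof -
      have "(if a < 2 * (r + (a - k)) then 2 * of_nat (r + (a - k)) - of_nat a else 0)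
          = (if 2 * k - a < 2 * r then 2 * of_nat r - of_nat (2 * k - a) else 0 :: rat)" for r
        using that by (auto simp: of_nat_diff)
      then show ?thesis
        unfolding h_def sum_upper_half_binomial [symmetric] by simp
    qed
    show ?thesis
      unfolding S_def sum_binomial_mult by (intro sum.cong refl) (simp only: eq)
  qed
  have B: "B = (\<Sum>k\<in>?K. ?g k * 2 ^ (2 * k - a))"
  proof -
    have "(\<Sum>r\<le>d. 1 * of_nat (d choose r)) = (2 ^ d :: rat)" for d
      using choose_row_sum[of d] by (simp flip: of_nat_sum)
    then show ?thesis
      unfolding B_sum sum_binomial_mult by simp
  qed
  have M1: "M1 = (\<Sum>k\<in>?K. ?g k * (if 2 * k - a = 0 then 1 else 0))"
    unfolding M1_def by (intro sum.mono_neutral_cong_right) auto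
  have "exponents m n (a, 2) = (\<Sum>k\<in>?K. ?N ^ 2 / 2 * (?g k * h (2 * k - a)) - ?N / 4 * (?g k * 2 ^ (2 * k - a))
      + ?N / 4 * (?g k * (if 2 * k - a = 0 then 1 else 0)))"
    unfolding u S B M1 by (simp only: sum.distrib sum_subtractf sum_distrib_left)
  also have "\<dots> = (\<Sum>k\<in>?K. h (2 * k - a) * of_nat (k choose (2 * k - a)) * of_nat (m choose k) * of_nat (n choose 2)
      + (h (2 * k - a) / 2 - 2 ^ (2 * k - a) / 4 + (if 2 * k - a = 0 then 1 / 4 else 0))
        * of_nat (k choose (2 * k - a)) * of_nat (m choose k) * of_nat (n choose 1))"
    unfolding N2 by (intro sum.cong refl) (simp add: field_simps)
  also have "\<dots> = (\<Sum>k\<in>?K. h (2 * k - a) * of_nat (k choose (2 * k - a)) * of_nat (m choose k) * of_nat (n choose 2))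
      + (\<Sum>k\<in>?K. (h (2 * k - a) / 2 - 2 ^ (2 * k - a) / 4 + (if 2 * k - a = 0 then 1 / 4 else 0))
        * of_nat (k choose (2 * k - a)) * of_nat (m choose k) * of_nat (n choose 1))"
    by (rule sum.distrib)
  also have "(\<Sum>k\<in>?K. h (2 * k - a) * of_nat (k choose (2 * k - a)) * of_nat (m choose k) * of_nat (n choose 2))
    = (\<Sum>k\<in>{k::nat. (of_nat a :: rat) / 2 < of_nat k \<and> k \<le> a}.
        of_int \<lceil>of_nat (2 * k - a) / (2::rat)\<rceil>
        * of_nat ((2 * k - a) choose nat \<lceil>of_nat (2 * k - a) / (2::rat)\<rceil>)
        * of_nat (k choose (2 * k - a)) * of_nat (m choose k) * of_nat (n choose 2))"
  proof (rule sum.mono_neutral_cong_right)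
    have half: "(of_nat a :: rat) / 2 < of_nat k \<longleftrightarrow> a < 2 * k" for k
    proof -
      have "(of_nat a :: rat) / 2 < of_nat k \<longleftrightarrow> (of_nat a :: rat) < of_nat (2 * k)"
        by (simp add: mult.commute)
      then show ?thesis
        by (simp only: of_nat_less_iff)
    qed
    show "{k::nat. (of_nat a :: rat) / 2 < of_nat k \<and> k \<le> a} \<subseteq> ?K"
      unfolding half by auto
    show "\<forall>k\<in>?K - {k::nat. (of_nat a :: rat) / 2 < of_nat k \<and> k \<le> a}.
        h (2 * k - a) * of_nat (k choose (2 * k - a)) * of_nat (m choose k) * of_nat (n choose 2) = 0"
      unfolding half by (auto simp: h_def)
    show "h (2 * k - a) * of_nat (k choose (2 * k - a)) * of_nat (m choose k) * of_nat (n choose 2) =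
        of_int \<lceil>of_nat (2 * k - a) / (2::rat)\<rceil>
        * of_nat ((2 * k - a) choose nat \<lceil>of_nat (2 * k - a) / (2::rat)\<rceil>)
        * of_nat (k choose (2 * k - a)) * of_nat (m choose k) * of_nat (n choose 2)" for k
    proof -
      have "of_int \<lceil>of_nat d / (2::rat)\<rceil> * of_nat (d choose nat \<lceil>of_nat d / (2::rat)\<rceil>) = h d" for d
        unfolding ceiling_half h_def nat_int of_int_of_nat_eq of_nat_mult [symmetric] central_binomial_absorb ..
      then show ?thesis
        by simp
    qed
  qed auto
  also have "(\<Sum>k\<in>?K. (h (2 * k - a) / 2 - 2 ^ (2 * k - a) / 4 + (if 2 * k - a = 0 then 1 / 4 else 0))
        * of_nat (k choose (2 * k - a)) * of_nat (m choose k) * of_nat (n choose 1))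
    = (\<Sum>k\<in>{k::nat. (of_nat a :: rat) / 2 + 1 < of_nat k \<and> k \<le> a}.
        (of_nat (2 * k - a) / 2
           * of_nat ((2 * k - a - 1) choose nat \<lceil>of_nat (2 * k - a - 1) / (2::rat)\<rceil>)
         - 2 ^ (2 * k - a - 2))
        * of_nat (k choose (2 * k - a)) * of_nat (m choose k) * of_nat (n choose 1))"
  proof (rule sum.mono_neutral_cong_right)
    have half: "(of_nat a :: rat) / 2 + 1 < of_nat k \<longleftrightarrow> a + 2 < 2 * k" for k
    proof -
      have "(of_nat a :: rat) / 2 + 1 < of_nat k \<longleftrightarrow> (of_nat (a + 2) :: rat) < of_nat (2 * k)"
        by (simp add: field_simps)
      then show ?thesis
        by (simp only: of_nat_less_iff)
    qed
    show "{k::nat. (of_nat a :: rat) / 2 + 1 < of_nat k \<and> k \<le> a} \<subseteq> ?K"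
      unfolding half by auto
    \<comment> \<open>The origin of the bound a/2 + 1 < k: the coefficient vanishes for d = 0, 1, 2,
      where d = 0 uses the 1/4 from the middle term.\<close>
    have zero: "h d / 2 - 2 ^ d / 4 + (if d = 0 then 1 / 4 else 0) = 0" if "d \<le> 2" for d
    proof -
      have "d = 0 \<or> d = 1 \<or> d = 2"
        using that by linarith
      then show ?thesis
        by (elim disjE) (simp_all add: h_def)
    qed
    show "\<forall>k\<in>?K - {k::nat. (of_nat a :: rat) / 2 + 1 < of_nat k \<and> k \<le> a}.
        (h (2 * k - a) / 2 - 2 ^ (2 * k - a) / 4 + (if 2 * k - a = 0 then 1 / 4 else 0))
        * of_nat (k choose (2 * k - a)) * of_nat (m choose k) * of_nat (n choose 1) = 0"
    proof
      fix k assume "k \<in> ?K - {k::nat. (of_nat a :: rat) / 2 + 1 < of_nat k \<and> k \<le> a}"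
      then have "2 * k - a \<le> 2"
        unfolding half by auto
      then show "(h (2 * k - a) / 2 - 2 ^ (2 * k - a) / 4 + (if 2 * k - a = 0 then 1 / 4 else 0))
        * of_nat (k choose (2 * k - a)) * of_nat (m choose k) * of_nat (n choose 1) = 0"
        by (simp only: zero mult_zero_left)
    qed
    fix k assume "k \<in> {k::nat. (of_nat a :: rat) / 2 + 1 < of_nat k \<and> k \<le> a}"
    then have k: "a + 2 < 2 * k"
      unfolding half by simp
    \<comment> \<open>For d > 2 the ceiling of (d - 1)/2 is floor(d/2), and 2^d/4 is 2^(d - 2) with
      a genuine subtraction.\<close>
    have "h d / 2 - 2 ^ d / 4 + (if d = 0 then 1 / 4 else 0)
        = of_nat d / 2 * of_nat ((d - 1) choose nat \<lceil>of_nat (d - 1) / (2::rat)\<rceil>) - 2 ^ (d - 2)" if "2 < d" for d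
    proof -
      have "(d - 1 + 1) div 2 = d div 2"
        using that by simp
      moreover have "(2 ^ d :: rat) / 4 = 2 ^ (d - 2)"
      proof -
        have "d = 2 + (d - 2)"
          using that by simp
        then have "(2 :: rat) ^ d = 2 ^ 2 * 2 ^ (d - 2)"
          by (metis power_add)
        then show ?thesis
          by simp
      qed
      ultimately show ?thesis
        using that by (simp only: ceiling_half nat_int h_def) simp
    qed
    from this[of "2 * k - a"] k
    show "(h (2 * k - a) / 2 - 2 ^ (2 * k - a) / 4 + (if 2 * k - a = 0 then 1 / 4 else 0))
        * of_nat (k choose (2 * k - a)) * of_nat (m choose k) * of_nat (n choose 1) =
        (of_nat (2 * k - a) / 2
           * of_nat ((2 * k - a - 1) choose nat \<lceil>of_nat (2 * k - a - 1) / (2::rat)\<rceil>)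
         - 2 ^ (2 * k - a - 2))
        * of_nat (k choose (2 * k - a)) * of_nat (m choose k) * of_nat (n choose 1)"
      by simp
  qed auto
  finally show ?thesis .
qed

end
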